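(* Let $p\colon E\to B$ be a smooth vector bundle of rank $n\ge1$ over a compact manifold $B$ without boundary, $f\colon E\to\mathbb{R}$ a definite $2$-homogeneous $C^\infty$ function, $\mathbf{T}=f^{-1}([0;1])$ (so that $\partial\mathbf{T}=f^{-1}(1)$), and $\mathcal{F}=\{f^{-1}(t)\mid t\in[0;1]\}$ the partition of $\mathbf{T}$ into level sets of $f$. Then the homomorphism $$p_2\colon\mathcal{S}^{img}_{LR}(f)\to\mathcal{D}^{fol}(\mathcal{F}),\qquad p_2(\phi,h)=h,$$ induces an isomorphism of the short exact sequences $$1\to\mathcal{S}_R(f)\xrightarrow{\ j\ }\mathcal{S}^{img}_{LR}(f)\xrightarrow{\ p_1\ }\mathcal{D}^+([0;1])\to1,$$ $$1\to\mathcal{D}^{lp}(\mathcal{F})\hookrightarrow\mathcal{D}^{fol}(\mathcal{F})\xrightarrow{\ \sigma\ }\mathcal{D}^+([0;1])\to1,$$ being the identity on $\mathcal{S}_R(f)=\mathcal{D}^{lp}(\mathcal{F})$ and on $\mathcal{D}^+([0;1])$, where $p_1$ has the section $\widehat\theta$ and $\sigma$ has the section $\theta$; the inverse of $p_2$ is $\widehat\sigma$. Moreover, the pair $\bigl(\mathcal{D}^{lp}(\mathcal{F}),\mathcal{D}^{lp}(\mathcal{F},\partial\mathbf{T})\bigr)$ is a strong deformation retract of $\bigl(\mathcal{D}^{fol}(\mathcal{F}),\mathcal{D}^{fol}(\mathcal{F},\partial\mathbf{T})\bigr)$.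
   Context: $B$ is identified with the image of the zero section in $E$. $f\colon E\to\mathbb{R}$ is $k$-homogeneous if $f(tx)=t^kf(x)$ for all $t\ge0$, $x\in E$, and definite if $f(x)>0$ for all $x\in E\setminus B$. All diffeomorphism groups consist of $C^\infty$ diffeomorphisms and have the $C^\infty$ topology. $\mathcal{D}(\mathbf{T})$, $\mathcal{D}([0;1])$ are the groups of diffeomorphisms of $\mathbf{T}$ and $[0;1]$, and $\mathcal{D}^+([0;1])$ the subgroup of orientation preserving ones. $\mathcal{D}^{fol}(\mathcal{F})$ (resp. $\mathcal{D}^{lp}(\mathcal{F})$) is the group of diffeomorphisms of $\mathbf{T}$ sending each leaf of $\mathcal{F}$ onto a leaf (resp. onto itself); $\mathcal{D}^{fol}(\mathcal{F},\partial\mathbf{T})$ and $\mathcal{D}^{lp}(\mathcal{F},\partial\mathbf{T})$ are their subgroups of diffeomorphisms equal to the identity on $\partial\mathbf{T}$. With $f$ regarded as a function $\mathbf{T}\to[0;1]$, put $\mathcal{S}_R(f)=\{h\in\mathcal{D}(\mathbf{T})\mid f\circ h=f\}$ and $\mathcal{S}^{img}_{LR}(f)=\{(\phi,h)\in\mathcal{D}([0;1])\times\mathcal{D}(\mathbf{T})\mid\phi\circ f=f\circ h\}$, and let $j(h)=(\mathrm{id}_{[0;1]},h)$, $p_1(\phi,h)=\phi$. For $h\in\mathcal{D}^{fol}(\mathcal{F})$, $\sigma(h)\in\mathcal{D}^+([0;1])$ is the unique map with $\sigma(h)\circ f=f\circ h$; $\sigma$ is a continuous homomorphism. For $\phi\in\mathcal{D}^+([0;1])$,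 $\theta(\phi)\in\mathcal{D}^{fol}(\mathcal{F})$ is $\theta(\phi)(x)=[g_\phi(f(x))]^{1/2}x$, where $g_\phi(t)=\int_0^1\phi'(st)\,ds$; $\theta$ is a continuous homomorphism with $\phi\circ f=f\circ\theta(\phi)$. Put $\widehat\sigma(h)=(\sigma(h),h)$ and $\widehat\theta(\phi)=(\phi,\theta(\phi))$. *)

theory Defs
  imports "HOL-Analysis.Analysis" "HOL-Algebra.Group" "HOL-Algebra.Coset"
    "HOL-Algebra.Elementary_Groups" "HOL-Combinatorics.Permutations"
begin

section \<open>Smooth functions\<close>

text \<open>
  \<open>nderiv S f [v\<^sub>k, \<dots>, v\<^sub>1]\<close> is the iterated directional derivative of \<open>f\<close>, first along \<open>v\<^sub>1\<close> and
  last along \<open>v\<^sub>k\<close>. All derivatives are taken within \<open>S\<close>. Below, \<open>S\<close> is always an open set, an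
  interval, or the image in a chart of a domain with smooth boundary; derivatives within such sets
  are unique, at boundary points they are the one-sided ones.
\<close>

primrec nderiv ::
  "'a::real_normed_vector set \<Rightarrow> ('a \<Rightarrow> 'c::real_normed_vector) \<Rightarrow> 'a list \<Rightarrow> 'a \<Rightarrow> 'c" where
  "nderiv S f [] = f"
| "nderiv S f (v # vs) = (\<lambda>x. frechet_derivative (nderiv S f vs) (at x within S) v)"

definition smooth_on ::
  "'a::real_normed_vector set \<Rightarrow> ('a \<Rightarrow> 'c::real_normed_vector) \<Rightarrow> bool" where
  "smooth_on S f \<longleftrightarrow> (\<forall>vs. nderiv S f vs differentiable_on S)"


section \<open>Smooth manifolds\<close>

text \<open>
  A chart is a pair \<open>(U, c)\<close> of its domain and its coordinate map. The model space is a normed space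
  of class \<^class>\<open>heine_borel\<close>. By Riesz' theorem this means exactly that it is finite-dimensional;
  unlike \<^class>\<open>euclidean_space\<close>, this class does not exclude dimension 0.
\<close>

type_synonym ('a, 'm) chart = "'a set \<times> ('a \<Rightarrow> 'm)"

definition smooth_atlas ::
  "('a::topological_space, 'm::{real_normed_vector,heine_borel}) chart set \<Rightarrow> bool" where
  "smooth_atlas A \<longleftrightarrow>
     (\<Union>(U, c)\<in>A. U) = UNIV \<and>
     (\<forall>(U, c)\<in>A. open U \<and> open (c ` U) \<and> homeomorphism U (c ` U) c (inv_into U c)) \<and>
     (\<forall>(U, c)\<in>A. \<forall>(V, d)\<in>A. smooth_on (c ` (U \<inter> V)) (d \<circ> inv_into U c))"

definition line_atlas :: "(real, real) chart set" where
  "line_atlas = {(UNIV, id)}"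

definition smooth_map ::
  "('a::topological_space, 'm::real_normed_vector) chart set \<Rightarrow> 'a set \<Rightarrow>
   ('c::topological_space, 'k::real_normed_vector) chart set \<Rightarrow> 'c set \<Rightarrow> ('a \<Rightarrow> 'c) \<Rightarrow> bool" where
  "smooth_map A X A' Y h \<longleftrightarrow>
     continuous_on X h \<and> h ` X \<subseteq> Y \<and>
     (\<forall>(U, c)\<in>A. \<forall>(V, d)\<in>A'. smooth_on (c ` (U \<inter> X \<inter> h -` V)) (d \<circ> h \<circ> inv_into U c))"

text \<open>
  The \<open>C\<^sup>\<infinity>\<close> topology on the smooth maps from \<open>X\<close> to \<open>Y\<close>: a subbasic neighbourhood of \<open>h\<close> consists
  of the maps whose derivatives of order at most \<open>r\<close>, in given charts and on a given compact set \<open>K\<close>,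
  are \<open>\<epsilon>\<close>-close to those of \<open>h\<close>.
\<close>

definition cinf_nbhd ::
  "('a::topological_space, 'm::real_normed_vector) chart set \<Rightarrow> 'a set \<Rightarrow>
   ('c::topological_space, 'k::real_normed_vector) chart set \<Rightarrow> 'c set \<Rightarrow> ('a \<Rightarrow> 'c) \<Rightarrow>
   ('a, 'm) chart \<Rightarrow> ('c, 'k) chart \<Rightarrow> 'a set \<Rightarrow> nat \<Rightarrow> real \<Rightarrow> ('a \<Rightarrow> 'c) set" where
  "cinf_nbhd A X A' Y h = (\<lambda>(U, c) (V, d) K r \<epsilon>.
     {g. smooth_map A X A' Y g \<and> g ` K \<subseteq> V \<and>
         (\<forall>vs. length vs \<le> r \<and> (\<forall>v\<in>set vs. norm v \<le> 1) \<longrightarrow>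
           (\<forall>y\<in>c ` K. norm (nderiv (c ` (U \<inter> X)) (d \<circ> g \<circ> inv_into U c) vs y
                          - nderiv (c ` (U \<inter> X)) (d \<circ> h \<circ> inv_into U c) vs y) < \<epsilon>))})"

definition cinf_topology ::
  "('a::topological_space, 'm::real_normed_vector) chart set \<Rightarrow> 'a set \<Rightarrow>
   ('c::topological_space, 'k::real_normed_vector) chart set \<Rightarrow> 'c set \<Rightarrow> ('a \<Rightarrow> 'c) topology" where
  "cinf_topology A X A' Y = topology_generated_by
     {cinf_nbhd A X A' Y h (U, c) (V, d) K r \<epsilon> | h U c V d K r \<epsilon>.
        smooth_map A X A' Y h \<and> (U, c) \<in> A \<and> (V, d) \<in> A' \<and>
        compact K \<and> K \<subseteq> U \<inter> X \<and> h ` K \<subseteq> V \<and> 0 < \<epsilon>}"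

text \<open>
  A diffeomorphism of \<open>X\<close> is represented by its extension by the identity to the whole type, so that
  the group operation is plain composition. The extension need not be smooth off \<open>X\<close>.
\<close>

definition diffeos ::
  "('a::topological_space, 'm::real_normed_vector) chart set \<Rightarrow> 'a set \<Rightarrow> ('a \<Rightarrow> 'a) set" where
  "diffeos A X = {h. h permutes X \<and> smooth_map A X A X h \<and> smooth_map A X A X (inv_into UNIV h)}"

definition map_group :: "('a \<Rightarrow> 'a) set \<Rightarrow> ('a \<Rightarrow> 'a) monoid" where
  "map_group G = \<lparr>carrier = G, monoid.mult = (\<circ>), one = id\<rparr>"


section \<open>Smooth vector bundles\<close>

text \<open>
  A local trivialisation \<open>p\<^sup>-\<^sup>1(U) \<cong> U \<times> 'v\<close>, \<open>x \<mapsto> (p x, \<tau> x)\<close>, is recorded as \<open>(U, \<tau>)\<close>. Together with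
  a chart of the base it gives a chart of the total space.
\<close>

definition bundle_atlas ::
  "('e \<Rightarrow> 'b) \<Rightarrow> ('b, 'm) chart set \<Rightarrow> ('b set \<times> ('e \<Rightarrow> 'v)) set \<Rightarrow> ('e, 'm \<times> 'v) chart set" where
  "bundle_atlas p A \<Phi> = {(p -` (W \<inter> U), \<lambda>x. (c (p x), \<tau> x)) | W c U \<tau>. (W, c) \<in> A \<and> (U, \<tau>) \<in> \<Phi>}"

text \<open>
  The base manifold is the whole type \<open>'b\<close> and the rank is \<open>DIM('v)\<close>, which is at least 1.
  The operations \<open>add\<close> and \<open>scal\<close> are the fibrewise ones (\<open>add x y\<close> is unspecified if \<open>x\<close> and \<open>y\<close> lie
  in different fibres). Linearity of the trivialisations makes each fibre a vector space isomorphic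
  to \<open>'v\<close>, and the last assumption says that the transition maps are smooth.
\<close>

locale smooth_vector_bundle =
  fixes p :: "'e::topological_space \<Rightarrow> 'b::t2_space"
    and add :: "'e \<Rightarrow> 'e \<Rightarrow> 'e"
    and scal :: "real \<Rightarrow> 'e \<Rightarrow> 'e"
    and A :: "('b, 'm::{real_normed_vector,heine_borel}) chart set"
    and \<Phi> :: "('b set \<times> ('e \<Rightarrow> 'v::euclidean_space)) set"
  assumes base_atlas: "smooth_atlas A"
    and proj_continuous: "continuous_on UNIV p"
    and proj_scal: "p (scal t x) = p x"
    and proj_add: "p x = p y \<Longrightarrow> p (add x y) = p x"
    and triv_cover: "(\<Union>(U, \<tau>)\<in>\<Phi>. U) = UNIV"
    and triv_open: "(U, \<tau>) \<in> \<Phi> \<Longrightarrow> open U"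
    and triv_homeo: "(U, \<tau>) \<in> \<Phi> \<Longrightarrow> \<exists>g. homeomorphism (p -` U) (U \<times> UNIV) (\<lambda>x. (p x, \<tau> x)) g"
    and triv_scal: "(U, \<tau>) \<in> \<Phi> \<Longrightarrow> p x \<in> U \<Longrightarrow> \<tau> (scal t x) = t *\<^sub>R \<tau> x"
    and triv_add: "(U, \<tau>) \<in> \<Phi> \<Longrightarrow> p x \<in> U \<Longrightarrow> p x = p y \<Longrightarrow> \<tau> (add x y) = \<tau> x + \<tau> y"
    and total_atlas: "smooth_atlas (bundle_atlas p A \<Phi>)"

definition homogeneous :: "(real \<Rightarrow> 'e \<Rightarrow> 'e) \<Rightarrow> nat \<Rightarrow> ('e \<Rightarrow> real) \<Rightarrow> bool" where
  "homogeneous scal k f \<longleftrightarrow> (\<forall>t\<ge>0. \<forall>x. f (scal t x) = t ^ k * f x)"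

text \<open>\<open>range (scal 0)\<close> is the image of the zero section.\<close>

definition definite :: "(real \<Rightarrow> 'e \<Rightarrow> 'e) \<Rightarrow> ('e \<Rightarrow> real) \<Rightarrow> bool" where
  "definite scal f \<longleftrightarrow> (\<forall>x. x \<notin> range (scal 0) \<longrightarrow> f x > 0)"


section \<open>Diffeomorphism groups of the tube\<close>

definition tube :: "('e \<Rightarrow> real) \<Rightarrow> 'e set" where
  "tube f = f -` {0..1}"

definition leaves :: "('e \<Rightarrow> real) \<Rightarrow> 'e set set" where
  "leaves f = {f -` {t} | t. t \<in> {0..1}}"

definition D01 :: "(real \<Rightarrow> real) set" where
  "D01 = diffeos line_atlas {0..1}"

definition D01_plus :: "(real \<Rightarrow> real) set" where
  "D01_plus = {\<phi> \<in> D01. \<forall>t\<in>{0..1}. vector_derivative \<phi> (at t within {0..1}) > 0}"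

text \<open>In the remaining definitions \<open>A\<close> is an atlas of the total space \<open>E\<close>.\<close>

definition DT :: "('e::topological_space, 'm::real_normed_vector) chart set \<Rightarrow> ('e \<Rightarrow> real) \<Rightarrow> ('e \<Rightarrow> 'e) set" where
  "DT A f = diffeos A (tube f)"

definition D_fol :: "('e::topological_space, 'm::real_normed_vector) chart set \<Rightarrow> ('e \<Rightarrow> real) \<Rightarrow> ('e \<Rightarrow> 'e) set" where
  "D_fol A f = {h \<in> DT A f. \<forall>L\<in>leaves f. h ` L \<in> leaves f}"

definition D_lp :: "('e::topological_space, 'm::real_normed_vector) chart set \<Rightarrow> ('e \<Rightarrow> real) \<Rightarrow> ('e \<Rightarrow> 'e) set" where
  "D_lp A f = {h \<in> DT A f. \<forall>L\<in>leaves f. h ` L = L}"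

definition D_fol_bd :: "('e::topological_space, 'm::real_normed_vector) chart set \<Rightarrow> ('e \<Rightarrow> real) \<Rightarrow> ('e \<Rightarrow> 'e) set" where
  "D_fol_bd A f = {h \<in> D_fol A f. \<forall>x\<in>f -` {1}. h x = x}"

definition D_lp_bd :: "('e::topological_space, 'm::real_normed_vector) chart set \<Rightarrow> ('e \<Rightarrow> real) \<Rightarrow> ('e \<Rightarrow> 'e) set" where
  "D_lp_bd A f = {h \<in> D_lp A f. \<forall>x\<in>f -` {1}. h x = x}"

definition S_R :: "('e::topological_space, 'm::real_normed_vector) chart set \<Rightarrow> ('e \<Rightarrow> real) \<Rightarrow> ('e \<Rightarrow> 'e) set" where
  "S_R A f = {h \<in> DT A f. \<forall>x\<in>tube f. f (h x) = f x}"

definition S_LR ::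
  "('e::topological_space, 'm::real_normed_vector) chart set \<Rightarrow> ('e \<Rightarrow> real) \<Rightarrow>
   ((real \<Rightarrow> real) \<times> ('e \<Rightarrow> 'e)) set" where
  "S_LR A f = {(\<phi>, h). \<phi> \<in> D01 \<and> h \<in> DT A f \<and> (\<forall>x\<in>tube f. \<phi> (f x) = f (h x))}"

definition S_LR_group ::
  "('e::topological_space, 'm::real_normed_vector) chart set \<Rightarrow> ('e \<Rightarrow> real) \<Rightarrow>
   ((real \<Rightarrow> real) \<times> ('e \<Rightarrow> 'e)) monoid" where
  "S_LR_group A f = (map_group D01 \<times>\<times> map_group (DT A f))\<lparr>carrier := S_LR A f\<rparr>"

definition D01_topology :: "(real \<Rightarrow> real) set \<Rightarrow> (real \<Rightarrow> real) topology" where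
  "D01_topology G = subtopology (cinf_topology line_atlas {0..1} line_atlas {0..1}) G"

definition DT_topology ::
  "('e::topological_space, 'm::real_normed_vector) chart set \<Rightarrow> ('e \<Rightarrow> real) \<Rightarrow> ('e \<Rightarrow> 'e) set \<Rightarrow>
   ('e \<Rightarrow> 'e) topology" where
  "DT_topology A f G = subtopology (cinf_topology A (tube f) A (tube f)) G"

definition S_LR_topology ::
  "('e::topological_space, 'm::real_normed_vector) chart set \<Rightarrow> ('e \<Rightarrow> real) \<Rightarrow>
   ((real \<Rightarrow> real) \<times> ('e \<Rightarrow> 'e)) topology" where
  "S_LR_topology A f =
     subtopology (prod_topology (D01_topology D01) (DT_topology A f (DT A f))) (S_LR A f)"

definition sigma_map :: "('e \<Rightarrow> real) \<Rightarrow> ('e \<Rightarrow> 'e) \<Rightarrow> real \<Rightarrow> real" where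
  "sigma_map f h = (THE \<phi>. \<phi> \<in> D01_plus \<and> (\<forall>x\<in>tube f. \<phi> (f x) = f (h x)))"

definition g_fun :: "(real \<Rightarrow> real) \<Rightarrow> real \<Rightarrow> real" where
  "g_fun \<phi> t = integral {0..1} (\<lambda>s. vector_derivative \<phi> (at (s * t) within {0..1}))"

definition theta_map :: "(real \<Rightarrow> 'e \<Rightarrow> 'e) \<Rightarrow> ('e \<Rightarrow> real) \<Rightarrow> (real \<Rightarrow> real) \<Rightarrow> 'e \<Rightarrow> 'e" where
  "theta_map scal f \<phi> = (\<lambda>x. if x \<in> tube f then scal (sqrt (g_fun \<phi> (f x))) x else x)"

definition j_incl :: "('e \<Rightarrow> 'e) \<Rightarrow> (real \<Rightarrow> real) \<times> ('e \<Rightarrow> 'e)" where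
  "j_incl h = (id, h)"

definition sigma_hat :: "('e \<Rightarrow> real) \<Rightarrow> ('e \<Rightarrow> 'e) \<Rightarrow> (real \<Rightarrow> real) \<times> ('e \<Rightarrow> 'e)" where
  "sigma_hat f h = (sigma_map f h, h)"

definition theta_hat ::
  "(real \<Rightarrow> 'e \<Rightarrow> 'e) \<Rightarrow> ('e \<Rightarrow> real) \<Rightarrow> (real \<Rightarrow> real) \<Rightarrow> (real \<Rightarrow> real) \<times> ('e \<Rightarrow> 'e)" where
  "theta_hat scal f \<phi> = (\<phi>, theta_map scal f \<phi>)"


section \<open>Exact sequences and deformation retracts of pairs\<close>

text \<open>\<open>short_exact_sequence\<close> of HOL-Algebra forces all groups to have elements of the same type.\<close>

definition short_exact :: "'x monoid \<Rightarrow> 'y monoid \<Rightarrow> 'z monoid \<Rightarrow> ('x \<Rightarrow> 'y) \<Rightarrow> ('y \<Rightarrow> 'z) \<Rightarrow> bool" where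
  "short_exact G H K i q \<longleftrightarrow>
     group G \<and> group H \<and> group K \<and> i \<in> mon G H \<and> q \<in> epi H K \<and> i ` carrier G = kernel H K q"

text \<open>The pair \<open>(A, A')\<close> is a strong deformation retract of the pair \<open>(X, X')\<close>.\<close>

definition strong_deformation_retract_pair ::
  "'a set \<Rightarrow> 'a set \<Rightarrow> 'a topology \<Rightarrow> 'a set \<Rightarrow> bool" where
  "strong_deformation_retract_pair A A' X X' \<longleftrightarrow>
     A \<subseteq> topspace X \<and> X' \<subseteq> topspace X \<and> A' \<subseteq> A \<inter> X' \<and>
     (\<exists>r. r ` topspace X \<subseteq> A \<and> r ` X' \<subseteq> A' \<and>
          homotopic_with (\<lambda>k. k ` X' \<subseteq> X' \<and> (\<forall>a\<in>A. k a = a)) X X id r)"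

end

theory Submission
  imports Defs
begin

text \<open>
  Euler's relation makes the tube a domain with smooth boundary, and a definite 2-homogeneous smooth \<open>f\<close> is a
  quadratic form on each fibre. If \<open>h\<close> permutes the leaves and \<open>x\<close> is a vector with \<open>f x = 1\<close>, then
  \<open>\<psi> t = f (h (t x)) = \<sigma>(h) (t\<^sup>2)\<close> is a smooth even function on \<open>[-1, 1]\<close>, so by Whitney's
  theorem \<open>\<sigma>(h)\<close> is smooth and depends continuously on \<open>h\<close>: its derivative at \<open>t\<^sup>2\<close> is
  \<open>1/2 \<integral> \<psi>'' (u t) du\<close>, and this can be iterated. Both \<open>\<theta>(\<phi>)\<close> and the deformation
  \<open>h \<mapsto> \<theta>((1 - a) id + a \<sigma>(h)\<^sup>-\<^sup>1) \<circ> h\<close> of the leaf permuting diffeomorphisms onto the leaf preserving ones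
  are fibrewise rescalings: the latter sends \<open>h\<close> to
  \<open>x \<mapsto> (1 - a + a / g (f x))\<^bsup>1/2\<^esup> h x\<close> with \<open>g = g\<^bsub>\<sigma>(h)\<^esub>\<close>. In bundle charts a rescaling multiplies the fibre coordinate
  by a function, so continuity in the \<open>C\<^sup>\<infinity>\<close> topology reduces to the product and chain rules.
\<close>

section \<open>Finite-dimensional coordinates\<close>

text \<open>The delicate point is continuity in a topology whose neighbourhoods bound all
  derivatives in charts, uniformly over unit directions. It is turned once into convergence along
  arbitrary filters (\<open>limitin_cinf_iff\<close>); each continuity claim then says that limits
  of the data give limits of the result, and sums, products and compositions have their own limit
  rules. Uniformity in the directions comes from expanding every direction in a finite basis, which
  is why finite dimension is extracted from compactness of balls. The deformation is written with
  \<open>1 / g (f x)\<close> although its algebraic meaning is a composition with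
  \<open>\<theta>\<close>: the quotient of \<open>\<sigma>(h)\<^sup>-\<^sup>1\<close> at the level
  of \<open>h x\<close> is the reciprocal of the quotient of \<open>\<sigma>(h)\<close> at the level
  of \<open>x\<close>. In this form neither inversion nor composition in the diffeomorphism groups
  has to be shown continuous, only the dependence of \<open>\<sigma>(h)\<close> on \<open>h\<close>.
  Smoothness across the zero section is also what forces \<open>f\<close> to be even on fibres and
  \<open>\<sigma>(h)\<close> to preserve orientation.\<close>

lemma infdist_span_le:
  fixes a :: "'a::real_normed_vector"
  assumes "v \<in> span F"
  shows "\<bar>c\<bar> * infdist a (span F) \<le> norm (c *\<^sub>R a + v)"
proof (cases "c = 0")
  case False
  have "infdist a (span F) \<le> dist a ((- 1 / c) *\<^sub>R v)"
    by (intro infdist_le span_scale assms)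
  also have "\<dots> = norm ((1 / c) *\<^sub>R (c *\<^sub>R a + v))"
    using False by (simp add: dist_norm scaleR_add_right)
  also have "\<dots> = norm (c *\<^sub>R a + v) / \<bar>c\<bar>"
    by (simp only: norm_scaleR) simp
  finally show ?thesis
    using False by (simp add: field_simps)
qed auto

text \<open>Induction on \<open>F\<close>. By \<open>infdist_span_le\<close> the coefficients of a
  new vector \<open>a\<close> form a Cauchy sequence as soon as the vectors do, because
  \<open>a\<close> has positive distance from the span that is already known to be closed.\<close>

lemma closed_span_finite:
  fixes F :: "'a::real_normed_vector set"
  assumes "finite F"
  shows "closed (span F)"
  using assms
proof (induction F)
  case empty
  then show ?case by simp
next
  case (insert a F)
  show ?case
  proof (cases "a \<in> span F")
    case True
    then show ?thesis using insert by (simp add: span_redundant)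
  next
    case False
    define d where "d = infdist a (span F)"
    have d: "d > 0"
      unfolding d_def using insert False span_0[of F]
      by (intro infdist_pos_not_in_closed) auto
    show ?thesis
      unfolding closed_sequential_limits
    proof (intro allI impI)
      fix x l assume *: "(\<forall>n. x n \<in> span (insert a F)) \<and> x \<longlonglongrightarrow> l"
      then have "\<forall>n. \<exists>k. x n - k *\<^sub>R a \<in> span F"
        using span_breakdown_eq by blast
      then obtain c where c: "\<And>n. x n - c n *\<^sub>R a \<in> span F" by metis
      have bound: "\<bar>c n - c m\<bar> * d \<le> dist (x n) (x m)" for n m
      proof -
        have "(x n - c n *\<^sub>R a) - (x m - c m *\<^sub>R a) \<in> span F" using c span_diff by blast
        from infdist_span_le[OF this, of "c n - c m" a] show ?thesis
          by (simp add: d_def dist_norm algebra_simps)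
      qed
      have "Cauchy x" using * LIMSEQ_imp_Cauchy by blast
      have "Cauchy c"
      proof (rule metric_CauchyI)
        fix e :: real assume "e > 0"
        then have "e * d > 0" using d by simp
        then obtain M where M: "\<And>m n. m \<ge> M \<Longrightarrow> n \<ge> M \<Longrightarrow> dist (x m) (x n) < e * d"
          using metric_CauchyD[OF \<open>Cauchy x\<close>] by blast
        show "\<exists>M. \<forall>m\<ge>M. \<forall>n\<ge>M. dist (c m) (c n) < e"
        proof (intro exI allI impI)
          fix m n assume "m \<ge> M" "n \<ge> M"
          then have "\<bar>c m - c n\<bar> * d < e * d" using bound[of m n] M[of m n] by linarith
          then show "dist (c m) (c n) < e" using d by (simp add: dist_real_def)
        qed
      qed
      then obtain k where k: "c \<longlonglongrightarrow> k" using real_Cauchy_convergent convergent_def by blast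
      have "(\<lambda>n. x n - c n *\<^sub>R a) \<longlonglongrightarrow> l - k *\<^sub>R a"
        using * k by (intro tendsto_intros) auto
      from closed_sequentially[OF insert.IH c this] have "l - k *\<^sub>R a \<in> span F" .
      then show "l \<in> span (insert a F)" using span_breakdown_eq by blast
    qed
  qed
qed

text \<open>Riesz' argument: a finite net of mesh 1/2 in the unit ball spans everything. The
  normalised residual of a vector outside the span would be approximated by the net, which produces
  a point of the span closer than the distance allows.\<close>

lemma heine_borel_finite_span:
  obtains F :: "'a::{real_normed_vector,heine_borel} set" where "finite F" "span F = UNIV"
proof -
  have "compact (cball (0::'a) 1)" by simp
  moreover have "cball (0::'a) 1 \<subseteq> (\<Union>x\<in>cball 0 1. ball x (1/2))" by auto
  ultimately obtain F where F: "finite F" "cball (0::'a) 1 \<subseteq> (\<Union>x\<in>F. ball x (1/2))"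
    by (metis compactE_image open_ball)
  have "x \<in> span F" for x
  proof (rule ccontr)
    assume x: "x \<notin> span F"
    define d where "d = infdist x (span F)"
    have d: "d > 0"
      unfolding d_def using x span_0[of F] closed_span_finite[OF F(1)]
      by (intro infdist_pos_not_in_closed) auto
    \<comment> \<open>The factor 2 is matched to the mesh 1/2: the residual has norm
      \<open>r < 2 * d\<close>, so an error below \<open>r / 2\<close> stays below
      \<open>d\<close>.\<close>
    have "\<exists>v\<in>span F. dist x v < 2 * d"
    proof (rule ccontr)
      assume "\<not> ?thesis"
      then have "2 * d \<le> infdist x (span F)"
        unfolding infdist_def using span_0[of F]
        by (auto intro!: cINF_greatest simp: not_less)
      then show False using d d_def by simp
    qed
    then obtain v where v: "v \<in> span F" "dist x v < 2 * d" by blast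
    define r where "r = norm (x - v)"
    have r: "r > 0" using v x unfolding r_def by auto
    have "(x - v) /\<^sub>R r \<in> cball 0 1" using r by (simp add: r_def)
    then have "(x - v) /\<^sub>R r \<in> (\<Union>x\<in>F. ball x (1/2))" using F(2) by blast
    then obtain b where b: "b \<in> F" "dist b ((x - v) /\<^sub>R r) < 1/2" by auto
    have "d \<le> dist x (v + r *\<^sub>R b)"
      unfolding d_def by (intro infdist_le span_add span_scale v span_base b)
    also have "\<dots> = norm (r *\<^sub>R ((x - v) /\<^sub>R r - b))"
      using r by (simp add: dist_norm algebra_simps)
    also have "\<dots> = r * dist b ((x - v) /\<^sub>R r)" using r by (simp add: dist_norm norm_minus_commute)
    also have "\<dots> < r * (1/2)" using r b by (intro mult_strict_left_mono) auto
    also have "\<dots> < d" using v(2) by (simp add: r_def dist_norm)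
    finally show False .
  qed
  then show ?thesis using that F by blast
qed

text \<open>The coordinate functional of \<open>b\<close> is bounded by \<open>1 / d\<close>, where
  \<open>d\<close> is the distance of \<open>b\<close> from the span of the other basis
  vectors.\<close>

lemma heine_borel_coordinates:
  "\<exists>(B :: 'a::{real_normed_vector,heine_borel} set) c. finite B \<and> (\<forall>b. bounded_linear (c b)) \<and>
    (\<forall>x. x = (\<Sum>b\<in>B. c b x *\<^sub>R b))"
proof -
  obtain F :: "'a set" where F: "finite F" "span F = UNIV" by (rule heine_borel_finite_span)
  obtain B where B: "B \<subseteq> F" "independent B" "F \<subseteq> span B"
    by (rule maximal_independent_subset)
  have fin: "finite B" using F B finite_subset by blast
  have sp: "span B = UNIV" using F B span_minimal[of F "span B"] by auto
  \<comment> \<open>Zero off the basis, so that every \<open>c b\<close> is a bounded linear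
    functional, whatever \<open>b\<close> is.\<close>
  define c where "c b x = (if b \<in> B then representation B x b else 0)" for b x :: 'a
  have rep: "x = (\<Sum>b\<in>B. c b x *\<^sub>R b)" for x
    using sum_representation_eq[OF B(2), of x B] fin sp by (simp add: c_def)
  have lin: "linear (c b)" for b
    using B(2) sp by (intro linearI) (auto simp: c_def representation_add representation_scale)
  have bl: "bounded_linear (c b)" for b
  proof (cases "b \<in> B")
    case True
    define d where "d = infdist b (span (B - {b}))"
    have "b \<notin> span (B - {b})" using B True dependent_def by blast
    then have d: "d > 0"
      unfolding d_def using span_0[of "B - {b}"] fin
      by (intro infdist_pos_not_in_closed closed_span_finite) auto
    have "norm (c b x) \<le> norm x * (1 / d)" for x
    proof -
      have "(\<Sum>a\<in>B - {b}. c a x *\<^sub>R a) \<in> span (B - {b})"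
        by (intro span_sum span_scale span_base) auto
      from infdist_span_le[OF this, of "c b x" b]
      have "\<bar>c b x\<bar> * d \<le> norm (c b x *\<^sub>R b + (\<Sum>a\<in>B - {b}. c a x *\<^sub>R a))"
        by (simp add: d_def)
      also have "\<dots> = norm x" using rep[of x] sum.remove[OF fin True, of "\<lambda>a. c a x *\<^sub>R a"] by simp
      finally show ?thesis using d by (simp add: field_simps)
    qed
    with lin show ?thesis
      by (intro bounded_linear_intro[where K = "1 / d"]) (auto simp: linear_add linear_scale)
  qed (simp add: c_def[abs_def])
  show ?thesis using fin bl rep by blast
qed

text \<open>A basis with its coordinate functionals, since the class \<^class>\<open>heine_borel\<close> does not come with one.\<close>

definition frame :: "'a::{real_normed_vector,heine_borel} set \<times> ('a \<Rightarrow> 'a \<Rightarrow> real)" where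
  "frame = (SOME (B, c). finite B \<and> (\<forall>b. bounded_linear (c b)) \<and> (\<forall>x. x = (\<Sum>b\<in>B. c b x *\<^sub>R b)))"

definition frame_dirs :: "'a::{real_normed_vector,heine_borel} set" where
  "frame_dirs = fst frame"

definition frame_coord :: "'a::{real_normed_vector,heine_borel} \<Rightarrow> 'a \<Rightarrow> real" where
  "frame_coord = snd frame"

lemma
  fixes x b :: "'a::{real_normed_vector,heine_borel}"
  shows finite_frame_dirs [simp]: "finite (frame_dirs :: 'a set)"
  and bounded_linear_frame_coord: "bounded_linear (frame_coord b)"
  and frame_expand: "(\<Sum>b\<in>frame_dirs. frame_coord b x *\<^sub>R b) = x"
proof -
  have "case frame of (B, c) \<Rightarrow> finite (B::'a set) \<and> (\<forall>b. bounded_linear (c b)) \<and>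
    (\<forall>x. x = (\<Sum>b\<in>B. c b x *\<^sub>R b))"
    unfolding frame_def by (rule someI_ex) (use heine_borel_coordinates in auto)
  then have "finite (fst frame :: 'a set) \<and> (\<forall>b::'a. bounded_linear (snd frame b)) \<and>
    (\<forall>x::'a. x = (\<Sum>b\<in>fst frame. snd frame b x *\<^sub>R b))"
    unfolding case_prod_beta .
  then show "finite (frame_dirs :: 'a set)" "bounded_linear (frame_coord b)"
    "(\<Sum>b\<in>frame_dirs. frame_coord b x *\<^sub>R b) = x"
    unfolding frame_dirs_def frame_coord_def by metis+
qed

lemma linear_frame_expand:
  assumes "linear L"
  shows "L v = (\<Sum>b\<in>frame_dirs. frame_coord b v *\<^sub>R L b)"
proof -
  have "L v = L (\<Sum>b\<in>frame_dirs. frame_coord b v *\<^sub>R b)" by (simp add: frame_expand)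
  also have "\<dots> = (\<Sum>b\<in>frame_dirs. frame_coord b v *\<^sub>R L b)"
    using assms by (simp add: linear_sum linear_scale)
  finally show ?thesis .
qed

section \<open>Calculus of iterated directional derivatives\<close>

text \<open>Derivatives within a fat set are unique. Unlike the criteria of the library for boxes, fatness is
  inherited by relatively open subsets and holds for domains with smooth boundary.\<close>

definition fat :: "'a::real_normed_vector set \<Rightarrow> bool" where
  "fat S \<longleftrightarrow> (\<forall>x\<in>S. span {w. \<forall>\<^sub>F t in at_right 0. x + t *\<^sub>R w \<in> S} = UNIV)"

section \<open>Fat sets and uniqueness of derivatives\<close>

lemma eventually_at_right_line:
  fixes x w :: "'a::real_normed_vector"
  assumes "open Q" "x \<in> Q"
  shows "\<forall>\<^sub>F t in at_right 0. x + t *\<^sub>R w \<in> Q"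
proof -
  have "((\<lambda>t. x + t *\<^sub>R w) \<longlongrightarrow> x + 0 *\<^sub>R w) (at_right 0)"
    by (intro tendsto_intros)
  then show ?thesis using assms topological_tendstoD by fastforce
qed

lemma fat_Int_open:
  assumes "fat S" "open Q"
  shows "fat (S \<inter> Q)"
  unfolding fat_def
proof
  fix x assume "x \<in> S \<inter> Q"
  then have "{w. \<forall>\<^sub>F t in at_right 0. x + t *\<^sub>R w \<in> S \<inter> Q} = {w. \<forall>\<^sub>F t in at_right 0. x + t *\<^sub>R w \<in> S}"
    using eventually_at_right_line[OF assms(2)] by (auto simp: eventually_conj_iff)
  then show "span {w. \<forall>\<^sub>F t in at_right 0. x + t *\<^sub>R w \<in> S \<inter> Q} = UNIV"
    using assms \<open>x \<in> S \<inter> Q\<close> by (simp add: fat_def)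
qed

lemma fat_UNIV: "fat UNIV"
  by (simp add: fat_def)

lemma fat_open: "open S \<Longrightarrow> fat S"
  using fat_Int_open[OF fat_UNIV] by simp

lemma fat_Icc:
  fixes a b :: real
  assumes "a < b"
  shows "fat {a..b}"
  unfolding fat_def
proof
  fix x assume x: "x \<in> {a..b}"
  show "span {w. \<forall>\<^sub>F t in at_right 0. x + t *\<^sub>R w \<in> {a..b}} = UNIV" (is "span ?W = _")
  proof (cases "x < b")
    case True
    have "1 \<in> ?W"
      using x True eventually_at_right_less[of "0::real"] eventually_at_right_line[of "{..<b}" x 1]
      by (auto elim: eventually_elim2)
    then show ?thesis
      by (metis (no_types, lifting) UNIV_eq_I mult.right_neutral real_scaleR_def span_base span_scale)
  next
    case False
    have "- 1 \<in> ?W"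
      using x False assms eventually_at_right_less[of "0::real"] eventually_at_right_line[of "{a<..}" x "-1"]
      by (auto elim: eventually_elim2)
    then have "(- c) *\<^sub>R (-1) \<in> span ?W" for c by (intro span_scale span_base)
    then show ?thesis by auto
  qed
qed

text \<open>A direction \<open>w\<close> that stays in \<open>S\<close> for small positive times
  gives a one-sided derivative along a segment, which determines \<open>D w\<close>; fatness says
  that such directions span.\<close>

lemma has_derivative_unique_fat:
  assumes S: "fat S" "x \<in> S"
    and D: "(u has_derivative D) (at x within S)" and D': "(u has_derivative D') (at x within S)"
  shows "D = D'"
proof -
  let ?W = "{w. \<forall>\<^sub>F t in at_right 0. x + t *\<^sub>R w \<in> S}"
  have lin: "linear D" "linear D'"
    using D D' has_derivative_linear by blast+
  have eq: "D w = D' w" if "w \<in> ?W" for w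
  proof -
    obtain e where e: "e > 0" "\<And>t. 0 < t \<Longrightarrow> t < e \<Longrightarrow> x + t *\<^sub>R w \<in> S"
      using \<open>w \<in> ?W\<close> unfolding eventually_at_right_field by auto
    have sub: "(\<lambda>t. x + t *\<^sub>R w) ` {0..<e} \<subseteq> S"
    proof safe
      fix t assume "t \<in> {0..<e}"
      then show "x + t *\<^sub>R w \<in> S" using e(2)[of t] S by (cases "t = 0") auto
    qed
    have line: "((\<lambda>t. x + t *\<^sub>R w) has_derivative (\<lambda>t. t *\<^sub>R w)) (at 0 within {0..<e})"
      by (auto intro!: derivative_eq_intros)
    have "((\<lambda>t. u (x + t *\<^sub>R w)) has_vector_derivative L w) (at 0 within {0..<e})"
      if "(u has_derivative L) (at x within S)" for L
    proof -
      have "(u has_derivative L) (at (x + 0 *\<^sub>R w) within (\<lambda>t. x + t *\<^sub>R w) ` {0..<e})"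
        using has_derivative_subset[OF that sub] by simp
      from has_derivative_in_compose[OF line this]
      have "((\<lambda>t. u (x + t *\<^sub>R w)) has_derivative (\<lambda>t. L (t *\<^sub>R w))) (at 0 within {0..<e})" .
      then show ?thesis
        using has_derivative_linear[OF that] by (simp add: has_vector_derivative_def linear_scale)
    qed
    moreover have "at 0 within {0..<e} \<noteq> bot"
      using e by (simp add: trivial_limit_within islimpt_Ico)
    ultimately show ?thesis using D D' vector_derivative_unique_within by blast
  qed
  have "D y = D' y" for y
  proof -
    have "y \<in> span ?W" using S unfolding fat_def by blast
    from linear_eq_on[OF lin this eq] show ?thesis .
  qed
  then show ?thesis by auto
qed

section \<open>Locality and restriction of iterated derivatives\<close>

lemma nderiv_append: "nderiv S u (vs @ ws) = nderiv S (nderiv S u ws) vs"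
  by (induction vs) auto

lemma nderiv_1_eq:
  assumes "fat S" "x \<in> S" "(u has_derivative D) (at x within S)"
  shows "nderiv S u [v] x = D v"
  using has_derivative_unique_fat[OF assms(1,2) assms(3)] frechet_derivative_works assms(3)
  by (metis differentiableI nderiv.simps)

lemma has_derivative_nderiv:
  assumes "u differentiable (at x within S)"
  shows "(u has_derivative (\<lambda>v. nderiv S u [v] x)) (at x within S)"
  using assms frechet_derivative_works by auto

lemma frechet_derivative_cong_eventually:
  assumes "\<forall>\<^sub>F y in at x within S. u y = w y" "u x = w x" "x \<in> S"
  shows "frechet_derivative u (at x within S) = frechet_derivative w (at x within S)"
proof -
  have ev: "\<forall>\<^sub>F y in at x within S. w y = u y"
    using assms(1) by (rule eventually_mono) simp
  have "(u has_derivative D) (at x within S) \<longleftrightarrow> (w has_derivative D) (at x within S)" for D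
    using has_derivative_transform_eventually[OF _ assms] 
      has_derivative_transform_eventually[OF _ ev assms(2)[symmetric] assms(3)] by blast
  then show ?thesis unfolding frechet_derivative_def by simp
qed

lemma nderiv_cong:
  assumes "\<And>y. y \<in> S \<Longrightarrow> u y = w y" "x \<in> S"
  shows "nderiv S u vs x = nderiv S w vs x"
  using assms(2)
proof (induction vs arbitrary: x)
  case (Cons v vs)
  have "\<forall>\<^sub>F y in at x within S. nderiv S u vs y = nderiv S w vs y"
    using Cons.IH by (auto simp: eventually_at_filter)
  then show ?case
    using Cons by (auto dest!: frechet_derivative_cong_eventually)
qed (use assms in auto)

lemma nderiv_Int_open:
  assumes Q: "open Q" and x: "x \<in> S \<inter> Q"
  shows "nderiv (S \<inter> Q) u vs x = nderiv S u vs x"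
  using x
proof (induction vs arbitrary: x)
  case (Cons v vs)
  have at: "at x within S \<inter> Q = at x within S"
    using Cons.prems Q by (intro at_within_nhd[of x Q]) auto
  have "\<forall>\<^sub>F y in at x within S \<inter> Q. nderiv (S \<inter> Q) u vs y = nderiv S u vs y"
    using Cons.IH by (auto simp: eventually_at_filter)
  then have "frechet_derivative (nderiv (S \<inter> Q) u vs) (at x within S \<inter> Q)
      = frechet_derivative (nderiv S u vs) (at x within S \<inter> Q)"
    using Cons by (intro frechet_derivative_cong_eventually) auto
  then show ?case by (simp add: at)
qed auto

lemma differentiable_cong_on:
  assumes "\<And>y. y \<in> S \<Longrightarrow> u y = w y" "x \<in> S"
  shows "u differentiable (at x within S) \<longleftrightarrow> w differentiable (at x within S)"
  unfolding differentiable_def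
  using has_derivative_transform[of x S u w] has_derivative_transform[of x S w u] assms by auto

text \<open>A derivative within \<open>T\<close> is also one within \<open>S\<close>, and fatness of
  \<open>S\<close> makes it the one that \<open>nderiv S\<close> picks. Smoothness on
  \<open>T\<close> carries this to all orders.\<close>

lemma nderiv_subset:
  assumes T: "smooth_on T u" and S: "S \<subseteq> T" "fat S" and x: "x \<in> S"
  shows "nderiv S u vs x = nderiv T u vs x"
  using x
proof (induction vs arbitrary: x)
  case (Cons v vs)
  have "nderiv T u vs differentiable (at x within T)"
    using T S Cons.prems by (auto simp: smooth_on_def differentiable_on_def)
  then have "(nderiv T u vs has_derivative (\<lambda>v. nderiv T u (v # vs) x)) (at x within T)"
    using frechet_derivative_works by auto
  then have D: "(nderiv T u vs has_derivative (\<lambda>v. nderiv T u (v # vs) x)) (at x within S)"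
    using S has_derivative_subset by blast
  have "(nderiv S u vs has_derivative (\<lambda>v. nderiv T u (v # vs) x)) (at x within S)"
    by (rule has_derivative_transform[OF Cons.prems _ D]) (rule Cons.IH)
  from nderiv_1_eq[OF S(2) Cons.prems this] show ?case by simp
qed auto

lemma smooth_on_subset:
  assumes T: "smooth_on T u" and S: "S \<subseteq> T" "fat S"
  shows "smooth_on S u"
  unfolding smooth_on_def differentiable_on_def
proof (intro allI ballI)
  fix vs x assume x: "x \<in> S"
  have "nderiv T u vs differentiable (at x within S)"
    using T S x by (meson differentiable_on_def smooth_on_def differentiable_within_subset subsetD)
  then show "nderiv S u vs differentiable (at x within S)"
    using differentiable_cong_on[of S "nderiv S u vs" "nderiv T u vs"] nderiv_subset[OF assms] x by blast
qed

lemma smooth_on_Int_open: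
  assumes "smooth_on S u" "open Q"
  shows "smooth_on (S \<inter> Q) u"
  unfolding smooth_on_def differentiable_on_def
proof (intro allI ballI)
  fix vs x assume x: "x \<in> S \<inter> Q"
  have "nderiv S u vs differentiable (at x within S \<inter> Q)"
    using assms x by (meson differentiable_on_def smooth_on_def differentiable_within_subset Int_lower1 IntD1)
  then show "nderiv (S \<inter> Q) u vs differentiable (at x within S \<inter> Q)"
    using differentiable_cong_on[of "S \<inter> Q" "nderiv (S \<inter> Q) u vs" "nderiv S u vs"]
      nderiv_Int_open[OF assms(2)] x by blast
qed

lemma smooth_on_local:
  assumes "\<And>x. x \<in> S \<Longrightarrow> \<exists>Q. open Q \<and> x \<in> Q \<and> smooth_on (S \<inter> Q) u"
  shows "smooth_on S u"
  unfolding smooth_on_def differentiable_on_def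
proof (intro allI ballI)
  fix vs x assume x: "x \<in> S"
  then obtain Q where Q: "open Q" "x \<in> Q" "smooth_on (S \<inter> Q) u" using assms by blast
  have "nderiv (S \<inter> Q) u vs differentiable (at x within S \<inter> Q)"
    using Q x by (auto simp: smooth_on_def differentiable_on_def)
  then have "nderiv S u vs differentiable (at x within S \<inter> Q)"
    using differentiable_cong_on[of "S \<inter> Q" "nderiv (S \<inter> Q) u vs" "nderiv S u vs"]
      nderiv_Int_open[OF Q(1)] x Q by blast
  moreover have "at x within S \<inter> Q = at x within S"
    using x Q by (intro at_within_nhd[of x Q]) auto
  ultimately show "nderiv S u vs differentiable (at x within S)" by simp
qed

lemma smooth_on_cong:
  assumes "smooth_on S u" "\<And>x. x \<in> S \<Longrightarrow> u x = w x"
  shows "smooth_on S w"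
  unfolding smooth_on_def differentiable_on_def
proof (intro allI ballI)
  fix vs x assume x: "x \<in> S"
  have "nderiv S u vs differentiable (at x within S)"
    using assms x by (auto simp: smooth_on_def differentiable_on_def)
  then show "nderiv S w vs differentiable (at x within S)"
    using differentiable_cong_on[of S "nderiv S u vs" "nderiv S w vs"]
      nderiv_cong[of S u w] assms(2) x by blast
qed

section \<open>Differentiability up to a finite order\<close>

definition diff_to_order :: "nat \<Rightarrow> 'a::real_normed_vector set \<Rightarrow> ('a \<Rightarrow> 'c::real_normed_vector) \<Rightarrow> bool" where
  "diff_to_order k S u \<longleftrightarrow> (\<forall>vs. length vs \<le> k \<longrightarrow> nderiv S u vs differentiable_on S)"

lemma smooth_on_iff_order: "smooth_on S u \<longleftrightarrow> (\<forall>k. diff_to_order k S u)"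
  unfolding smooth_on_def diff_to_order_def by blast

lemma diff_to_order_0: "diff_to_order 0 S u \<longleftrightarrow> u differentiable_on S"
  by (simp add: diff_to_order_def)

text \<open>Lists are split at their last entry, which is the direction differentiated first, so
  that an induction can be applied to the function \<open>nderiv S u [v]\<close>. Order
  \<open>k\<close> means that derivatives of order \<open>k\<close> are still differentiable; order
  0 is plain differentiability.\<close>

lemma diff_to_order_Suc:
  "diff_to_order (Suc k) S u \<longleftrightarrow> u differentiable_on S \<and> (\<forall>v. diff_to_order k S (nderiv S u [v]))"
  (is "?L \<longleftrightarrow> ?R")
proof
  assume L: ?L
  have "nderiv S (nderiv S u [v]) vs differentiable_on S" if "length vs \<le> k" for v vs
    using L[unfolded diff_to_order_def, rule_format, of "vs @ [v]"] that by (simp add: nderiv_append)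
  then show ?R using L unfolding diff_to_order_def
    by (metis le0 list.size(3) nderiv.simps(1))
next
  assume R: ?R
  have "nderiv S u vs differentiable_on S" if "length vs \<le> Suc k" for vs
  proof (cases vs rule: rev_cases)
    case (snoc ws v)
    then show ?thesis using R that nderiv_append[of S u ws "[v]"] by (auto simp: diff_to_order_def)
  qed (use R in auto)
  then show ?L by (auto simp: diff_to_order_def)
qed

lemma diff_to_order_imp_differentiable: "diff_to_order k S u \<Longrightarrow> u differentiable_on S"
  unfolding diff_to_order_def by (metis le0 list.size(3) nderiv.simps(1))

lemma diff_to_order_SucD: "diff_to_order (Suc k) S u \<Longrightarrow> diff_to_order k S u"
  by (auto simp: diff_to_order_def)

lemma diff_to_order_cong:
  assumes "diff_to_order k S u" "\<And>x. x \<in> S \<Longrightarrow> u x = w x"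
  shows "diff_to_order k S w"
  unfolding diff_to_order_def differentiable_on_def
proof (intro allI ballI impI)
  fix vs :: "'a list" and x assume x: "x \<in> S" and l: "length vs \<le> k"
  have "nderiv S u vs differentiable (at x within S)"
    using assms x l by (auto simp: diff_to_order_def differentiable_on_def)
  then show "nderiv S w vs differentiable (at x within S)"
    using differentiable_cong_on[of S "nderiv S u vs" "nderiv S w vs"]
      nderiv_cong[of S u w] assms(2) x by blast
qed

lemma smooth_on_nderiv: "smooth_on S u \<Longrightarrow> smooth_on S (nderiv S u ws)"
  unfolding smooth_on_def by (metis nderiv_append)

lemma smooth_on_imp_differentiable: "smooth_on S u \<Longrightarrow> u differentiable_on S"
  using smooth_on_iff_order diff_to_order_imp_differentiable by blast

lemma smooth_on_imp_continuous: "smooth_on S u \<Longrightarrow> continuous_on S u"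
  using smooth_on_imp_differentiable differentiable_imp_continuous_on by blast

section \<open>Linear, bilinear and chain rules\<close>

lemma nderiv_linear:
  assumes "fat S" "bounded_linear L" "u differentiable_on S" "x \<in> S"
  shows "nderiv S (\<lambda>x. L (u x)) [v] x = L (nderiv S u [v] x)"
proof -
  have "(u has_derivative (\<lambda>v. nderiv S u [v] x)) (at x within S)"
    using assms by (intro has_derivative_nderiv) (auto simp: differentiable_on_def)
  from bounded_linear.has_derivative[OF assms(2) this] show ?thesis
    using nderiv_1_eq[OF assms(1,4)] by blast
qed

lemma nderiv_bilinear:
  assumes "fat S" "bounded_bilinear B" "u differentiable_on S" "w differentiable_on S" "x \<in> S"
  shows "nderiv S (\<lambda>x. B (u x) (w x)) [v] x = B (u x) (nderiv S w [v] x) + B (nderiv S u [v] x) (w x)"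
proof -
  have "(u has_derivative (\<lambda>v. nderiv S u [v] x)) (at x within S)"
    "(w has_derivative (\<lambda>v. nderiv S w [v] x)) (at x within S)"
    using assms by (auto intro!: has_derivative_nderiv simp: differentiable_on_def simp del: nderiv.simps)
  from bounded_bilinear.FDERIV[OF assms(2) this] show ?thesis
    using nderiv_1_eq[OF assms(1,5)] by blast
qed

lemma nderiv_add:
  assumes "fat S" "u differentiable_on S" "w differentiable_on S" "x \<in> S"
  shows "nderiv S (\<lambda>x. u x + w x) [v] x = nderiv S u [v] x + nderiv S w [v] x"
proof -
  have "(u has_derivative (\<lambda>v. nderiv S u [v] x)) (at x within S)"
    "(w has_derivative (\<lambda>v. nderiv S w [v] x)) (at x within S)"
    using assms by (auto intro!: has_derivative_nderiv simp: differentiable_on_def simp del: nderiv.simps)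
  from has_derivative_add[OF this] show ?thesis
    using nderiv_1_eq[OF assms(1,4)] by blast
qed

lemma nderiv_const:
  assumes "fat S" "x \<in> S"
  shows "nderiv S (\<lambda>x. c) [v] x = 0"
  using nderiv_1_eq[OF assms, of "\<lambda>x. c" "\<lambda>v. 0"] by simp

text \<open>The derivative of the inner map is expanded in the frame. The direction in which
  \<open>g\<close> is differentiated then no longer varies with \<open>x\<close>, and the right-hand
  side is a finite sum of products to which induction on the order applies.\<close>

lemma nderiv_compose:
  fixes w :: "'a::real_normed_vector \<Rightarrow> 'b::{real_normed_vector,heine_borel}"
  assumes "fat S" "w differentiable_on S" "g differentiable_on T" "w ` S \<subseteq> T" "x \<in> S"
  shows "nderiv S (\<lambda>x. g (w x)) [v] x =
    (\<Sum>b\<in>frame_dirs. frame_coord b (nderiv S w [v] x) *\<^sub>R nderiv T g [b] (w x))"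
proof -
  have w: "(w has_derivative (\<lambda>v. nderiv S w [v] x)) (at x within S)"
    using assms by (intro has_derivative_nderiv) (auto simp: differentiable_on_def)
  have g: "(g has_derivative (\<lambda>v. nderiv T g [v] (w x))) (at (w x) within T)"
    using assms by (intro has_derivative_nderiv) (auto simp: differentiable_on_def)
  have "((\<lambda>x. g (w x)) has_derivative (\<lambda>v. nderiv T g [nderiv S w [v] x] (w x))) (at x within S)"
    using has_derivative_in_compose[OF w has_derivative_subset[OF g assms(4)]] .
  from nderiv_1_eq[OF assms(1,5) this]
  have "nderiv S (\<lambda>x. g (w x)) [v] x = nderiv T g [nderiv S w [v] x] (w x)" .
  also have "\<dots> = (\<Sum>b\<in>frame_dirs. frame_coord b (nderiv S w [v] x) *\<^sub>R nderiv T g [b] (w x))"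
    using linear_frame_expand[OF has_derivative_linear[OF g], of "nderiv S w [v] x"] .
  finally show ?thesis .
qed

lemma diff_to_order_const: "fat S \<Longrightarrow> diff_to_order k S (\<lambda>x. c)"
proof (induction k arbitrary: c)
  case 0
  then show ?case by (simp add: diff_to_order_0)
next
  case (Suc k)
  then show ?case
    unfolding diff_to_order_Suc
    using diff_to_order_cong[OF Suc.IH[of 0]] nderiv_const by (metis differentiable_on_const)
qed

lemma diff_to_order_linear:
  assumes "fat S" "bounded_linear L"
  shows "diff_to_order k S u \<Longrightarrow> diff_to_order k S (\<lambda>x. L (u x))"
proof (induction k arbitrary: u)
  case 0
  then show ?case
    using assms by (auto simp: diff_to_order_0 differentiable_on_def differentiable_def
        intro: bounded_linear.has_derivative)
next
  case (Suc k)
  then have u: "u differentiable_on S" "\<And>v. diff_to_order k S (nderiv S u [v])"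
    by (auto simp: diff_to_order_Suc)
  have "(\<lambda>x. L (u x)) differentiable_on S"
    using Suc diff_to_order_SucD diff_to_order_imp_differentiable by blast
  moreover have "diff_to_order k S (nderiv S (\<lambda>x. L (u x)) [v])" for v
    using diff_to_order_cong[OF Suc.IH[OF u(2)[of v]]] nderiv_linear[OF assms u(1)] by metis
  ultimately show ?case by (simp add: diff_to_order_Suc)
qed

lemma diff_to_order_add:
  assumes "fat S"
  shows "diff_to_order k S u \<Longrightarrow> diff_to_order k S w \<Longrightarrow> diff_to_order k S (\<lambda>x. u x + w x)"
proof (induction k arbitrary: u w)
  case 0
  then show ?case by (simp add: diff_to_order_0)
next
  case (Suc k)
  then have u: "u differentiable_on S" "\<And>v. diff_to_order k S (nderiv S u [v])"
    and w: "w differentiable_on S" "\<And>v. diff_to_order k S (nderiv S w [v])"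
    by (auto simp: diff_to_order_Suc)
  have "diff_to_order k S (nderiv S (\<lambda>x. u x + w x) [v])" for v
    using diff_to_order_cong[OF Suc.IH[OF u(2)[of v] w(2)[of v]]] nderiv_add[OF assms u(1) w(1)] by metis
  then show ?case using u w by (simp add: diff_to_order_Suc)
qed

lemma diff_to_order_bilinear:
  assumes "fat S" "bounded_bilinear B"
  shows "diff_to_order k S u \<Longrightarrow> diff_to_order k S w \<Longrightarrow> diff_to_order k S (\<lambda>x. B (u x) (w x))"
proof (induction k arbitrary: u w)
  case 0
  show ?case
    unfolding diff_to_order_0 differentiable_on_def differentiable_def
  proof
    fix x assume "x \<in> S"
    then obtain D D' where "(u has_derivative D) (at x within S)" "(w has_derivative D') (at x within S)"
      using 0 unfolding diff_to_order_0 differentiable_on_def differentiable_def by blast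
    from bounded_bilinear.FDERIV[OF assms(2) this]
    show "\<exists>D. ((\<lambda>x. B (u x) (w x)) has_derivative D) (at x within S)" by blast
  qed
next
  case (Suc k)
  then have u: "u differentiable_on S" "\<And>v. diff_to_order k S (nderiv S u [v])"
    and w: "w differentiable_on S" "\<And>v. diff_to_order k S (nderiv S w [v])"
    by (auto simp: diff_to_order_Suc)
  have uw: "diff_to_order k S u" "diff_to_order k S w"
    using Suc.prems diff_to_order_SucD by auto
  have "(\<lambda>x. B (u x) (w x)) differentiable_on S"
    using Suc.IH[OF uw] diff_to_order_imp_differentiable by blast
  moreover have "diff_to_order k S (nderiv S (\<lambda>x. B (u x) (w x)) [v])" for v
  proof (rule diff_to_order_cong)
    show "diff_to_order k S (\<lambda>x. B (u x) (nderiv S w [v] x) + B (nderiv S u [v] x) (w x))"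
      by (intro diff_to_order_add assms Suc.IH u w uw)
  qed (use nderiv_bilinear[OF assms u(1) w(1)] in metis)
  ultimately show ?case by (simp add: diff_to_order_Suc)
qed

lemma diff_to_order_sum:
  assumes "fat S" "\<And>i. i \<in> I \<Longrightarrow> diff_to_order k S (u i)"
  shows "diff_to_order k S (\<lambda>x. \<Sum>i\<in>I. u i x)"
proof (cases "finite I")
  case True
  then show ?thesis using assms(2)
    by (induction I) (auto intro: diff_to_order_const diff_to_order_add assms(1))
qed (use diff_to_order_const[OF assms(1)] in simp)

lemma diff_to_order_compose:
  fixes w :: "'a::real_normed_vector \<Rightarrow> 'b::{real_normed_vector,heine_borel}"
  assumes "fat S" "w ` S \<subseteq> T"
  shows "diff_to_order k S w \<Longrightarrow> diff_to_order k T g \<Longrightarrow> diff_to_order k S (\<lambda>x. g (w x))"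
proof (induction k arbitrary: g)
  case 0
  then show ?case
    using differentiable_on_subset[OF _ assms(2)] differentiable_on_compose unfolding diff_to_order_0 by blast
next
  case (Suc k)
  have w: "w differentiable_on S" "\<And>v. diff_to_order k S (nderiv S w [v])" "diff_to_order k S w"
    and g: "g differentiable_on T" "\<And>v. diff_to_order k T (nderiv T g [v])" "diff_to_order k T g"
    using Suc.prems(1)[unfolded diff_to_order_Suc] Suc.prems(2)[unfolded diff_to_order_Suc]
      diff_to_order_SucD[OF Suc.prems(1)] diff_to_order_SucD[OF Suc.prems(2)]
    by blast+
  have "(\<lambda>x. g (w x)) differentiable_on S"
    by (rule diff_to_order_imp_differentiable[OF Suc.IH[OF w(3) g(3)]])
  moreover have "diff_to_order k S (nderiv S (\<lambda>x. g (w x)) [v])" for v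
  proof (rule diff_to_order_cong)
    show "diff_to_order k S
      (\<lambda>x. \<Sum>b\<in>frame_dirs. frame_coord b (nderiv S w [v] x) *\<^sub>R nderiv T g [b] (w x))"
      by (intro diff_to_order_sum diff_to_order_bilinear[OF _ bounded_bilinear_scaleR]
          diff_to_order_linear[OF _ bounded_linear_frame_coord] assms(1) w(2) Suc.IH w(3) g(2))
  qed (use nderiv_compose[OF assms(1) w(1) g(1) assms(2)] in metis)
  ultimately show ?case by (simp add: diff_to_order_Suc)
qed

lemma diff_to_order_Pair:
  assumes "fat S" "diff_to_order k S u" "diff_to_order k S w"
  shows "diff_to_order k S (\<lambda>x. (u x, w x))"
proof -
  have "diff_to_order k S (\<lambda>x. (u x, 0) + (0, w x))"
    using assms
    by (intro diff_to_order_add diff_to_order_linear[of S "\<lambda>x. (x, 0)"] diff_to_order_linear[of S "\<lambda>x. (0, x)"])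
       (auto intro!: bounded_linear_Pair bounded_linear_zero bounded_linear_ident)
  then show ?thesis by simp
qed

lemma diff_to_order_ident: "fat S \<Longrightarrow> diff_to_order k S (\<lambda>x. x)"
proof (induction k)
  case 0
  then show ?case by (simp add: diff_to_order_0)
next
  case (Suc k)
  have "diff_to_order k S (nderiv S (\<lambda>x. x) [v])" for v
    by (rule diff_to_order_cong[OF diff_to_order_const[OF Suc.prems, of k v]])
      (use nderiv_1_eq[OF Suc.prems] in \<open>metis has_derivative_ident\<close>)
  then show ?case by (simp add: diff_to_order_Suc)
qed

lemma smooth_on_const: "fat S \<Longrightarrow> smooth_on S (\<lambda>x. c)"
  by (simp add: smooth_on_iff_order diff_to_order_const)

lemma smooth_on_ident: "fat S \<Longrightarrow> smooth_on S (\<lambda>x. x)"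
  by (simp add: smooth_on_iff_order diff_to_order_ident)

lemma smooth_on_linear: "fat S \<Longrightarrow> bounded_linear L \<Longrightarrow> smooth_on S u \<Longrightarrow> smooth_on S (\<lambda>x. L (u x))"
  by (simp add: smooth_on_iff_order diff_to_order_linear)

lemma smooth_on_add: "fat S \<Longrightarrow> smooth_on S u \<Longrightarrow> smooth_on S w \<Longrightarrow> smooth_on S (\<lambda>x. u x + w x)"
  by (simp add: smooth_on_iff_order diff_to_order_add)

lemma smooth_on_bilinear:
  "fat S \<Longrightarrow> bounded_bilinear B \<Longrightarrow> smooth_on S u \<Longrightarrow> smooth_on S w \<Longrightarrow> smooth_on S (\<lambda>x. B (u x) (w x))"
  by (simp add: smooth_on_iff_order diff_to_order_bilinear)

lemma smooth_on_Pair: "fat S \<Longrightarrow> smooth_on S u \<Longrightarrow> smooth_on S w \<Longrightarrow> smooth_on S (\<lambda>x. (u x, w x))"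
  by (simp add: smooth_on_iff_order diff_to_order_Pair)

lemma smooth_on_compose:
  fixes w :: "'a::real_normed_vector \<Rightarrow> 'b::{real_normed_vector,heine_borel}"
  assumes "fat S" "smooth_on S w" "smooth_on T g" "w ` S \<subseteq> T"
  shows "smooth_on S (\<lambda>x. g (w x))"
  using assms by (auto simp: smooth_on_iff_order intro: diff_to_order_compose)

text \<open>A bootstrap for functions whose derivative is expressed through the function itself: if
  order \<open>k\<close> passes from \<open>u\<close> to its derivatives, all orders follow.\<close>

lemma smooth_on_Suc_I:
  assumes "fat S"
    and "\<And>k. diff_to_order k S u \<Longrightarrow> \<forall>v. diff_to_order k S (nderiv S u [v])"
    and "u differentiable_on S"
  shows "smooth_on S u"
proof -
  have "diff_to_order k S u" for k
    by (induction k) (use assms in \<open>auto simp: diff_to_order_0 diff_to_order_Suc\<close>)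
  then show ?thesis by (simp add: smooth_on_iff_order)
qed

section \<open>Reciprocal and square root\<close>

lemma smooth_on_inverse: "smooth_on {0<..} (inverse :: real \<Rightarrow> real)"
proof (rule smooth_on_Suc_I)
  show F: "fat {0::real<..}" by (rule fat_open) simp
  show "(inverse :: real \<Rightarrow> real) differentiable_on {0<..}"
    by (auto simp: differentiable_on_def intro!: derivative_intros)
  fix k assume k: "diff_to_order k {0<..} (inverse :: real \<Rightarrow> real)"
  show "\<forall>v. diff_to_order k {0<..} (nderiv {0<..} (inverse :: real \<Rightarrow> real) [v])"
  proof
    fix v :: real
    show "diff_to_order k {0<..} (nderiv {0<..} (inverse :: real \<Rightarrow> real) [v])"
    proof (rule diff_to_order_cong)
      show "diff_to_order k {0<..} (\<lambda>x. - v * (inverse x * inverse x :: real))"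
        by (intro diff_to_order_bilinear[OF _ bounded_bilinear_mult] F k diff_to_order_const)
      fix x :: real assume x: "x \<in> {0<..}"
      have "(inverse has_derivative (\<lambda>h. - (inverse x * h * inverse x))) (at x within {0<..})"
        using x by (intro has_derivative_inverse') auto
      from nderiv_1_eq[OF F x this]
      show "- v * (inverse x * inverse x) = nderiv {0<..} inverse [v] x" by simp
    qed
  qed
qed

lemma smooth_on_sqrt: "smooth_on {0<..} sqrt"
proof (rule smooth_on_Suc_I)
  show F: "fat {0::real<..}" by (rule fat_open) simp
  have D: "(sqrt has_derivative (\<lambda>h. h * (inverse x * sqrt x / 2))) (at x within {0<..})" if "x > 0" for x
  proof -
    have "(sqrt has_real_derivative inverse (sqrt x) / 2) (at x)"
      using DERIV_real_sqrt[OF that] .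
    \<comment> \<open>In this form the derivative is a product of the reciprocal, already smooth,
      with the square root itself, as the bootstrap requires.\<close>
    moreover have "inverse (sqrt x) / 2 = inverse x * sqrt x / 2"
      using that by (simp add: field_simps)
    ultimately show ?thesis
      by (metis has_field_derivative_at_within has_field_derivative_def mult_commute_abs)
  qed
  show "sqrt differentiable_on {0<..}"
    using D by (auto simp: differentiable_on_def differentiable_def)
  fix k assume k: "diff_to_order k {0<..} sqrt"
  show "\<forall>v. diff_to_order k {0<..} (nderiv {0<..} sqrt [v])"
  proof
    fix v :: real
    show "diff_to_order k {0<..} (nderiv {0<..} sqrt [v])"
    proof (rule diff_to_order_cong)
      show "diff_to_order k {0<..} (\<lambda>x. (v / 2) * (inverse x * sqrt x))"
        using smooth_on_inverse
        by (intro diff_to_order_bilinear[OF _ bounded_bilinear_mult] F k diff_to_order_const)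
           (simp add: smooth_on_iff_order)
      fix x :: real assume x: "x \<in> {0<..}"
      then show "(v / 2) * (inverse x * sqrt x) = nderiv {0<..} sqrt [v] x"
        using nderiv_1_eq[OF F x D] by simp
    qed
  qed
qed

section \<open>Uniform convergence of derivatives\<close>

definition smooth_near :: "'a::real_normed_vector set \<Rightarrow> 'a set \<Rightarrow> ('a \<Rightarrow> 'c::real_normed_vector) \<Rightarrow> bool" where
  "smooth_near S K u \<longleftrightarrow> (\<exists>Q. open Q \<and> K \<subseteq> Q \<and> smooth_on (S \<inter> Q) u)"

definition eq_near :: "'a::topological_space set \<Rightarrow> 'a set \<Rightarrow> ('a \<Rightarrow> 'c) \<Rightarrow> ('a \<Rightarrow> 'c) \<Rightarrow> bool" where
  "eq_near S K u w \<longleftrightarrow> (\<exists>Q. open Q \<and> K \<subseteq> Q \<and> (\<forall>x\<in>S \<inter> Q. u x = w x))"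

definition maps_near :: "'a::topological_space set \<Rightarrow> 'a set \<Rightarrow> 'c set \<Rightarrow> ('a \<Rightarrow> 'c) \<Rightarrow> bool" where
  "maps_near S K T u \<longleftrightarrow> (\<exists>Q. open Q \<and> K \<subseteq> Q \<and> u ` (S \<inter> Q) \<subseteq> T)"

lemma smooth_on_imp_near: "smooth_on S u \<Longrightarrow> smooth_near S K u"
  unfolding smooth_near_def by (intro exI[of _ UNIV]) simp

lemma smooth_near_mono: "smooth_near S K u \<Longrightarrow> K' \<subseteq> K \<Longrightarrow> smooth_near S K' u"
  unfolding smooth_near_def by blast

lemma smooth_on_Int_open2: "smooth_on (S \<inter> Q) u \<Longrightarrow> open Q' \<Longrightarrow> smooth_on (S \<inter> (Q \<inter> Q')) u"
  using smooth_on_Int_open[of "S \<inter> Q" u Q'] by (simp add: Int_assoc)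

lemma smooth_near_common:
  assumes "smooth_near S K u" "smooth_near S K w"
  obtains Q where "open Q" "K \<subseteq> Q" "smooth_on (S \<inter> Q) u" "smooth_on (S \<inter> Q) w"
proof -
  obtain P Q where "open P" "K \<subseteq> P" "smooth_on (S \<inter> P) u" "open Q" "K \<subseteq> Q" "smooth_on (S \<inter> Q) w"
    using assms unfolding smooth_near_def by blast
  then have "open (P \<inter> Q)" "K \<subseteq> P \<inter> Q" "smooth_on (S \<inter> (P \<inter> Q)) u" "smooth_on (S \<inter> (P \<inter> Q)) w"
    using smooth_on_Int_open2[of S P u Q] smooth_on_Int_open2[of S Q w P] by (auto simp: Int_commute)
  then show ?thesis using that by blast
qed

lemma smooth_near_cong:
  assumes "smooth_near S K u" "eq_near S K u w"
  shows "smooth_near S K w"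
proof -
  obtain P Q where "open P" "K \<subseteq> P" "smooth_on (S \<inter> P) u" "open Q" "K \<subseteq> Q" "\<forall>x\<in>S \<inter> Q. u x = w x"
    using assms unfolding smooth_near_def eq_near_def by blast
  then have "open (P \<inter> Q)" "K \<subseteq> P \<inter> Q" "smooth_on (S \<inter> (P \<inter> Q)) w"
    using smooth_on_cong[OF smooth_on_Int_open2[of S P u Q], of w] by auto
  then show ?thesis unfolding smooth_near_def by blast
qed

lemma nderiv_cong_near:
  assumes "eq_near S K u w" "x \<in> K" "x \<in> S"
  shows "nderiv S u vs x = nderiv S w vs x"
proof -
  obtain Q where Q: "open Q" "K \<subseteq> Q" "\<forall>x\<in>S \<inter> Q. u x = w x" using assms unfolding eq_near_def by blast
  have "nderiv (S \<inter> Q) u vs x = nderiv (S \<inter> Q) w vs x"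
    using Q assms by (intro nderiv_cong) auto
  moreover have "x \<in> S \<inter> Q" using Q assms by blast
  ultimately show ?thesis using nderiv_Int_open[OF Q(1)] by metis
qed

lemma smooth_near_nderiv:
  assumes "smooth_near S K u"
  shows "smooth_near S K (nderiv S u vs)"
proof -
  obtain Q where Q: "open Q" "K \<subseteq> Q" "smooth_on (S \<inter> Q) u" using assms unfolding smooth_near_def by blast
  then have "smooth_on (S \<inter> Q) (nderiv S u vs)"
    using smooth_on_cong[OF smooth_on_nderiv[OF Q(3)]] nderiv_Int_open[OF Q(1)] by metis
  then show ?thesis using Q unfolding smooth_near_def by blast
qed

lemma smooth_near_imp_continuous_on:
  assumes "smooth_near S K u" "K \<subseteq> S"
  shows "continuous_on K (nderiv S u vs)"
proof -
  obtain Q where Q: "open Q" "K \<subseteq> Q" "smooth_on (S \<inter> Q) (nderiv S u vs)"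
    using smooth_near_nderiv[OF assms(1)] unfolding smooth_near_def by blast
  have "K \<subseteq> S \<inter> Q" using assms Q by auto
  then show ?thesis using smooth_on_imp_continuous[OF Q(3)] continuous_on_subset by blast
qed

lemma smooth_near_linear:
  assumes "fat S" "bounded_linear L" "smooth_near S K u"
  shows "smooth_near S K (\<lambda>x. L (u x))"
  using assms(3) unfolding smooth_near_def
  by (blast intro: smooth_on_linear fat_Int_open assms)

lemma smooth_near_add:
  assumes "fat S" "smooth_near S K u" "smooth_near S K w"
  shows "smooth_near S K (\<lambda>x. u x + w x)"
  using smooth_near_common[OF assms(2,3)] unfolding smooth_near_def
  by (metis smooth_on_add fat_Int_open assms(1))

lemma smooth_near_bilinear:
  assumes "fat S" "bounded_bilinear B" "smooth_near S K u" "smooth_near S K w"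
  shows "smooth_near S K (\<lambda>x. B (u x) (w x))"
  using smooth_near_common[OF assms(3,4)] unfolding smooth_near_def
  by (metis smooth_on_bilinear fat_Int_open assms(1,2))

lemma near_compose_common:
  assumes w: "smooth_near S K w" "maps_near S K T w" and P: "open P" "w ` K \<subseteq> P" and K: "K \<subseteq> S"
  obtains Q where "open Q" "K \<subseteq> Q" "smooth_on (S \<inter> Q) w" "w ` (S \<inter> Q) \<subseteq> T \<inter> P"
proof -
  obtain Q1 where Q1: "open Q1" "K \<subseteq> Q1" "smooth_on (S \<inter> Q1) w"
    using w unfolding smooth_near_def by blast
  obtain Q2 where Q2: "open Q2" "K \<subseteq> Q2" "w ` (S \<inter> Q2) \<subseteq> T"
    using w unfolding maps_near_def by blast
  obtain Q3 where Q3: "open Q3" "Q3 \<inter> (S \<inter> Q1) = w -` P \<inter> (S \<inter> Q1)"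
    using smooth_on_imp_continuous[OF Q1(3)] P(1) unfolding continuous_on_open_invariant by blast
  have "K \<subseteq> Q3"
  proof
    fix x assume "x \<in> K"
    then have "x \<in> w -` P \<inter> (S \<inter> Q1)" using P K Q1 by auto
    then show "x \<in> Q3" using Q3 by blast
  qed
  show ?thesis
  proof (rule that[of "Q1 \<inter> (Q2 \<inter> Q3)"])
    show "smooth_on (S \<inter> (Q1 \<inter> (Q2 \<inter> Q3))) w"
      using Q1 Q2 Q3 by (intro smooth_on_Int_open2) auto
  qed (use \<open>K \<subseteq> Q3\<close> Q1 Q2 Q3 in auto)
qed

lemma smooth_near_compose:
  fixes w :: "'a::real_normed_vector \<Rightarrow> 'b::{real_normed_vector,heine_borel}"
  assumes "fat S" "smooth_near S K w" "maps_near S K T w" "smooth_near T K2 g" "w ` K \<subseteq> K2" "K \<subseteq> S"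
  shows "smooth_near S K (\<lambda>x. g (w x))"
proof -
  obtain P where P: "open P" "K2 \<subseteq> P" "smooth_on (T \<inter> P) g"
    using assms unfolding smooth_near_def by blast
  have "w ` K \<subseteq> P" using P assms by blast
  then obtain Q where Q: "open Q" "K \<subseteq> Q" "smooth_on (S \<inter> Q) w" "w ` (S \<inter> Q) \<subseteq> T \<inter> P"
    using near_compose_common[OF assms(2,3) P(1) _ assms(6)] by blast
  have "smooth_on (S \<inter> Q) (\<lambda>x. g (w x))"
    using smooth_on_compose[OF fat_Int_open[OF assms(1) Q(1)] Q(3) P(3) Q(4)] .
  then show ?thesis using Q unfolding smooth_near_def by blast
qed

text \<open>The functions only have to be smooth near \<open>K\<close>: in charts, a map close to \<open>u0\<close> need not be defined
  on all of \<open>S\<close>.\<close>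

definition smooth_lim ::
  "nat \<Rightarrow> 'i filter \<Rightarrow> 'a::real_normed_vector set \<Rightarrow> 'a set \<Rightarrow>
    ('i \<Rightarrow> 'a \<Rightarrow> 'c::real_normed_vector) \<Rightarrow> ('a \<Rightarrow> 'c) \<Rightarrow> bool" where
  "smooth_lim n F S K u u0 \<longleftrightarrow>
     smooth_near S K u0 \<and> (\<forall>\<^sub>F i in F. smooth_near S K (u i)) \<and>
     (\<forall>vs. length vs \<le> n \<longrightarrow> uniform_limit K (\<lambda>i. nderiv S (u i) vs) (nderiv S u0 vs) F)"

lemma smooth_lim_Suc:
  "smooth_lim (Suc n) F S K u u0 \<longleftrightarrow>
    smooth_near S K u0 \<and> (\<forall>\<^sub>F i in F. smooth_near S K (u i)) \<and> uniform_limit K u u0 F \<and>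
    (\<forall>v. smooth_lim n F S K (\<lambda>i. nderiv S (u i) [v]) (nderiv S u0 [v]))" (is "?L \<longleftrightarrow> ?R")
proof
  assume L: ?L
  then have "\<forall>\<^sub>F i in F. smooth_near S K (nderiv S (u i) [v])" for v
    unfolding smooth_lim_def by (metis (mono_tags, lifting) eventually_mono smooth_near_nderiv)
  moreover have "uniform_limit K (\<lambda>i. nderiv S (nderiv S (u i) [v]) vs) (nderiv S (nderiv S u0 [v]) vs) F"
    if "length vs \<le> n" for v vs
    using L[unfolded smooth_lim_def, THEN conjunct2, THEN conjunct2, rule_format, of "vs @ [v]"] that
    by (simp add: nderiv_append)
  moreover have "uniform_limit K u u0 F"
    using L[unfolded smooth_lim_def, THEN conjunct2, THEN conjunct2, rule_format, of "[]"] by simp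
  ultimately show ?R using L smooth_near_nderiv unfolding smooth_lim_def by blast
next
  assume R: ?R
  have "uniform_limit K (\<lambda>i. nderiv S (u i) vs) (nderiv S u0 vs) F" if "length vs \<le> Suc n" for vs
  proof (cases vs rule: rev_cases)
    case Nil
    then show ?thesis using R by simp
  next
    case (snoc ws v)
    then show ?thesis using R that unfolding smooth_lim_def by (simp only: nderiv_append) simp
  qed
  then show ?L using R by (auto simp: smooth_lim_def)
qed

lemma smooth_lim_0:
  "smooth_lim 0 F S K u u0 \<longleftrightarrow>
    smooth_near S K u0 \<and> (\<forall>\<^sub>F i in F. smooth_near S K (u i)) \<and> uniform_limit K u u0 F"
  by (simp add: smooth_lim_def)

lemma smooth_lim_mono: "smooth_lim m F S K u u0 \<Longrightarrow> n \<le> m \<Longrightarrow> smooth_lim n F S K u u0"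
  by (auto simp: smooth_lim_def)

lemma smooth_lim_D:
  assumes "smooth_lim n F S K u u0"
  shows "smooth_near S K u0" "\<forall>\<^sub>F i in F. smooth_near S K (u i)" "uniform_limit K u u0 F"
  using smooth_lim_mono[OF assms, of 0] by (auto simp: smooth_lim_0)

lemma smooth_lim_cong:
  fixes u w :: "'i \<Rightarrow> 'a::real_normed_vector \<Rightarrow> 'c::real_normed_vector"
  assumes "smooth_lim n F S K u u0" "\<forall>\<^sub>F i in F. eq_near S K (u i) (w i)" "eq_near S K u0 w0" "K \<subseteq> S"
  shows "smooth_lim n F S K w w0"
  unfolding smooth_lim_def
proof (intro conjI allI impI)
  show "smooth_near S K w0" using assms smooth_near_cong unfolding smooth_lim_def by blast
  have "\<forall>\<^sub>F i in F. smooth_near S K (u i)" using assms unfolding smooth_lim_def by blast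
  then show "\<forall>\<^sub>F i in F. smooth_near S K (w i)"
    using assms(2) by eventually_elim (rule smooth_near_cong)
  fix vs :: "'a list" assume "length vs \<le> n"
  then have "uniform_limit K (\<lambda>i. nderiv S (u i) vs) (nderiv S u0 vs) F"
    using assms unfolding smooth_lim_def by blast
  moreover have "\<forall>\<^sub>F i in F. \<forall>x\<in>K. nderiv S (u i) vs x = nderiv S (w i) vs x"
    using assms(2) by eventually_elim (use assms nderiv_cong_near in blast)
  moreover have "nderiv S u0 vs x = nderiv S w0 vs x" if "x \<in> K" for x
    using assms that nderiv_cong_near by blast
  ultimately show "uniform_limit K (\<lambda>i. nderiv S (w i) vs) (nderiv S w0 vs) F"
    using uniform_limit_cong[of K "\<lambda>i. nderiv S (u i) vs" "\<lambda>i. nderiv S (w i) vs" F "nderiv S u0 vs" "nderiv S w0 vs"]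
    by blast
qed

lemma smooth_lim_subset: "smooth_lim n F S K u u0 \<Longrightarrow> K' \<subseteq> K \<Longrightarrow> smooth_lim n F S K' u u0"
  unfolding smooth_lim_def
  by (auto intro: smooth_near_mono uniform_limit_on_subset elim!: eventually_mono)

lemma smooth_lim_const: "smooth_near S K u \<Longrightarrow> smooth_lim n F S K (\<lambda>i. u) u"
  by (auto simp: smooth_lim_def intro: uniform_limit_const)

text \<open>Here and in the next three lemmas a rule is applied on \<open>S \<inter> Q\<close>,
  where the functions are smooth, and \<open>nderiv_Int_open\<close> turns derivatives within
  \<open>S \<inter> Q\<close> into derivatives within \<open>S\<close>.\<close>

lemma eq_near_linear:
  assumes "fat S" "bounded_linear L" "smooth_near S K u"
  shows "eq_near S K (\<lambda>x. L (nderiv S u [v] x)) (nderiv S (\<lambda>x. L (u x)) [v])"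
proof -
  obtain Q where Q: "open Q" "K \<subseteq> Q" "smooth_on (S \<inter> Q) u" using assms unfolding smooth_near_def by blast
  have "L (nderiv S u [v] x) = nderiv S (\<lambda>x. L (u x)) [v] x" if x: "x \<in> S \<inter> Q" for x
    by (rule nderiv_linear[OF fat_Int_open[OF assms(1) Q(1)] assms(2)
          smooth_on_imp_differentiable[OF Q(3)] x, unfolded nderiv_Int_open[OF Q(1) x], symmetric])
  then show ?thesis using Q unfolding eq_near_def by blast
qed

lemma eq_near_add:
  assumes "fat S" "smooth_near S K u" "smooth_near S K w"
  shows "eq_near S K (\<lambda>x. nderiv S u [v] x + nderiv S w [v] x) (nderiv S (\<lambda>x. u x + w x) [v])"
proof -
  obtain Q where Q: "open Q" "K \<subseteq> Q" "smooth_on (S \<inter> Q) u" "smooth_on (S \<inter> Q) w"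
    using smooth_near_common[OF assms(2,3)] by blast
  have "nderiv S u [v] x + nderiv S w [v] x = nderiv S (\<lambda>x. u x + w x) [v] x" if x: "x \<in> S \<inter> Q" for x
    by (rule nderiv_add[OF fat_Int_open[OF assms(1) Q(1)] smooth_on_imp_differentiable[OF Q(3)]
          smooth_on_imp_differentiable[OF Q(4)] x, unfolded nderiv_Int_open[OF Q(1) x], symmetric])
  then show ?thesis using Q unfolding eq_near_def by blast
qed

lemma eq_near_bilinear:
  assumes "fat S" "bounded_bilinear B" "smooth_near S K u" "smooth_near S K w"
  shows "eq_near S K (\<lambda>x. B (u x) (nderiv S w [v] x) + B (nderiv S u [v] x) (w x))
    (nderiv S (\<lambda>x. B (u x) (w x)) [v])"
proof -
  obtain Q where Q: "open Q" "K \<subseteq> Q" "smooth_on (S \<inter> Q) u" "smooth_on (S \<inter> Q) w"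
    using smooth_near_common[OF assms(3,4)] by blast
  have "B (u x) (nderiv S w [v] x) + B (nderiv S u [v] x) (w x) = nderiv S (\<lambda>x. B (u x) (w x)) [v] x"
    if x: "x \<in> S \<inter> Q" for x
    by (rule nderiv_bilinear[OF fat_Int_open[OF assms(1) Q(1)] assms(2) smooth_on_imp_differentiable[OF Q(3)]
          smooth_on_imp_differentiable[OF Q(4)] x, unfolded nderiv_Int_open[OF Q(1) x], symmetric])
  then show ?thesis using Q unfolding eq_near_def by blast
qed

lemma eq_near_compose:
  fixes w :: "'a::real_normed_vector \<Rightarrow> 'b::{real_normed_vector,heine_borel}"
  assumes "fat S" "smooth_near S K w" "maps_near S K T w" "smooth_near T K2 g" "w ` K \<subseteq> K2" "K \<subseteq> S"
  shows "eq_near S K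
    (\<lambda>x. \<Sum>b\<in>frame_dirs. frame_coord b (nderiv S w [v] x) *\<^sub>R nderiv T g [b] (w x))
    (nderiv S (\<lambda>x. g (w x)) [v])"
proof -
  obtain P where P: "open P" "K2 \<subseteq> P" "smooth_on (T \<inter> P) g"
    using assms unfolding smooth_near_def by blast
  have "w ` K \<subseteq> P" using P assms by blast
  then obtain Q where Q: "open Q" "K \<subseteq> Q" "smooth_on (S \<inter> Q) w" "w ` (S \<inter> Q) \<subseteq> T \<inter> P"
    using near_compose_common[OF assms(2,3) P(1) _ assms(6)] by blast
  have "(\<Sum>b\<in>frame_dirs. frame_coord b (nderiv S w [v] x) *\<^sub>R nderiv T g [b] (w x))
    = nderiv S (\<lambda>x. g (w x)) [v] x" if x: "x \<in> S \<inter> Q" for x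
  proof -
    have "w x \<in> T \<inter> P" using Q x by auto
    from nderiv_Int_open[OF P(1) this] have g: "nderiv (T \<inter> P) g [b] (w x) = nderiv T g [b] (w x)" for b .
    show ?thesis
      using nderiv_compose[OF fat_Int_open[OF assms(1) Q(1)] smooth_on_imp_differentiable[OF Q(3)]
          smooth_on_imp_differentiable[OF P(3)] Q(4) x, of v]
      unfolding nderiv_Int_open[OF Q(1) x] g by simp
  qed
  then show ?thesis using Q unfolding eq_near_def by blast
qed

section \<open>Limit rules for sums, products and compositions\<close>

lemma smooth_lim_Suc_I:
  assumes "smooth_lim 0 F S K u u0"
    "\<And>v. smooth_lim n F S K (\<lambda>i. nderiv S (u i) [v]) (nderiv S u0 [v])"
  shows "smooth_lim (Suc n) F S K u u0"
  using assms by (simp only: smooth_lim_Suc smooth_lim_0) blast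

lemma smooth_lim_SucD:
  assumes "smooth_lim (Suc n) F S K u u0"
  shows "smooth_lim n F S K u u0" "smooth_lim n F S K (\<lambda>i. nderiv S (u i) [v]) (nderiv S u0 [v])"
  using assms smooth_lim_mono[OF assms, of n] by (simp_all only: smooth_lim_Suc)

lemma smooth_lim_linear:
  assumes "fat S" "bounded_linear L" "K \<subseteq> S"
  shows "smooth_lim n F S K u u0 \<Longrightarrow> smooth_lim n F S K (\<lambda>i x. L (u i x)) (\<lambda>x. L (u0 x))"
proof (induction n arbitrary: u u0)
  case 0
  note u = smooth_lim_D[OF 0]
  have "\<forall>\<^sub>F i in F. smooth_near S K (\<lambda>x. L (u i x))"
    using u(2) by (rule eventually_mono) (rule smooth_near_linear[OF assms(1,2)])
  then show ?case
    using smooth_near_linear[OF assms(1,2) u(1)] bounded_linear.uniform_limit[OF assms(2) u(3)]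
    by (simp only: smooth_lim_0)
next
  case (Suc n)
  note u = smooth_lim_D[OF Suc.prems] and du = smooth_lim_SucD[OF Suc.prems]
  show ?case
  proof (rule smooth_lim_Suc_I)
    show "smooth_lim 0 F S K (\<lambda>i x. L (u i x)) (\<lambda>x. L (u0 x))"
      by (rule smooth_lim_mono[OF Suc.IH[OF du(1)]]) simp
    fix v
    have "\<forall>\<^sub>F i in F. eq_near S K (\<lambda>x. L (nderiv S (u i) [v] x)) (nderiv S (\<lambda>x. L (u i x)) [v])"
      using u(2) by (rule eventually_mono) (rule eq_near_linear[OF assms(1,2)])
    then show "smooth_lim n F S K (\<lambda>i. nderiv S (\<lambda>x. L (u i x)) [v]) (nderiv S (\<lambda>x. L (u0 x)) [v])"
      by (rule smooth_lim_cong[OF Suc.IH[OF du(2)] _ eq_near_linear[OF assms(1,2) u(1)] assms(3)])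
  qed
qed

lemma smooth_lim_add:
  assumes "fat S" "K \<subseteq> S"
  shows "smooth_lim n F S K u u0 \<Longrightarrow> smooth_lim n F S K w w0 \<Longrightarrow>
    smooth_lim n F S K (\<lambda>i x. u i x + w i x) (\<lambda>x. u0 x + w0 x)"
proof (induction n arbitrary: u u0 w w0)
  case 0
  note u = smooth_lim_D[OF 0(1)] and w = smooth_lim_D[OF 0(2)]
  have "\<forall>\<^sub>F i in F. smooth_near S K (\<lambda>x. u i x + w i x)"
    using u(2) w(2) by (rule eventually_elim2) (rule smooth_near_add[OF assms(1)])
  then show ?case
    using smooth_near_add[OF assms(1) u(1) w(1)] uniform_limit_add[OF u(3) w(3)]
    by (simp only: smooth_lim_0)
next
  case (Suc n)
  note u = smooth_lim_D[OF Suc.prems(1)] and w = smooth_lim_D[OF Suc.prems(2)]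
  note du = smooth_lim_SucD[OF Suc.prems(1)] and dw = smooth_lim_SucD[OF Suc.prems(2)]
  show ?case
  proof (rule smooth_lim_Suc_I)
    show "smooth_lim 0 F S K (\<lambda>i x. u i x + w i x) (\<lambda>x. u0 x + w0 x)"
      by (rule smooth_lim_mono[OF Suc.IH[OF du(1) dw(1)]]) simp
    fix v
    have "\<forall>\<^sub>F i in F. eq_near S K (\<lambda>x. nderiv S (u i) [v] x + nderiv S (w i) [v] x)
        (nderiv S (\<lambda>x. u i x + w i x) [v])"
      using u(2) w(2) by (rule eventually_elim2) (rule eq_near_add[OF assms(1)])
    then show "smooth_lim n F S K (\<lambda>i. nderiv S (\<lambda>x. u i x + w i x) [v]) (nderiv S (\<lambda>x. u0 x + w0 x) [v])"
      by (rule smooth_lim_cong[OF Suc.IH[OF du(2) dw(2)] _ eq_near_add[OF assms(1) u(1) w(1)] assms(2)])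
  qed
qed

text \<open>Uniform limits of products need bounded limits, which compactness of \<open>K\<close>
  supplies. The derivative is a sum of two products with the same bilinear map, so the induction
  closes.\<close>

lemma smooth_lim_bilinear:
  assumes "fat S" "bounded_bilinear B" "K \<subseteq> S" "compact K"
  shows "smooth_lim n F S K u u0 \<Longrightarrow> smooth_lim n F S K w w0 \<Longrightarrow>
    smooth_lim n F S K (\<lambda>i x. B (u i x) (w i x)) (\<lambda>x. B (u0 x) (w0 x))"
proof (induction n arbitrary: u u0 w w0)
  case 0
  note u = smooth_lim_D[OF 0(1)] and w = smooth_lim_D[OF 0(2)]
  have bd: "bounded (u0 ` K)" "bounded (w0 ` K)"
    using smooth_near_imp_continuous_on[OF u(1) assms(3), of "[]"]
      smooth_near_imp_continuous_on[OF w(1) assms(3), of "[]"] assms(4)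
    by (auto intro!: compact_imp_bounded compact_continuous_image)
  have "\<forall>\<^sub>F i in F. smooth_near S K (\<lambda>x. B (u i x) (w i x))"
    using u(2) w(2) by (rule eventually_elim2) (rule smooth_near_bilinear[OF assms(1,2)])
  then show ?case
    using smooth_near_bilinear[OF assms(1,2) u(1) w(1)]
      bounded_bilinear.bounded_uniform_limit[OF assms(2) u(3) w(3) bd(2,1)]
    by (simp only: smooth_lim_0)
next
  case (Suc n)
  note u = smooth_lim_D[OF Suc.prems(1)] and w = smooth_lim_D[OF Suc.prems(2)]
  note du = smooth_lim_SucD[OF Suc.prems(1)] and dw = smooth_lim_SucD[OF Suc.prems(2)]
  show ?case
  proof (rule smooth_lim_Suc_I)
    show "smooth_lim 0 F S K (\<lambda>i x. B (u i x) (w i x)) (\<lambda>x. B (u0 x) (w0 x))"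
      by (rule smooth_lim_mono[OF Suc.IH[OF du(1) dw(1)]]) simp
    fix v
    have "\<forall>\<^sub>F i in F. eq_near S K (\<lambda>x. B (u i x) (nderiv S (w i) [v] x) + B (nderiv S (u i) [v] x) (w i x))
        (nderiv S (\<lambda>x. B (u i x) (w i x)) [v])"
      using u(2) w(2) by (rule eventually_elim2) (rule eq_near_bilinear[OF assms(1,2)])
    then show "smooth_lim n F S K (\<lambda>i. nderiv S (\<lambda>x. B (u i x) (w i x)) [v]) (nderiv S (\<lambda>x. B (u0 x) (w0 x)) [v])"
      by (rule smooth_lim_cong[OF smooth_lim_add[OF assms(1,3) Suc.IH[OF du(1) dw(2)] Suc.IH[OF du(2) dw(1)]]
            _ eq_near_bilinear[OF assms(1,2) u(1) w(1)] assms(3)])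
  qed
qed

lemma smooth_lim_sum:
  assumes "fat S" "K \<subseteq> S" "\<And>j. j \<in> J \<Longrightarrow> smooth_lim n F S K (u j) (u0 j)"
  shows "smooth_lim n F S K (\<lambda>i x. \<Sum>j\<in>J. u j i x) (\<lambda>x. \<Sum>j\<in>J. u0 j x)"
proof -
  have 0: "smooth_lim n F S K (\<lambda>i x. 0) (\<lambda>x. 0)"
    by (intro smooth_lim_const smooth_on_imp_near smooth_on_const assms)
  show ?thesis
  proof (cases "finite J")
    case True
    then show ?thesis using assms(3)
    proof (induction J)
      case (insert j J)
      then have "smooth_lim n F S K (\<lambda>i x. u j i x + (\<Sum>j\<in>J. u j i x)) (\<lambda>x. u0 j x + (\<Sum>j\<in>J. u0 j x))"
        by (intro smooth_lim_add assms(1,2)) auto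
      then show ?case using insert by simp
    qed (use 0 in simp)
  qed (use 0 in simp)
qed

text \<open>Inner and outer maps both vary. The compact set \<open>K2\<close> catches the images, so
  that uniform convergence of the outer maps combines with uniform continuity of \<open>g0\<close>
  on \<open>K2\<close>; higher orders follow from the chain rule in the frame.\<close>

lemma smooth_lim_compose:
  fixes w :: "'i \<Rightarrow> 'a::real_normed_vector \<Rightarrow> 'b::{real_normed_vector,heine_borel}"
  assumes S: "fat S" "K \<subseteq> S" "compact K" and K2: "compact K2" "K2 \<subseteq> T"
    and w: "\<forall>\<^sub>F i in F. maps_near S K T (w i) \<and> w i ` K \<subseteq> K2" "maps_near S K T w0" "w0 ` K \<subseteq> K2"
  shows "smooth_lim n F S K w w0 \<Longrightarrow> smooth_lim n F T K2 g g0 \<Longrightarrow>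
    smooth_lim n F S K (\<lambda>i x. g i (w i x)) (\<lambda>x. g0 (w0 x))"
proof (induction n arbitrary: g g0)
  case 0
  note gD = smooth_lim_D[OF 0(2)] and wD = smooth_lim_D[OF 0(1)]
  have cont: "uniformly_continuous_on K2 g0"
    using smooth_near_imp_continuous_on[OF gD(1) K2(2), of "[]"] K2(1)
    by (auto intro: compact_uniformly_continuous)
  have "uniform_limit K (\<lambda>i x. g i (w i x)) (\<lambda>x. g0 (w0 x)) F"
  proof (rule uniform_limitI)
    fix e :: real assume e: "e > 0"
    then have "e / 2 > 0" by simp
    from uniform_limitD[OF gD(3) this]
    have 1: "\<forall>\<^sub>F i in F. \<forall>x\<in>K2. dist (g i x) (g0 x) < e / 2" .
    have "\<forall>\<^sub>F i in F. \<forall>x\<in>K. w i x \<in> K2"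
      using w(1) by (rule eventually_mono) blast
    from uniform_limit_compose_uniformly_continuous_on[OF wD(3) cont this compact_imp_closed[OF K2(1)]]
    have "uniform_limit K (\<lambda>i x. g0 (w i x)) (\<lambda>x. g0 (w0 x)) F" .
    from uniform_limitD[OF this \<open>e / 2 > 0\<close>]
    have 2: "\<forall>\<^sub>F i in F. \<forall>x\<in>K. dist (g0 (w i x)) (g0 (w0 x)) < e / 2" .
    show "\<forall>\<^sub>F i in F. \<forall>x\<in>K. dist (g i (w i x)) (g0 (w0 x)) < e"
      using 1 2 w(1)
    proof eventually_elim
      case (elim i)
      show ?case
      proof
        fix x assume "x \<in> K"
        then have "dist (g i (w i x)) (g0 (w i x)) < e / 2" "dist (g0 (w i x)) (g0 (w0 x)) < e / 2"
          using elim by auto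
        then show "dist (g i (w i x)) (g0 (w0 x)) < e"
          using dist_triangle[of "g i (w i x)" "g0 (w0 x)" "g0 (w i x)"] by linarith
      qed
    qed
  qed
  moreover have "\<forall>\<^sub>F i in F. smooth_near S K (\<lambda>x. g i (w i x))"
    using gD(2) wD(2) w(1) by eventually_elim (use smooth_near_compose S in blast)
  moreover have "smooth_near S K (\<lambda>x. g0 (w0 x))"
    using gD(1) wD(1) w smooth_near_compose S by blast
  ultimately show ?case by (simp add: smooth_lim_0)
next
  case (Suc n)
  note gD = smooth_lim_D[OF Suc.prems(2)] and wD = smooth_lim_D[OF Suc.prems(1)]
  note dw = smooth_lim_SucD[OF Suc.prems(1)] and dg = smooth_lim_SucD[OF Suc.prems(2)]
  show ?case
  proof (rule smooth_lim_Suc_I)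
    show "smooth_lim 0 F S K (\<lambda>i x. g i (w i x)) (\<lambda>x. g0 (w0 x))"
      by (rule smooth_lim_mono[OF Suc.IH[OF dw(1) dg(1)]]) simp
    fix v
    have 1: "smooth_lim n F S K
      (\<lambda>i x. \<Sum>b\<in>frame_dirs. frame_coord b (nderiv S (w i) [v] x) *\<^sub>R nderiv T (g i) [b] (w i x))
      (\<lambda>x. \<Sum>b\<in>frame_dirs. frame_coord b (nderiv S w0 [v] x) *\<^sub>R nderiv T g0 [b] (w0 x))"
      by (rule smooth_lim_sum[OF S(1,2)], rule smooth_lim_bilinear[OF S(1) bounded_bilinear_scaleR S(2,3)])
        (rule smooth_lim_linear[OF S(1) bounded_linear_frame_coord S(2) dw(2)], rule Suc.IH[OF dw(1) dg(2)])
    have 2: "\<forall>\<^sub>F i in F. eq_near S K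
       (\<lambda>x. \<Sum>b\<in>frame_dirs. frame_coord b (nderiv S (w i) [v] x) *\<^sub>R nderiv T (g i) [b] (w i x))
       (nderiv S (\<lambda>x. g i (w i x)) [v])"
      using gD(2) wD(2) w(1) by eventually_elim (use eq_near_compose S in blast)
    show "smooth_lim n F S K (\<lambda>i. nderiv S (\<lambda>x. g i (w i x)) [v]) (nderiv S (\<lambda>x. g0 (w0 x)) [v])"
      by (rule smooth_lim_cong[OF 1 2 eq_near_compose[OF S(1) wD(1) w(2) gD(1) w(3) S(2)] S(2)])
  qed
qed

lemma smooth_lim_Pair:
  assumes "fat S" "K \<subseteq> S" "smooth_lim n F S K u u0" "smooth_lim n F S K w w0"
  shows "smooth_lim n F S K (\<lambda>i x. (u i x, w i x)) (\<lambda>x. (u0 x, w0 x))"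
proof -
  have "smooth_lim n F S K (\<lambda>i x. (u i x, 0) + (0, w i x)) (\<lambda>x. (u0 x, 0) + (0, w0 x))"
    by (intro smooth_lim_add[OF assms(1,2)] smooth_lim_linear[OF assms(1) _ assms(2) assms(3)]
        smooth_lim_linear[OF assms(1) _ assms(2) assms(4)]
        bounded_linear_Pair bounded_linear_zero bounded_linear_ident)
  then show ?thesis by simp
qed

section \<open>Multilinearity in the directions and uniformity over unit directions\<close>

lemma nderiv_scaled_sum:
  assumes "fat S" "\<And>j. j \<in> J \<Longrightarrow> smooth_on S (W j)" "x \<in> S"
  shows "nderiv S (\<lambda>x. \<Sum>j\<in>J. c j *\<^sub>R W j x) vs x = (\<Sum>j\<in>J. c j *\<^sub>R nderiv S (W j) vs x)"
  using assms(3)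
proof (induction vs arbitrary: x)
  case (Cons v vs)
  have "(nderiv S (W j) vs has_derivative (\<lambda>v. nderiv S (W j) (v # vs) x)) (at x within S)" if "j \<in> J" for j
    using smooth_on_imp_differentiable[OF smooth_on_nderiv[OF assms(2)[OF that], of vs]] Cons.prems
      has_derivative_nderiv[of "nderiv S (W j) vs" x S] by (simp add: differentiable_on_def)
  then have "((\<lambda>x. \<Sum>j\<in>J. c j *\<^sub>R nderiv S (W j) vs x) has_derivative
      (\<lambda>v. \<Sum>j\<in>J. c j *\<^sub>R nderiv S (W j) (v # vs) x)) (at x within S)"
    by (intro has_derivative_sum has_derivative_scaleR_right)
  from nderiv_1_eq[OF assms(1) Cons.prems this]
  have "nderiv S (\<lambda>x. \<Sum>j\<in>J. c j *\<^sub>R nderiv S (W j) vs x) [v] x = (\<Sum>j\<in>J. c j *\<^sub>R nderiv S (W j) (v # vs) x)" .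
  moreover have "nderiv S (\<lambda>x. \<Sum>j\<in>J. c j *\<^sub>R W j x) (v # vs) x
      = nderiv S (nderiv S (\<lambda>x. \<Sum>j\<in>J. c j *\<^sub>R W j x) vs) [v] x"
    using nderiv_append[of S _ "[v]" vs] by simp
  moreover have "\<dots> = nderiv S (\<lambda>x. \<Sum>j\<in>J. c j *\<^sub>R nderiv S (W j) vs x) [v] x"
    by (rule nderiv_cong[OF Cons.IH Cons.prems])
  ultimately show ?case by metis
qed simp

text \<open>After the derivatives along \<open>bs\<close>, the next one is linear in its direction
  at every point of a neighbourhood, so the later derivatives along \<open>us\<close> act on the sum
  term by term.\<close>

lemma nderiv_multilinear:
  assumes S: "fat S" and w: "smooth_near S K w" and x: "x \<in> K" "x \<in> S"
  shows "nderiv S w (us @ (\<Sum>j\<in>J. c j *\<^sub>R a j) # bs) x = (\<Sum>j\<in>J. c j *\<^sub>R nderiv S w (us @ a j # bs) x)"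
proof -
  obtain Q where Q: "open Q" "K \<subseteq> Q" "smooth_on (S \<inter> Q) w" using w unfolding smooth_near_def by blast
  define T where "T = S \<inter> Q"
  have T: "fat T" unfolding T_def using S Q fat_Int_open by blast
  have xT: "x \<in> T" using x Q T_def by blast
  have sm: "smooth_on T (nderiv T w vs)" for vs using Q(3) T_def smooth_on_nderiv by blast
  have eq: "nderiv T w ((\<Sum>j\<in>J. c j *\<^sub>R a j) # bs) y = (\<Sum>j\<in>J. c j *\<^sub>R nderiv T w (a j # bs) y)" if "y \<in> T" for y
  proof -
    have "nderiv T w bs differentiable (at y within T)"
      using smooth_on_imp_differentiable[OF sm] that by (simp add: differentiable_on_def)
    then have lin: "linear (\<lambda>v. nderiv T w (v # bs) y)"
      using has_derivative_linear[OF has_derivative_nderiv] by simp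
    show ?thesis
      unfolding linear_sum[OF lin] linear_scale[OF lin] by simp
  qed
  have "nderiv T w (us @ (\<Sum>j\<in>J. c j *\<^sub>R a j) # bs) x
      = nderiv T (\<lambda>y. \<Sum>j\<in>J. c j *\<^sub>R nderiv T w (a j # bs) y) us x"
    unfolding nderiv_append by (rule nderiv_cong[OF eq xT])
  also have "\<dots> = (\<Sum>j\<in>J. c j *\<^sub>R nderiv T w (us @ a j # bs) x)"
    unfolding nderiv_append by (rule nderiv_scaled_sum[OF T sm xT])
  finally show ?thesis
    unfolding T_def nderiv_Int_open[OF Q(1) xT[unfolded T_def]] .
qed

lemma nderiv_expand:
  fixes w :: "'a::{real_normed_vector,heine_borel} \<Rightarrow> 'c::real_normed_vector"
  assumes "fat S" "smooth_near S K w" "x \<in> K" "x \<in> S"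
  shows "nderiv S w (us @ v # bs) x = (\<Sum>b\<in>frame_dirs. frame_coord b v *\<^sub>R nderiv S w (us @ b # bs) x)"
  using nderiv_multilinear[OF assms, of us "\<lambda>b. frame_coord b v" "\<lambda>b. b" frame_dirs bs]
  by (simp add: frame_expand)

lemma nderiv_scale_dirs:
  assumes "fat S" "smooth_near S K w" "x \<in> K" "x \<in> S"
  shows "nderiv S w (map ((*\<^sub>R) r) vs @ bs) x = r ^ length vs *\<^sub>R nderiv S w (vs @ bs) x"
proof (induction vs arbitrary: bs rule: rev_induct)
  case (snoc v vs)
  have "nderiv S w (map ((*\<^sub>R) r) (vs @ [v]) @ bs) x = r ^ length vs *\<^sub>R nderiv S w (vs @ (r *\<^sub>R v) # bs) x"
    using snoc[of "(r *\<^sub>R v) # bs"] by simp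
  also have "nderiv S w (vs @ (r *\<^sub>R v) # bs) x = r *\<^sub>R nderiv S w (vs @ v # bs) x"
    using nderiv_multilinear[OF assms, of vs "\<lambda>_. r" "\<lambda>_. v" "{()}" bs] by simp
  finally show ?case by (simp add: mult.commute)
qed simp

text \<open>A list of \<open>n\<close> directions is coded by the first \<open>n\<close> terms of a
  sequence. Expanding them one by one in the frame leaves fixed directions, whose derivatives are
  continuous in the point, multiplied by continuous coordinates.\<close>

lemma continuous_on_nderiv_joint:
  fixes w :: "'a::{real_normed_vector,heine_borel} \<Rightarrow> 'c::real_normed_vector"
  assumes S: "fat S" "K \<subseteq> S" and w: "smooth_near S K w"
  shows "continuous_on (K \<times> UNIV) (\<lambda>z. nderiv S w (map (snd z) [0..<n] @ bs) (fst z))"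
proof (induction n arbitrary: bs)
  case 0
  have "continuous_on (K \<times> UNIV) (\<lambda>z. nderiv S w bs (fst z))"
    by (rule continuous_on_compose2[OF smooth_near_imp_continuous_on[OF w S(2)]
          continuous_on_fst[OF continuous_on_id]]) auto
  then show ?case by simp
next
  case (Suc n)
  have eq: "nderiv S w (map (snd z) [0..<Suc n] @ bs) (fst z) =
    (\<Sum>b\<in>frame_dirs. frame_coord b (snd z n) *\<^sub>R nderiv S w (map (snd z) [0..<n] @ b # bs) (fst z))"
    if "z \<in> K \<times> UNIV" for z
    using nderiv_expand[OF S(1) w, of "fst z" "map (snd z) [0..<n]" "snd z n" bs] that S by auto
  have "continuous_on (K \<times> UNIV) (\<lambda>z. (snd z :: nat \<Rightarrow> 'a) n)"
    by (rule continuous_on_product_then_coordinatewise[OF continuous_on_snd[OF continuous_on_id]])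
  then have "continuous_on (K \<times> UNIV) (\<lambda>z. \<Sum>b\<in>frame_dirs.
      frame_coord b ((snd z :: nat \<Rightarrow> 'a) n) *\<^sub>R nderiv S w (map (snd z) [0..<n] @ b # bs) (fst z))"
    by (intro continuous_on_sum continuous_on_scaleR Suc.IH
        bounded_linear.continuous_on[OF bounded_linear_frame_coord])
  then show ?case by (rule continuous_on_eq) (use eq in simp)
qed

text \<open>Sequences are used, rather than lists of a fixed length, so that one space, compact by
  Tychonoff's theorem, carries the directions for every order.\<close>

definition ball_seqs :: "(nat \<Rightarrow> 'a::{real_normed_vector,heine_borel}) set" where
  "ball_seqs = {s. \<forall>i. norm (s i) \<le> 1}"

lemma compact_ball_seqs: "compact ball_seqs"
proof -
  have eq: "ball_seqs = PiE UNIV (\<lambda>_. cball 0 1)"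
    by (auto simp: ball_seqs_def PiE_def Pi_def)
  have "compactin (product_topology (\<lambda>i::nat. euclidean :: 'a topology) UNIV) (PiE UNIV (\<lambda>_. cball 0 1))"
    unfolding compactin_PiE by (simp add: compactin_euclidean_iff)
  then show ?thesis
    unfolding eq euclidean_product_topology by (simp add: compactin_euclidean_iff)
qed

lemma uniform_limit_sum':
  fixes f :: "'j \<Rightarrow> 'i \<Rightarrow> 'b \<Rightarrow> 'c::real_normed_vector"
  assumes "\<And>j. j \<in> J \<Longrightarrow> uniform_limit X (f j) (l j) F"
  shows "uniform_limit X (\<lambda>i x. \<Sum>j\<in>J. f j i x) (\<lambda>x. \<Sum>j\<in>J. l j x) F"
proof (cases "finite J")
  case True
  then show ?thesis using assms
  proof (induction J)
    case (insert j J)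
    then have "uniform_limit X (\<lambda>i x. f j i x + (\<Sum>j\<in>J. f j i x)) (\<lambda>x. l j x + (\<Sum>j\<in>J. l j x)) F"
      by (intro uniform_limit_add) auto
    then show ?case using insert by simp
  qed (simp add: uniform_limit_const)
qed (simp add: uniform_limit_const)

lemma uniform_limit_scale_bounded:
  fixes f :: "'i \<Rightarrow> 'b \<Rightarrow> 'c::real_normed_vector"
  assumes f: "uniform_limit X f l F" and c: "\<And>x. x \<in> X \<Longrightarrow> \<bar>c x\<bar> \<le> C"
  shows "uniform_limit X (\<lambda>i x. c x *\<^sub>R f i x) (\<lambda>x. c x *\<^sub>R l x) F"
proof (rule uniform_limitI)
  fix e :: real assume e: "e > 0"
  define D where "D = max C 1"
  have "e / D > 0" using e by (simp add: D_def)
  from uniform_limitD[OF f this]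
  show "\<forall>\<^sub>F i in F. \<forall>x\<in>X. dist (c x *\<^sub>R f i x) (c x *\<^sub>R l x) < e"
  proof (rule eventually_mono, intro ballI)
    fix i x assume *: "\<forall>x\<in>X. dist (f i x) (l x) < e / D" "x \<in> X"
    have "dist (c x *\<^sub>R f i x) (c x *\<^sub>R l x) = \<bar>c x\<bar> * dist (f i x) (l x)"
      by (simp add: dist_norm flip: scaleR_diff_right)
    also have "\<dots> \<le> D * dist (f i x) (l x)"
      using c[OF *(2)] by (intro mult_right_mono) (auto simp: D_def)
    also have "\<dots> < D * (e / D)"
      using * by (intro mult_strict_left_mono) (auto simp: D_def)
    also have "\<dots> = e" by (simp add: D_def)
    finally show "dist (c x *\<^sub>R f i x) (c x *\<^sub>R l x) < e" .
  qed
qed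

text \<open>\<open>smooth_lim\<close> gives convergence for each fixed list of directions. Expansion
  in the frame makes it uniform over unit directions, since the coordinates are bounded on the unit
  ball.\<close>

lemma uniform_limit_nderiv_joint:
  fixes u :: "'i \<Rightarrow> 'a::{real_normed_vector,heine_borel} \<Rightarrow> 'c::real_normed_vector"
  assumes S: "fat S" "K \<subseteq> S" and u: "smooth_lim N F S K u u0"
  shows "n + length bs \<le> N \<Longrightarrow>
    uniform_limit (K \<times> ball_seqs) (\<lambda>i z. nderiv S (u i) (map (snd z) [0..<n] @ bs) (fst z))
      (\<lambda>z. nderiv S u0 (map (snd z) [0..<n] @ bs) (fst z)) F"
proof (induction n arbitrary: bs)
  case 0
  then have "uniform_limit K (\<lambda>i. nderiv S (u i) bs) (nderiv S u0 bs) F"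
    using u by (simp add: smooth_lim_def)
  then have "uniform_limit (K \<times> ball_seqs) (\<lambda>i z. nderiv S (u i) bs (fst z)) (\<lambda>z. nderiv S u0 bs (fst z)) F"
    by (rule uniform_limit_compose') auto
  then show ?case by simp
next
  case (Suc n)
  have lim: "uniform_limit (K \<times> ball_seqs)
     (\<lambda>i z. \<Sum>b\<in>frame_dirs. frame_coord b (snd z n) *\<^sub>R nderiv S (u i) (map (snd z) [0..<n] @ b # bs) (fst z))
     (\<lambda>z. \<Sum>b\<in>frame_dirs. frame_coord b (snd z n) *\<^sub>R nderiv S u0 (map (snd z) [0..<n] @ b # bs) (fst z)) F"
  proof (rule uniform_limit_sum')
    fix b :: 'a
    obtain C where C: "\<And>x. norm (frame_coord b x) \<le> norm x * C"
      using bounded_linear.bounded[OF bounded_linear_frame_coord] by blast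
    have "\<bar>frame_coord b (s n)\<bar> \<le> \<bar>C\<bar>" if "s \<in> ball_seqs" for s
    proof -
      have "\<bar>frame_coord b (s n)\<bar> \<le> norm (s n) * \<bar>C\<bar>"
        using C[of "s n"] mult_left_mono[OF abs_ge_self[of C] norm_ge_zero[of "s n"]] by simp
      also have "\<dots> \<le> 1 * \<bar>C\<bar>" using that by (intro mult_right_mono) (auto simp: ball_seqs_def)
      finally show ?thesis by simp
    qed
    then show "uniform_limit (K \<times> ball_seqs)
      (\<lambda>i z. frame_coord b (snd z n) *\<^sub>R nderiv S (u i) (map (snd z) [0..<n] @ b # bs) (fst z))
      (\<lambda>z. frame_coord b (snd z n) *\<^sub>R nderiv S u0 (map (snd z) [0..<n] @ b # bs) (fst z)) F"
      using Suc.prems by (intro uniform_limit_scale_bounded[where C = "\<bar>C\<bar>"] Suc.IH) auto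
  qed
  have eq: "(\<Sum>b\<in>frame_dirs. frame_coord b (snd z n) *\<^sub>R nderiv S w (map (snd z) [0..<n] @ b # bs) (fst z))
      = nderiv S w (map (snd z) [0..<Suc n] @ bs) (fst z)"
    if "z \<in> K \<times> ball_seqs" "smooth_near S K w" for z and w :: "'a \<Rightarrow> 'c"
    using nderiv_expand[OF S(1) that(2), of "fst z" "map (snd z) [0..<n]" "snd z n" bs] that S by auto
  have ev: "\<forall>\<^sub>F i in F. \<forall>z\<in>K \<times> ball_seqs.
      (\<Sum>b\<in>frame_dirs. frame_coord b (snd z n) *\<^sub>R nderiv S (u i) (map (snd z) [0..<n] @ b # bs) (fst z))
      = nderiv S (u i) (map (snd z) [0..<Suc n] @ bs) (fst z)"
    using smooth_lim_D(2)[OF u] by (rule eventually_mono) (blast intro: eq)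
  show ?case
    by (rule uniform_limit_cong[THEN iffD1, OF ev eq lim]) (auto intro: smooth_lim_D(1)[OF u])
qed

text \<open>A subbasic neighbourhood of the limit \<open>u0\<close> may be centred at another
  function \<open>k\<close>. The strict inequality for \<open>u0\<close> holds with a uniform
  margin, because the difference of the jets attains its maximum on the compact set of points and
  directions.\<close>

lemma smooth_lim_eventually_close:
  fixes u :: "'i \<Rightarrow> 'a::{real_normed_vector,heine_borel} \<Rightarrow> 'c::real_normed_vector"
  assumes S: "fat S" "K \<subseteq> S" "compact K" and u: "smooth_lim r F S K u u0" and k: "smooth_near S K k"
    and close: "\<And>vs y. length vs \<le> r \<Longrightarrow> \<forall>v\<in>set vs. norm v \<le> 1 \<Longrightarrow> y \<in> K \<Longrightarrow>
      norm (nderiv S u0 vs y - nderiv S k vs y) < e"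
    and e: "e > 0"
  shows "\<forall>\<^sub>F i in F. \<forall>vs. length vs \<le> r \<and> (\<forall>v\<in>set vs. norm v \<le> 1) \<longrightarrow>
    (\<forall>y\<in>K. norm (nderiv S (u i) vs y - nderiv S k vs y) < e)"
proof -
  define jet where "jet w n z = nderiv S w (map (snd z) [0..<n]) (fst z)"
    for w :: "'a \<Rightarrow> 'c" and n and z :: "'a \<times> (nat \<Rightarrow> 'a)"
  define Z :: "('a \<times> (nat \<Rightarrow> 'a)) set" where "Z = K \<times> ball_seqs"
  have Z: "compact Z" unfolding Z_def using S(3) compact_ball_seqs by (rule compact_Times)
  have jet_close: "norm (jet u0 n z - jet k n z) < e" if "n \<le> r" "z \<in> Z" for n z
    unfolding jet_def using that by (intro close) (auto simp: Z_def ball_seqs_def)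
  have cont: "continuous_on Z (jet w n)" if "smooth_near S K w" for w n
    using continuous_on_nderiv_joint[OF S(1,2) that, of n "[]"] unfolding jet_def Z_def
    by (auto intro: continuous_on_subset)
  have ev: "\<forall>\<^sub>F i in F. \<forall>z\<in>Z. norm (jet (u i) n z - jet k n z) < e" if n: "n \<le> r" for n
  proof (cases "Z = {}")
    case False
    have "continuous_on Z (\<lambda>z. norm (jet u0 n z - jet k n z))"
      by (intro continuous_intros cont k smooth_lim_D(1)[OF u])
    from continuous_attains_sup[OF Z False this]
    obtain z0 where z0: "z0 \<in> Z" "\<And>z. z \<in> Z \<Longrightarrow> norm (jet u0 n z - jet k n z) \<le> norm (jet u0 n z0 - jet k n z0)"
      by blast
    define d where "d = e - norm (jet u0 n z0 - jet k n z0)"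
    have "d > 0" using jet_close[OF n z0(1)] by (simp add: d_def)
    have "uniform_limit Z (\<lambda>i. jet (u i) n) (jet u0 n) F"
      using uniform_limit_nderiv_joint[OF S(1,2) u, of n "[]"] n unfolding jet_def Z_def by simp
    from uniform_limitD[OF this \<open>d > 0\<close>] show ?thesis
    proof (rule eventually_mono, intro ballI)
      fix i z assume *: "\<forall>z\<in>Z. dist (jet (u i) n z) (jet u0 n z) < d" "z \<in> Z"
      then have "norm (jet (u i) n z - jet u0 n z) < d" by (simp add: dist_norm)
      then show "norm (jet (u i) n z - jet k n z) < e"
        using z0(2)[OF *(2)] norm_triangle_ineq[of "jet (u i) n z - jet u0 n z" "jet u0 n z - jet k n z"]
        by (simp add: d_def)
    qed
  qed simp
  have "\<forall>\<^sub>F i in F. \<forall>n\<in>{..r}. \<forall>z\<in>Z. norm (jet (u i) n z - jet k n z) < e"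
    using ev by (intro eventually_ball_finite) auto
  then show ?thesis
  proof (rule eventually_mono, intro allI impI ballI)
    fix i and vs :: "'a list" and y
    assume *: "\<forall>n\<in>{..r}. \<forall>z\<in>Z. norm (jet (u i) n z - jet k n z) < e"
      "length vs \<le> r \<and> (\<forall>v\<in>set vs. norm v \<le> 1)" "y \<in> K"
    \<comment> \<open>Padding by 0 keeps the sequence in the unit ball; only its first
      \<open>length vs\<close> terms matter.\<close>
    define s :: "nat \<Rightarrow> 'a" where "s j = (if j < length vs then vs ! j else 0)" for j
    have vs: "map s [0..<length vs] = vs"
      by (rule nth_equalityI) (auto simp: s_def)
    have "(y, s) \<in> Z" using * by (auto simp: Z_def ball_seqs_def s_def)
    then have "norm (jet (u i) (length vs) (y, s) - jet k (length vs) (y, s)) < e" using * by auto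
    then show "norm (nderiv S (u i) vs y - nderiv S k vs y) < e" by (simp add: jet_def vs)
  qed
qed

text \<open>The neighbourhoods control unit directions; all others are reached by rescaling the list
  and using homogeneity in every direction.\<close>

lemma smooth_lim_if_eventually_close:
  fixes u :: "'i \<Rightarrow> 'a::{real_normed_vector,heine_borel} \<Rightarrow> 'c::real_normed_vector"
  assumes S: "fat S" "K \<subseteq> S" and u0: "smooth_near S K u0" and u: "\<forall>\<^sub>F i in F. smooth_near S K (u i)"
    and close: "\<And>e. e > 0 \<Longrightarrow> \<forall>\<^sub>F i in F. \<forall>vs. length vs \<le> r \<and> (\<forall>v\<in>set vs. norm v \<le> 1) \<longrightarrow>
      (\<forall>y\<in>K. norm (nderiv S (u i) vs y - nderiv S u0 vs y) < e)"
  shows "smooth_lim r F S K u u0"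
  unfolding smooth_lim_def
proof (intro conjI allI impI u0 u)
  fix vs :: "'a list" assume vs: "length vs \<le> r"
  \<comment> \<open>\<open>M\<close> bounds the norm of every direction in \<open>vs\<close>; the
    summand 1 makes it positive even if all of them vanish or the list is empty.\<close>
  define M where "M = (\<Sum>v\<leftarrow>vs. norm v) + 1"
  have M: "M > 0" "\<And>v. v \<in> set vs \<Longrightarrow> norm v \<le> M"
  proof -
    have "0 \<le> (\<Sum>v\<leftarrow>vs. norm v)" by (intro sum_list_nonneg) auto
    then show "M > 0" by (simp add: M_def)
    fix v assume "v \<in> set vs"
    then have "norm v \<le> (\<Sum>v\<leftarrow>vs. norm v)" by (intro member_le_sum_list) auto
    then show "norm v \<le> M" by (simp add: M_def)
  qed
  define ws where "ws = map ((*\<^sub>R) (1 / M)) vs"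
  have ws: "length ws = length vs" "\<forall>v\<in>set ws. norm v \<le> 1" "map ((*\<^sub>R) M) ws = vs"
    using M by (auto simp: ws_def o_def field_simps intro!: map_idI)
  have scale: "nderiv S w vs y = M ^ length vs *\<^sub>R nderiv S w ws y" if "smooth_near S K w" "y \<in> K" for w :: "'a \<Rightarrow> 'c" and y
    using nderiv_scale_dirs[OF S(1) that, of M ws "[]"] that S ws by auto
  show "uniform_limit K (\<lambda>i. nderiv S (u i) vs) (nderiv S u0 vs) F"
  proof (rule uniform_limitI)
    fix e :: real assume e: "e > 0"
    then have "e / M ^ length vs > 0" using M by simp
    from close[OF this] u
    show "\<forall>\<^sub>F i in F. \<forall>x\<in>K. dist (nderiv S (u i) vs x) (nderiv S u0 vs x) < e"
    proof (rule eventually_elim2, intro ballI)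
      fix i y assume *: "\<forall>vs'. length vs' \<le> r \<and> (\<forall>v\<in>set vs'. norm v \<le> 1) \<longrightarrow>
        (\<forall>y\<in>K. norm (nderiv S (u i) vs' y - nderiv S u0 vs' y) < e / M ^ length vs)"
        "smooth_near S K (u i)" "y \<in> K"
      have "norm (nderiv S (u i) ws y - nderiv S u0 ws y) < e / M ^ length vs"
        using *(1,3) ws vs by simp
      then have "M ^ length vs * norm (nderiv S (u i) ws y - nderiv S u0 ws y) < e"
        using M by (simp add: field_simps)
      moreover have "dist (nderiv S (u i) vs y) (nderiv S u0 vs y)
          = M ^ length vs * norm (nderiv S (u i) ws y - nderiv S u0 ws y)"
        using M unfolding dist_norm scale[OF *(2,3)] scale[OF u0 *(3)] by (simp flip: scaleR_diff_right)
      ultimately show "dist (nderiv S (u i) vs y) (nderiv S u0 vs y) < e" by simp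
    qed
  qed
qed

section \<open>Smooth maps between domains in manifolds\<close>

text \<open>The domains, possibly with boundary, on which the calculus is carried out. Both the
  interval and the tube are of this kind.\<close>

definition fat_domain ::
  "('a::topological_space, 'm::{real_normed_vector,heine_borel}) chart set \<Rightarrow> 'a set \<Rightarrow> bool" where
  "fat_domain A X \<longleftrightarrow> smooth_atlas A \<and> (\<forall>(U, c)\<in>A. fat (c ` (U \<inter> X)))"

lemma fat_domainD:
  assumes "fat_domain A X"
  shows "smooth_atlas A" "(U, c) \<in> A \<Longrightarrow> fat (c ` (U \<inter> X))"
  using assms unfolding fat_domain_def by auto

lemma smooth_atlasD:
  assumes "smooth_atlas A" "(U, c) \<in> A"
  shows "open U" "open (c ` U)" "homeomorphism U (c ` U) c (inv_into U c)" "inj_on c U" "continuous_on U c"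
    and "(V, d) \<in> A \<Longrightarrow> smooth_on (c ` (U \<inter> V)) (d \<circ> inv_into U c)"
proof -
  note 1 = assms(1)[unfolded smooth_atlas_def, THEN conjunct2, THEN conjunct1]
    and 2 = assms(1)[unfolded smooth_atlas_def, THEN conjunct2, THEN conjunct2]
  show *: "open U" "open (c ` U)" "homeomorphism U (c ` U) c (inv_into U c)"
    using bspec[OF 1 assms(2)] by simp_all
  show "smooth_on (c ` (U \<inter> V)) (d \<circ> inv_into U c)" if "(V, d) \<in> A"
    using bspec[OF bspec[OF 2 assms(2), unfolded case_prod_conv] that] by simp
  show "inj_on c U" "continuous_on U c"
    using *(3) unfolding homeomorphism_def by (auto intro: inj_on_inverseI[of U "inv_into U c"])
qed

lemma smooth_atlas_cover:
  assumes "smooth_atlas A"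
  obtains U c where "(U, c) \<in> A" "x \<in> U"
proof -
  have "x \<in> (\<Union>(U, c)\<in>A. U)" using assms unfolding smooth_atlas_def by simp
  then show ?thesis using that by blast
qed

lemma chart_image_open:
  assumes "smooth_atlas A" "(U, c) \<in> A" "open Q"
  shows "open (c ` (U \<inter> Q))"
proof -
  have "openin (top_of_set U) (U \<inter> Q)" using assms(3) by (simp add: openin_open_Int)
  from homeomorphism_imp_open_map[OF smooth_atlasD(3)[OF assms(1,2)] this]
  show ?thesis using smooth_atlasD(2)[OF assms(1,2)] openin_open_trans by blast
qed

lemma chart_image_Int:
  assumes "inj_on c U"
  shows "c ` (U \<inter> X) \<inter> c ` (U \<inter> Q) = c ` (U \<inter> X \<inter> Q)"
  using inj_on_image_Int[OF assms, of "U \<inter> X" "U \<inter> Q"] by (metis Int_assoc Int_left_absorb Int_lower1 inf_commute)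

lemma continuous_preimage_open:
  assumes "continuous_on X h" "open V"
  obtains Q where "open Q" "X \<inter> h -` V = X \<inter> Q"
  using assms unfolding continuous_on_open_invariant by (metis inf_commute)

lemma smooth_map_local_domain:
  assumes A: "smooth_atlas A" "(U, c) \<in> A" and h: "continuous_on X h" and V: "open V"
  obtains O' where "open O'" "c ` (U \<inter> X \<inter> h -` V) = c ` (U \<inter> X) \<inter> O'"
proof -
  obtain Q where Q: "open Q" "X \<inter> h -` V = X \<inter> Q" using continuous_preimage_open[OF h V] .
  have "c ` (U \<inter> X \<inter> h -` V) = c ` (U \<inter> X) \<inter> c ` (U \<inter> Q)"
    using chart_image_Int[OF smooth_atlasD(4)[OF A]] Q(2) by (metis Int_assoc)
  then show ?thesis using that chart_image_open[OF A Q(1)] by blast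
qed

lemma fat_local_domain:
  assumes "fat_domain A X" "(U, c) \<in> A" "continuous_on X h" "open V"
  shows "fat (c ` (U \<inter> X \<inter> h -` V))"
proof -
  obtain O' where O': "open O'" "c ` (U \<inter> X \<inter> h -` V) = c ` (U \<inter> X) \<inter> O'"
    using smooth_map_local_domain[OF fat_domainD(1)[OF assms(1)] assms(2-4)] .
  then show ?thesis using fat_Int_open[OF fat_domainD(2)[OF assms(1,2)] O'(1)] by simp
qed

lemma smooth_mapD:
  assumes "smooth_map A X A' Y h"
  shows "continuous_on X h" "h ` X \<subseteq> Y"
    "(U, c) \<in> A \<Longrightarrow> (V, d) \<in> A' \<Longrightarrow> smooth_on (c ` (U \<inter> X \<inter> h -` V)) (d \<circ> h \<circ> inv_into U c)"
proof -
  show "continuous_on X h" "h ` X \<subseteq> Y" using assms unfolding smooth_map_def by simp_all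
  note * = assms[unfolded smooth_map_def, THEN conjunct2, THEN conjunct2]
  show "smooth_on (c ` (U \<inter> X \<inter> h -` V)) (d \<circ> h \<circ> inv_into U c)" if "(U, c) \<in> A" "(V, d) \<in> A'"
    using bspec[OF bspec[OF * that(1), unfolded case_prod_conv] that(2)] by simp
qed

lemma smooth_mapI:
  assumes "continuous_on X h" "h ` X \<subseteq> Y"
    "\<And>U c V d. (U, c) \<in> A \<Longrightarrow> (V, d) \<in> A' \<Longrightarrow> smooth_on (c ` (U \<inter> X \<inter> h -` V)) (d \<circ> h \<circ> inv_into U c)"
  shows "smooth_map A X A' Y h"
  unfolding smooth_map_def using assms by (auto simp del: comp_apply)

text \<open>The middle chart depends on the image point, so smoothness is checked near each point,
  on the piece of the domain that the first map sends into the middle chart.\<close>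

lemma smooth_map_compose:
  assumes X: "fat_domain A X" and A': "smooth_atlas A'" and A'': "smooth_atlas A''"
    and h: "smooth_map A X A' Y h" and k: "smooth_map A' Y A'' Z k"
  shows "smooth_map A X A'' Z (k \<circ> h)"
proof (rule smooth_mapI)
  note hD = smooth_mapD[OF h] and kD = smooth_mapD[OF k]
  have A: "smooth_atlas A" using fat_domainD(1)[OF X] .
  show cont: "continuous_on X (k \<circ> h)"
    using hD kD continuous_on_compose continuous_on_subset by metis
  show "(k \<circ> h) ` X \<subseteq> Z" using hD(2) kD(2) by (auto simp: image_subset_iff)
  fix U c V d assume c: "(U, c) \<in> A" and d: "(V, d) \<in> A''"
  note injc = smooth_atlasD(4)[OF A c]
  have V: "open V" using smooth_atlasD(1)[OF A'' d] .
  let ?S = "c ` (U \<inter> X \<inter> (k \<circ> h) -` V)"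
  show "smooth_on ?S (d \<circ> (k \<circ> h) \<circ> inv_into U c)"
  proof (rule smooth_on_local)
    fix y assume "y \<in> ?S"
    then obtain x where x: "x \<in> U" "x \<in> X" "k (h x) \<in> V" "y = c x" by auto
    obtain W e where e: "(W, e) \<in> A'" "h x \<in> W" using smooth_atlas_cover[OF A'] .
    have W: "open W" using smooth_atlasD(1)[OF A' e(1)] .
    obtain Q where Q: "open Q" "X \<inter> h -` W = X \<inter> Q" using continuous_preimage_open[OF hD(1) W] .
    let ?O = "c ` (U \<inter> Q)"
    have O: "open ?O" using chart_image_open[OF A c Q(1)] .
    have yO: "y \<in> ?O" using x e Q by blast
    have S_O: "?S \<inter> ?O = c ` (U \<inter> X \<inter> (k \<circ> h) -` V \<inter> Q)"
      using chart_image_Int[OF injc, of "X \<inter> (k \<circ> h) -` V" Q] by (simp add: Int_assoc)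
    also have "\<dots> = c ` (U \<inter> X \<inter> h -` W \<inter> (k \<circ> h) -` V)"
      using Q(2) by (intro arg_cong[where f = "(`) c"]) blast
    finally have S_O: "?S \<inter> ?O = c ` (U \<inter> X \<inter> h -` W \<inter> (k \<circ> h) -` V)" .
    have fat: "fat (?S \<inter> ?O)"
      using fat_Int_open[OF fat_local_domain[OF X c cont V] O] .
    have smh: "smooth_on (?S \<inter> ?O) (e \<circ> h \<circ> inv_into U c)"
      by (rule smooth_on_subset[OF hD(3)[OF c e(1)] _ fat]) (auto simp: S_O)
    have inv: "inv_into U c (c x) = x" if "x \<in> U" for x using injc that by simp
    have inve: "inv_into W e (e x) = x" if "x \<in> W" for x
      using smooth_atlasD(4)[OF A' e(1)] that by simp
    have maps: "(e \<circ> h \<circ> inv_into U c) ` (?S \<inter> ?O) \<subseteq> e ` (W \<inter> Y \<inter> k -` V)"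
      unfolding S_O using hD(2) by (auto simp: inv)
    have "smooth_on (?S \<inter> ?O) (\<lambda>y. (d \<circ> k \<circ> inv_into W e) ((e \<circ> h \<circ> inv_into U c) y))"
      by (rule smooth_on_compose[OF fat smh kD(3)[OF e(1) d] maps])
    then have "smooth_on (?S \<inter> ?O) (d \<circ> (k \<circ> h) \<circ> inv_into U c)"
      by (rule smooth_on_cong) (unfold S_O, auto simp: inv inve)
    then show "\<exists>Q. open Q \<and> y \<in> Q \<and> smooth_on (?S \<inter> Q) (d \<circ> (k \<circ> h) \<circ> inv_into U c)"
      using O yO by blast
  qed
qed

lemma smooth_map_id:
  assumes "fat_domain A X"
  shows "smooth_map A X A X id"
proof (rule smooth_mapI)
  fix U c V d assume c: "(U, c) \<in> A" and d: "(V, d) \<in> A"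
  have A: "smooth_atlas A" using fat_domainD(1)[OF assms(1)] .
  have "fat (c ` (U \<inter> X \<inter> id -` V))"
    using fat_local_domain[OF assms c continuous_on_id smooth_atlasD(1)[OF A d]] by (simp add: id_def)
  then show "smooth_on (c ` (U \<inter> X \<inter> id -` V)) (d \<circ> id \<circ> inv_into U c)"
    using smooth_on_subset[OF smooth_atlasD(6)[OF A c d], of "c ` (U \<inter> X \<inter> V)"] by (auto simp: image_mono)
qed (auto simp: continuous_on_id')

section \<open>Groups of diffeomorphisms\<close>

lemma diffeosD:
  assumes "h \<in> diffeos A X"
  shows "h permutes X" "bij h" "smooth_map A X A X h" "smooth_map A X A X (inv_into UNIV h)"
    "\<And>x. x \<in> X \<Longrightarrow> h x \<in> X" "\<And>x. x \<notin> X \<Longrightarrow> h x = x" "h ` X = X"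
  using assms permutes_bij[of h X] permutes_in_image[of h X] permutes_not_in[of h X] permutes_image[of h X]
  unfolding diffeos_def by auto

lemma diffeos_comp:
  assumes "fat_domain A X" "h \<in> diffeos A X" "k \<in> diffeos A X"
  shows "h \<circ> k \<in> diffeos A X"
proof -
  note h = diffeosD[OF assms(2)] and k = diffeosD[OF assms(3)]
  have A: "smooth_atlas A" using fat_domainD(1)[OF assms(1)] .
  have "inv_into UNIV (h \<circ> k) = inv_into UNIV k \<circ> inv_into UNIV h" using h(2) k(2) by (simp add: o_inv_distrib)
  then show ?thesis
    using smooth_map_compose[OF assms(1) A A k(3) h(3)] smooth_map_compose[OF assms(1) A A h(4) k(4)]
      permutes_compose[OF k(1) h(1)] unfolding diffeos_def by simp
qed

lemma diffeos_id:
  assumes "fat_domain A X"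
  shows "id \<in> diffeos A X"
  using smooth_map_id[OF assms] by (simp add: diffeos_def permutes_id inv_id del: id_apply)

lemma diffeos_inv:
  assumes "h \<in> diffeos A X"
  shows "inv_into UNIV h \<in> diffeos A X"
  unfolding diffeos_def mem_Collect_eq inv_inv_eq[OF diffeosD(2)[OF assms]]
  by (intro conjI permutes_inv diffeosD[OF assms])

lemma map_group_simps [simp]:
  "carrier (map_group G) = G" "mult (map_group G) = (\<circ>)" "one (map_group G) = id"
  by (simp_all add: map_group_def)

lemma group_map_groupI:
  assumes "id \<in> G" "\<And>h k. h \<in> G \<Longrightarrow> k \<in> G \<Longrightarrow> h \<circ> k \<in> G" "\<And>h. h \<in> G \<Longrightarrow> bij h \<and> inv_into UNIV h \<in> G"
  shows "group (map_group G)"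
proof (rule groupI)
  fix x assume "x \<in> carrier (map_group G)"
  then have "inv_into UNIV x \<in> G" "inv_into UNIV x \<circ> x = id" using assms(3)[of x] by (auto simp: bij_is_inj)
  then show "\<exists>y\<in>carrier (map_group G). y \<otimes>\<^bsub>map_group G\<^esub> x = \<one>\<^bsub>map_group G\<^esub>" by auto
qed (use assms in \<open>auto simp: o_assoc\<close>)

lemma smooth_map_near:
  assumes X: "smooth_atlas A" and h: "smooth_map A X A' Y h" and c: "(U, c) \<in> A" and d: "(V, d) \<in> A'"
    and V: "open V" and K: "K \<subseteq> U \<inter> X" "h ` K \<subseteq> V"
  shows "smooth_near (c ` (U \<inter> X)) (c ` K) (d \<circ> h \<circ> inv_into U c)"
proof -
  obtain O' where O': "open O'" "c ` (U \<inter> X \<inter> h -` V) = c ` (U \<inter> X) \<inter> O'"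
    using smooth_map_local_domain[OF X c smooth_mapD(1)[OF h] V] .
  moreover have "smooth_on (c ` (U \<inter> X \<inter> h -` V)) (d \<circ> h \<circ> inv_into U c)"
    using smooth_mapD(3)[OF h c d] .
  moreover have "c ` K \<subseteq> O'" using O' K by blast
  ultimately show ?thesis unfolding smooth_near_def by metis
qed

subsection \<open>Convergence in the smooth topology\<close>

text \<open>The sets that eventually contain \<open>f i\<close> if they contain \<open>l\<close> are
  closed under finite intersections and arbitrary unions, so the subbasis suffices.\<close>

lemma limitin_generated_by:
  assumes l: "l \<in> \<Union>\<B>" and ev: "\<And>U. U \<in> \<B> \<Longrightarrow> l \<in> U \<Longrightarrow> \<forall>\<^sub>F i in F. f i \<in> U"
  shows "limitin (topology_generated_by \<B>) f l F"
  unfolding limitin_def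
proof (intro conjI allI impI)
  show "l \<in> topspace (topology_generated_by \<B>)" using l by simp
  fix U assume U: "openin (topology_generated_by \<B>) U \<and> l \<in> U"
  then have "generate_topology_on \<B> U" by (simp add: openin_topology_generated_by_iff)
  then have "l \<in> U \<longrightarrow> (\<forall>\<^sub>F i in F. f i \<in> U)"
  proof induction
    case (Int a b)
    then show ?case by (auto simp: eventually_conj_iff)
  next
    case (UN K)
    show ?case
    proof
      assume "l \<in> \<Union> K"
      then obtain k where k: "k \<in> K" "l \<in> k" by blast
      then have "\<forall>\<^sub>F i in F. f i \<in> k" using UN by blast
      then show "\<forall>\<^sub>F i in F. f i \<in> \<Union> K" by (rule eventually_mono) (use k in blast)
    qed
  qed (use ev in simp_all)
  then show "\<forall>\<^sub>F i in F. f i \<in> U" using U by blast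
qed

text \<open>Convergence in charts, tested on the compact sets that the limit \<open>h0\<close> sends
  into one chart. By \<open>limitin_cinf_iff\<close> this is what convergence means once the maps
  are known to be smooth.\<close>

definition chart_lim where
  "chart_lim A X A' F h h0 \<longleftrightarrow>
    (\<forall>(U, c)\<in>A. \<forall>(V, d)\<in>A'. \<forall>K. compact K \<and> K \<subseteq> U \<inter> X \<and> h0 ` K \<subseteq> V \<longrightarrow>
      (\<forall>\<^sub>F i in F. h i ` K \<subseteq> V) \<and>
      (\<forall>n. smooth_lim n F (c ` (U \<inter> X)) (c ` K) (\<lambda>i. d \<circ> h i \<circ> inv_into U c) (d \<circ> h0 \<circ> inv_into U c)))"

lemma chart_limD:
  assumes "chart_lim A X A' F h h0" "(U, c) \<in> A" "(V, d) \<in> A'" "compact K" "K \<subseteq> U \<inter> X" "h0 ` K \<subseteq> V"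
  shows "\<forall>\<^sub>F i in F. h i ` K \<subseteq> V"
    "smooth_lim n F (c ` (U \<inter> X)) (c ` K) (\<lambda>i. d \<circ> h i \<circ> inv_into U c) (d \<circ> h0 \<circ> inv_into U c)"
  using bspec[OF bspec[OF assms(1)[unfolded chart_lim_def] assms(2), unfolded case_prod_conv] assms(3),
      unfolded case_prod_conv, rule_format, of K] assms(4-6) by blast+

lemma chart_limI:
  assumes "\<And>U c V d K. (U, c) \<in> A \<Longrightarrow> (V, d) \<in> A' \<Longrightarrow> compact K \<Longrightarrow> K \<subseteq> U \<inter> X \<Longrightarrow> h0 ` K \<subseteq> V \<Longrightarrow>
      (\<forall>\<^sub>F i in F. h i ` K \<subseteq> V) \<and>
      (\<forall>n. smooth_lim n F (c ` (U \<inter> X)) (c ` K) (\<lambda>i. d \<circ> h i \<circ> inv_into U c) (d \<circ> h0 \<circ> inv_into U c))"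
  shows "chart_lim A X A' F h h0"
  unfolding chart_lim_def using assms by blast

lemma mem_cinf_nbhd:
  "g \<in> cinf_nbhd A X A' Y h (U, c) (V, d) K r e \<longleftrightarrow>
    smooth_map A X A' Y g \<and> g ` K \<subseteq> V \<and>
    (\<forall>vs. length vs \<le> r \<and> (\<forall>v\<in>set vs. norm v \<le> 1) \<longrightarrow>
      (\<forall>y\<in>c ` K. norm (nderiv (c ` (U \<inter> X)) (d \<circ> g \<circ> inv_into U c) vs y
        - nderiv (c ` (U \<inter> X)) (d \<circ> h \<circ> inv_into U c) vs y) < e))"
  by (simp add: cinf_nbhd_def)

lemma self_mem_cinf_nbhd:
  "smooth_map A X A' Y h \<Longrightarrow> h ` K \<subseteq> V \<Longrightarrow> e > 0 \<Longrightarrow> h \<in> cinf_nbhd A X A' Y h (U, c) (V, d) K r e"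
  by (simp add: mem_cinf_nbhd)

lemma openin_cinf_nbhd:
  assumes "smooth_map A X A' Y h" "(U, c) \<in> A" "(V, d) \<in> A'" "compact K" "K \<subseteq> U \<inter> X" "h ` K \<subseteq> V" "0 < e"
  shows "openin (cinf_topology A X A' Y) (cinf_nbhd A X A' Y h (U, c) (V, d) K r e)"
  unfolding cinf_topology_def by (rule topology_generated_by_Basis) (use assms in blast)

lemma topspace_cinf_topology:
  assumes "smooth_atlas A" "smooth_atlas A'"
  shows "topspace (cinf_topology A X A' Y) = {h. smooth_map A X A' Y h}"
proof -
  obtain U c where c: "(U, c) \<in> A" using smooth_atlas_cover[OF assms(1)] by metis
  obtain V d where d: "(V, d) \<in> A'" using smooth_atlas_cover[OF assms(2)] by metis
  have "h \<in> topspace (cinf_topology A X A' Y)" if h: "smooth_map A X A' Y h" for h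
  proof -
    \<comment> \<open>The empty compact set makes all estimates vacuous, so this neighbourhood
      consists of all smooth maps.\<close>
    have "openin (cinf_topology A X A' Y) (cinf_nbhd A X A' Y h (U, c) (V, d) {} 0 1)"
      by (rule openin_cinf_nbhd[OF h c d]) auto
    moreover have "h \<in> cinf_nbhd A X A' Y h (U, c) (V, d) {} 0 1"
      by (rule self_mem_cinf_nbhd[OF h]) auto
    ultimately show ?thesis using openin_subset by blast
  qed
  moreover have "smooth_map A X A' Y h" if h: "h \<in> topspace (cinf_topology A X A' Y)" for h
  proof -
    from h show ?thesis
      unfolding cinf_topology_def topology_generated_by_topspace
      by (elim UnionE CollectE exE conjE) (simp only: mem_cinf_nbhd)
  qed
  ultimately show ?thesis by blast
qed

lemma compact_chart_image:
  assumes "smooth_atlas A" "(U, c) \<in> A" "compact K" "K \<subseteq> U"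
  shows "compact (c ` K)"
  using assms smooth_atlasD(5) continuous_on_subset compact_continuous_image by metis

text \<open>From left to right, neighbourhoods centred at \<open>h0\<close> suffice. Conversely, a
  subbasic set containing \<open>h0\<close> need not be centred there, which is what
  \<open>smooth_lim_eventually_close\<close> is for.\<close>

lemma limitin_cinf_iff:
  assumes X: "fat_domain A X" and A': "smooth_atlas A'"
  shows "limitin (cinf_topology A X A' Y) h h0 F \<longleftrightarrow>
    smooth_map A X A' Y h0 \<and> (\<forall>\<^sub>F i in F. smooth_map A X A' Y (h i)) \<and> chart_lim A X A' F h h0"
    (is "?L \<longleftrightarrow> ?R")
proof
  have A: "smooth_atlas A" using fat_domainD(1)[OF X] .
  assume L: ?L
  have h0: "smooth_map A X A' Y h0"
    using limitin_topspace[OF L] topspace_cinf_topology[OF A A'] by blast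
  have "\<forall>\<^sub>F i in F. h i \<in> topspace (cinf_topology A X A' Y)"
    using limitinD[OF L openin_topspace] limitin_topspace[OF L] by blast
  then have h: "\<forall>\<^sub>F i in F. smooth_map A X A' Y (h i)"
    unfolding topspace_cinf_topology[OF A A'] by simp
  have "(\<forall>\<^sub>F i in F. h i ` K \<subseteq> V) \<and>
      (\<forall>n. smooth_lim n F (c ` (U \<inter> X)) (c ` K) (\<lambda>i. d \<circ> h i \<circ> inv_into U c) (d \<circ> h0 \<circ> inv_into U c))"
    if c: "(U, c) \<in> A" and d: "(V, d) \<in> A'" and K: "compact K" "K \<subseteq> U \<inter> X" "h0 ` K \<subseteq> V" for U c V d K
  proof (intro conjI allI)
    have ev: "\<forall>\<^sub>F i in F. h i \<in> cinf_nbhd A X A' Y h0 (U, c) (V, d) K r e" if "e > 0" for r e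
      using limitinD[OF L openin_cinf_nbhd[OF h0 c d K that]] self_mem_cinf_nbhd[OF h0 K(3) that] by blast
    show *: "\<forall>\<^sub>F i in F. h i ` K \<subseteq> V"
      using ev[OF zero_less_one] unfolding mem_cinf_nbhd by (rule eventually_mono) (elim conjE)
    have V: "open V" using smooth_atlasD(1)[OF A' d] .
    fix n
    show "smooth_lim n F (c ` (U \<inter> X)) (c ` K) (\<lambda>i. d \<circ> h i \<circ> inv_into U c) (d \<circ> h0 \<circ> inv_into U c)"
    proof (rule smooth_lim_if_eventually_close)
      show "fat (c ` (U \<inter> X))" using fat_domainD(2)[OF X c] .
      show "smooth_near (c ` (U \<inter> X)) (c ` K) (d \<circ> h0 \<circ> inv_into U c)"
        by (rule smooth_map_near[OF A h0 c d V K(2,3)])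
      show "\<forall>\<^sub>F i in F. smooth_near (c ` (U \<inter> X)) (c ` K) (d \<circ> h i \<circ> inv_into U c)"
        using h * by eventually_elim (rule smooth_map_near[OF A _ c d V K(2)])
      fix e :: real assume "e > 0"
      from ev[OF this, of n] show "\<forall>\<^sub>F i in F. \<forall>vs. length vs \<le> n \<and> (\<forall>v\<in>set vs. norm v \<le> 1) \<longrightarrow>
         (\<forall>y\<in>c ` K. norm (nderiv (c ` (U \<inter> X)) (d \<circ> h i \<circ> inv_into U c) vs y
            - nderiv (c ` (U \<inter> X)) (d \<circ> h0 \<circ> inv_into U c) vs y) < e)"
        unfolding mem_cinf_nbhd by (rule eventually_mono) blast
    qed (use K in blast)
  qed
  then have "chart_lim A X A' F h h0" by (rule chart_limI)
  then show ?R using h0 h by blast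
next
  have A: "smooth_atlas A" using fat_domainD(1)[OF X] .
  assume R: ?R
  then have h0: "smooth_map A X A' Y h0" and h: "\<forall>\<^sub>F i in F. smooth_map A X A' Y (h i)"
    and lim: "chart_lim A X A' F h h0" by auto
  show ?L unfolding cinf_topology_def
  proof (rule limitin_generated_by)
    have "h0 \<in> topspace (cinf_topology A X A' Y)" using h0 topspace_cinf_topology[OF A A'] by blast
    then show "h0 \<in> \<Union>{cinf_nbhd A X A' Y h (U, c) (V, d) K r \<epsilon> | h U c V d K r \<epsilon>.
        smooth_map A X A' Y h \<and> (U, c) \<in> A \<and> (V, d) \<in> A' \<and>
        compact K \<and> K \<subseteq> U \<inter> X \<and> h ` K \<subseteq> V \<and> 0 < \<epsilon>}"
      unfolding cinf_topology_def topology_generated_by_topspace .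
    fix N assume Nin: "N \<in> {cinf_nbhd A X A' Y h (U, c) (V, d) K r \<epsilon> | h U c V d K r \<epsilon>.
        smooth_map A X A' Y h \<and> (U, c) \<in> A \<and> (V, d) \<in> A' \<and>
        compact K \<and> K \<subseteq> U \<inter> X \<and> h ` K \<subseteq> V \<and> 0 < \<epsilon>}" and h0N: "h0 \<in> N"
    obtain k U c V d K r e where N: "N = cinf_nbhd A X A' Y k (U, c) (V, d) K r e"
      and k: "smooth_map A X A' Y k" and c: "(U, c) \<in> A" and d: "(V, d) \<in> A'"
      and K: "compact K" "K \<subseteq> U \<inter> X" "k ` K \<subseteq> V" and e: "0 < e"
      by (use Nin in \<open>elim CollectE exE conjE\<close>) (rule that)
    note h0N = h0N[unfolded N mem_cinf_nbhd, THEN conjunct2]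
    note h0K = h0N[THEN conjunct1]
    have close: "norm (nderiv (c ` (U \<inter> X)) (d \<circ> h0 \<circ> inv_into U c) vs y
            - nderiv (c ` (U \<inter> X)) (d \<circ> k \<circ> inv_into U c) vs y) < e"
      if "length vs \<le> r" "\<forall>v\<in>set vs. norm v \<le> 1" "y \<in> c ` K" for vs y
      by (rule h0N[THEN conjunct2, rule_format]) (use that in auto)
    have V: "open V" using smooth_atlasD(1)[OF A' d] .
    note hK = chart_limD(1)[OF lim c d K(1,2) h0K] and sl = chart_limD(2)[OF lim c d K(1,2) h0K, of r]
    have "\<forall>\<^sub>F i in F. \<forall>vs. length vs \<le> r \<and> (\<forall>v\<in>set vs. norm v \<le> 1) \<longrightarrow>
         (\<forall>y\<in>c ` K. norm (nderiv (c ` (U \<inter> X)) (d \<circ> h i \<circ> inv_into U c) vs y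
            - nderiv (c ` (U \<inter> X)) (d \<circ> k \<circ> inv_into U c) vs y) < e)"
    proof (rule smooth_lim_eventually_close[OF _ _ _ sl _ close e])
      show "fat (c ` (U \<inter> X))" using fat_domainD(2)[OF X c] .
      show "compact (c ` K)" using compact_chart_image[OF A c K(1)] K(2) by blast
      show "smooth_near (c ` (U \<inter> X)) (c ` K) (d \<circ> k \<circ> inv_into U c)"
        by (rule smooth_map_near[OF A k c d V K(2,3)])
    qed (use K in blast)
    then show "\<forall>\<^sub>F i in F. h i \<in> N"
      using h hK by eventually_elim (simp add: N mem_cinf_nbhd)
  qed
qed

section \<open>Functions on an interval\<close>

abbreviation deriv_on :: "real set \<Rightarrow> (real \<Rightarrow> real) \<Rightarrow> real \<Rightarrow> real" where
  "deriv_on S w \<equiv> nderiv S w [1]"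

lemma smooth_near_self: "smooth_near S S u \<longleftrightarrow> smooth_on S u"
proof
  assume "smooth_near S S u"
  then obtain Q where Q: "open Q" "S \<subseteq> Q" "smooth_on (S \<inter> Q) u" unfolding smooth_near_def by blast
  then have "S \<inter> Q = S" by blast
  then show "smooth_on S u" using Q by simp
qed (rule smooth_on_imp_near)

section \<open>Derivatives and averages of functions of one real variable\<close>

lemma nderiv_real_dir:
  fixes w :: "real \<Rightarrow> real"
  assumes "w differentiable (at x within S)"
  shows "nderiv S w [v] x = v * deriv_on S w x"
  using linear_scale[OF has_derivative_linear[OF has_derivative_nderiv[OF assms]], of v 1] by simp

lemma smooth_on_has_vector_derivative:
  fixes w :: "real \<Rightarrow> real"
  assumes "smooth_on S w" "x \<in> S"
  shows "(w has_vector_derivative deriv_on S w x) (at x within S)"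
proof -
  have d: "w differentiable (at x within S)"
    using smooth_on_imp_differentiable[OF assms(1)] assms(2) by (simp add: differentiable_on_def)
  have "(\<lambda>v. nderiv S w [v] x) = (\<lambda>v. v *\<^sub>R deriv_on S w x)"
    by (rule ext, unfold real_scaleR_def, rule nderiv_real_dir[OF d])
  then show ?thesis
    using has_derivative_nderiv[OF d] unfolding has_vector_derivative_def by metis
qed

lemma nderiv_real_eq:
  fixes w :: "real \<Rightarrow> real"
  assumes "fat S" "x \<in> S" "(w has_vector_derivative D) (at x within S)"
  shows "nderiv S w [v] x = v * D"
  using nderiv_1_eq[OF assms(1,2) assms(3)[unfolded has_vector_derivative_def]] by simp

text \<open>Hadamard's integral: for \<open>k = 0\<close> and a derivative \<open>w'\<close> it is
  the smooth form of \<open>(w t - w 0) / t\<close>. The weight \<open>u ^ k\<close> is there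
  because each derivative in \<open>t\<close> brings out one more factor \<open>u\<close>.\<close>

definition avg :: "nat \<Rightarrow> (real \<Rightarrow> real) \<Rightarrow> real \<Rightarrow> real" where
  "avg k w t = integral {0..1} (\<lambda>u. u ^ k * w (u * t))"

lemma scaled_mem_interval:
  fixes a b :: real
  assumes "a \<le> 0" "0 \<le> b" "t \<in> {a..b}" "u \<in> {0..1}"
  shows "u * t \<in> {a..b}"
proof -
  have "u * t \<le> u * b" "u * a \<le> u * t" using assms by (auto intro: mult_left_mono)
  moreover have "u * b \<le> 1 * b" "u * a \<ge> 1 * a"
    using assms mult_right_mono[of u 1 b] mult_right_mono_neg[of u 1 a] by auto
  ultimately show ?thesis by auto
qed

lemma avg_integrand_continuous:
  fixes w :: "real \<Rightarrow> real"
  assumes ab: "a \<le> 0" "0 \<le> b" and w: "continuous_on {a..b} w" and t: "t \<in> {a..b}"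
  shows "continuous_on {0..1} (\<lambda>u. u ^ k * w (u * t))"
proof -
  have "continuous_on {0..1} (\<lambda>u. w (u * t))"
    by (rule continuous_on_compose2[OF w]) (auto intro!: continuous_intros simp: scaled_mem_interval[OF ab t] simp del: atLeastAtMost_iff)
  then show ?thesis by (intro continuous_intros)
qed

lemma avg_has_vector_derivative:
  assumes ab: "a \<le> 0" "0 \<le> b" and w: "smooth_on {a..b} w" and t: "t \<in> {a..b}"
  shows "(avg k w has_vector_derivative avg (Suc k) (deriv_on {a..b} w) t) (at t within {a..b})"
proof -
  let ?S = "{a..b}" and ?w' = "deriv_on {a..b} w"
  have cw: "continuous_on ?S w" "continuous_on ?S ?w'"
    using smooth_on_imp_continuous w smooth_on_nderiv by blast+
  have "((\<lambda>t. integral (cbox 0 1) (\<lambda>u. u ^ k * w (u * t))) has_vector_derivative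
      integral (cbox 0 1) (\<lambda>u. u ^ Suc k * ?w' (u * t))) (at t within ?S)"
  proof (rule leibniz_rule_vector_derivative[OF _ _ _ t])
    fix t u :: real assume t: "t \<in> ?S" and u: "u \<in> cbox 0 1"
    have sub: "(\<lambda>t. u * t) ` ?S \<subseteq> ?S" using scaled_mem_interval[OF ab _ u[unfolded cbox_interval]] by blast
    have "(w has_vector_derivative ?w' (u * t)) (at (u * t) within (\<lambda>t. u * t) ` ?S)"
      using smooth_on_has_vector_derivative[OF w] sub t has_vector_derivative_within_subset by blast
    moreover have "((\<lambda>t. u * t) has_vector_derivative u) (at t within ?S)"
      by (auto intro!: derivative_eq_intros)
    ultimately have "((\<lambda>t. w (u * t)) has_vector_derivative u * ?w' (u * t)) (at t within ?S)"
      using vector_diff_chain_within[of "\<lambda>t. u * t" u t ?S w] by (simp add: o_def)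
    from has_vector_derivative_mult_right[OF this, of "u ^ k"]
    show "((\<lambda>t. u ^ k * w (u * t)) has_vector_derivative u ^ Suc k * ?w' (u * t)) (at t within ?S)"
      by (simp add: mult_ac)
  next
    fix t assume "t \<in> ?S"
    from avg_integrand_continuous[OF ab cw(1) this, of k]
    show "(\<lambda>u. u ^ k * w (u * t)) integrable_on cbox 0 1"
      unfolding cbox_interval by (rule integrable_continuous_real)
  next
    have "continuous_on (?S \<times> {0..1}) (\<lambda>z. ?w' (snd z * fst z))"
      by (rule continuous_on_compose2[OF cw(2)])
        (auto intro!: continuous_intros simp: scaled_mem_interval[OF ab] simp del: atLeastAtMost_iff)
    then show "continuous_on (?S \<times> cbox 0 1) (\<lambda>(t, u). u ^ Suc k * ?w' (u * t))"
      unfolding cbox_interval case_prod_beta by (intro continuous_intros)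
  qed simp
  then show ?thesis unfolding avg_def cbox_interval by (simp add: fun_eq_iff)
qed

lemma nderiv_avg_1:
  assumes ab: "a \<le> 0" "0 \<le> b" "a < b" and w: "smooth_on {a..b} w" and t: "t \<in> {a..b}"
  shows "nderiv {a..b} (avg k w) [v] t = avg (Suc k) (nderiv {a..b} w [v]) t"
proof -
  have "nderiv {a..b} w [v] (u * t) = v * deriv_on {a..b} w (u * t)" if "u \<in> {0..1}" for u
    using smooth_on_imp_differentiable[OF w] scaled_mem_interval[OF ab(1,2) t that]
    by (intro nderiv_real_dir) (auto simp: differentiable_on_def)
  then have "avg (Suc k) (nderiv {a..b} w [v]) t = integral {0..1} (\<lambda>u. v * (u ^ Suc k * deriv_on {a..b} w (u * t)))"
    unfolding avg_def by (intro integral_cong) (simp only: mult_ac)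
  also have "\<dots> = v * avg (Suc k) (deriv_on {a..b} w) t" unfolding avg_def by (rule integral_mult_right)
  finally show ?thesis
    using nderiv_real_eq[OF fat_Icc[OF ab(3)] t avg_has_vector_derivative[OF ab(1,2) w t]] by simp
qed

lemma nderiv_avg:
  assumes ab: "a \<le> 0" "0 \<le> b" "a < b" and w: "smooth_on {a..b} w" and t: "t \<in> {a..b}"
  shows "nderiv {a..b} (avg k w) vs t = avg (k + length vs) (nderiv {a..b} w vs) t"
  using t
proof (induction vs arbitrary: t)
  case (Cons v vs)
  have "nderiv {a..b} (avg k w) (v # vs) t = nderiv {a..b} (nderiv {a..b} (avg k w) vs) [v] t"
    using nderiv_append[of "{a..b}" "avg k w" "[v]" vs] by simp
  also have "\<dots> = nderiv {a..b} (avg (k + length vs) (nderiv {a..b} w vs)) [v] t"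
    by (rule nderiv_cong[OF Cons.IH Cons.prems])
  also have "\<dots> = avg (Suc (k + length vs)) (nderiv {a..b} (nderiv {a..b} w vs) [v]) t"
    by (rule nderiv_avg_1[OF ab smooth_on_nderiv[OF w] Cons.prems])
  also have "\<dots> = avg (k + length (v # vs)) (nderiv {a..b} w (v # vs)) t"
    using nderiv_append[of "{a..b}" w "[v]" vs] by simp
  finally show ?case .
qed simp

lemma smooth_on_avg:
  assumes ab: "a \<le> 0" "0 \<le> b" "a < b" and w: "smooth_on {a..b} w"
  shows "smooth_on {a..b} (avg k w)"
  unfolding smooth_on_def differentiable_on_def
proof (intro allI ballI)
  fix vs t assume t: "t \<in> {a..b}"
  have eq: "nderiv {a..b} (avg k w) vs y = avg (k + length vs) (nderiv {a..b} w vs) y" if "y \<in> {a..b}" for y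
    by (rule nderiv_avg[OF ab w that])
  have "avg (k + length vs) (nderiv {a..b} w vs) differentiable (at t within {a..b})"
    using avg_has_vector_derivative[OF ab(1,2) smooth_on_nderiv[OF w] t]
    by (rule differentiableI_vector)
  then show "nderiv {a..b} (avg k w) vs differentiable (at t within {a..b})"
    using differentiable_cong_on[of _ "nderiv {a..b} (avg k w) vs", OF eq t] by blast
qed

lemma uniform_limit_avg:
  assumes ab: "a \<le> 0" "0 \<le> b" and w0: "continuous_on {a..b} w0"
    and w: "\<forall>\<^sub>F i in F. continuous_on {a..b} (w i)" and lim: "uniform_limit {a..b} w w0 F"
  shows "uniform_limit {a..b} (\<lambda>i. avg k (w i)) (avg k w0) F"
proof (rule uniform_limitI)
  fix e :: real assume e: "e > 0"
  then have "e / 2 > 0" by simp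
  from uniform_limitD[OF lim this] w
  show "\<forall>\<^sub>F i in F. \<forall>t\<in>{a..b}. dist (avg k (w i) t) (avg k w0 t) < e"
  proof (rule eventually_elim2, intro ballI)
    fix i t assume *: "\<forall>t\<in>{a..b}. dist (w i t) (w0 t) < e / 2" "continuous_on {a..b} (w i)" "t \<in> {a..b}"
    have int: "(\<lambda>u. u ^ k * w i (u * t)) integrable_on {0..1}" "(\<lambda>u. u ^ k * w0 (u * t)) integrable_on {0..1}"
      using avg_integrand_continuous[OF ab _ *(3)] *(2) w0 integrable_continuous_real by blast+
    have "norm (integral {0..1} (\<lambda>u. u ^ k * w i (u * t) - u ^ k * w0 (u * t))) \<le> integral {0..1} (\<lambda>u::real. e / 2)"
    proof (rule Henstock_Kurzweil_Integration.integral_norm_bound_integral)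
      fix u :: real assume u: "u \<in> {0..1}"
      have "norm (u ^ k * w i (u * t) - u ^ k * w0 (u * t)) = u ^ k * dist (w i (u * t)) (w0 (u * t))"
        using u by (simp add: dist_real_def abs_mult flip: right_diff_distrib)
      also have "\<dots> \<le> 1 * dist (w i (u * t)) (w0 (u * t))"
        using u by (intro mult_right_mono power_le_one) auto
      also have "\<dots> \<le> e / 2" using *(1) scaled_mem_interval[OF ab *(3) u] by fastforce
      finally show "norm (u ^ k * w i (u * t) - u ^ k * w0 (u * t)) \<le> e / 2" .
    qed (use int in \<open>auto intro: integrable_diff\<close>)
    then have "norm (avg k (w i) t - avg k w0 t) \<le> e / 2"
      unfolding avg_def integral_diff[OF int] by simp
    then show "dist (avg k (w i) t) (avg k w0 t) < e" using e by (simp add: dist_norm)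
  qed
qed

lemma smooth_lim_avg:
  assumes ab: "a \<le> 0" "0 \<le> b" "a < b" and w: "smooth_lim n F {a..b} {a..b} w w0"
  shows "smooth_lim n F {a..b} {a..b} (\<lambda>i. avg k (w i)) (avg k w0)"
  unfolding smooth_lim_def smooth_near_self
proof (intro conjI allI impI)
  note wD = smooth_lim_D[OF w, unfolded smooth_near_self]
  show "smooth_on {a..b} (avg k w0)" using smooth_on_avg[OF ab wD(1)] .
  show "\<forall>\<^sub>F i in F. smooth_on {a..b} (avg k (w i))"
    using wD(2) by (rule eventually_mono) (rule smooth_on_avg[OF ab])
  fix vs :: "real list" assume vs: "length vs \<le> n"
  have u: "uniform_limit {a..b} (\<lambda>i. nderiv {a..b} (w i) vs) (nderiv {a..b} w0 vs) F"
    using w vs unfolding smooth_lim_def by blast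
  have c: "\<forall>\<^sub>F i in F. continuous_on {a..b} (nderiv {a..b} (w i) vs)"
    using wD(2) by (rule eventually_mono) (rule smooth_on_imp_continuous[OF smooth_on_nderiv])
  have lim: "uniform_limit {a..b} (\<lambda>i. avg (k + length vs) (nderiv {a..b} (w i) vs))
      (avg (k + length vs) (nderiv {a..b} w0 vs)) F"
    by (rule uniform_limit_avg[OF ab(1,2) smooth_on_imp_continuous[OF smooth_on_nderiv[OF wD(1)]] c u])
  have ev: "\<forall>\<^sub>F i in F. \<forall>t\<in>{a..b}. avg (k + length vs) (nderiv {a..b} (w i) vs) t = nderiv {a..b} (avg k (w i)) vs t"
    using wD(2) by (rule eventually_mono) (intro ballI nderiv_avg[OF ab, symmetric])
  show "uniform_limit {a..b} (\<lambda>i. nderiv {a..b} (avg k (w i)) vs) (nderiv {a..b} (avg k w0) vs) F"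
    by (rule uniform_limit_cong[THEN iffD1, OF ev _ lim]) (rule nderiv_avg[OF ab wD(1), symmetric])
qed

text \<open>The fundamental theorem of calculus for \<open>u \<mapsto> w (u * t)\<close> on the unit
  interval.\<close>

lemma avg_deriv:
  assumes ab: "a \<le> 0" "0 \<le> b" and w: "smooth_on {a..b} w" and t: "t \<in> {a..b}"
  shows "t * avg 0 (deriv_on {a..b} w) t = w t - w 0"
proof -
  have "((\<lambda>u. t * deriv_on {a..b} w (u * t)) has_integral (w (1 * t) - w (0 * t))) {0..1}"
  proof (rule fundamental_theorem_of_calculus)
    fix u :: real assume u: "u \<in> {0..1}"
    have sub: "(\<lambda>u. u * t) ` {0..1} \<subseteq> {a..b}" using scaled_mem_interval[OF ab t] by blast
    have "(w has_vector_derivative deriv_on {a..b} w (u * t)) (at (u * t) within (\<lambda>u. u * t) ` {0..1})"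
      using smooth_on_has_vector_derivative[OF w] sub u has_vector_derivative_within_subset by blast
    moreover have "((\<lambda>u. u * t) has_vector_derivative t) (at u within {0..1})"
      by (auto intro!: derivative_eq_intros)
    ultimately show "((\<lambda>u. w (u * t)) has_vector_derivative t * deriv_on {a..b} w (u * t)) (at u within {0..1})"
      using vector_diff_chain_within[of "\<lambda>u. u * t" t u "{0..1}" w] by (simp add: o_def)
  qed simp
  from integral_unique[OF this]
  have "integral {0..1} (\<lambda>u. t * deriv_on {a..b} w (u * t)) = w t - w 0" by simp
  then show ?thesis by (simp only: avg_def integral_mult_right power_0 mult_1)
qed

subsection \<open>Even functions\<close>

definition even_quotient :: "(real \<Rightarrow> real) \<Rightarrow> real \<Rightarrow> real" where
  "even_quotient \<psi> t = 1/2 * avg 0 (nderiv {-1..1} \<psi> [1, 1]) t"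

lemma even_deriv:
  assumes \<psi>: "smooth_on {-1..1} \<psi>" and ev: "\<And>t. t \<in> {-1..1} \<Longrightarrow> \<psi> (- t) = \<psi> t" and t: "t \<in> {-1..1}"
  shows "deriv_on {-1..1} \<psi> (- t) = - deriv_on {-1..1} \<psi> t"
proof -
  let ?S = "{-1..1::real}"
  have mt: "- t \<in> ?S" using t by auto
  have im: "uminus ` ?S = ?S" by simp
  have "(\<psi> has_vector_derivative deriv_on ?S \<psi> (- t)) (at (- t) within uminus ` ?S)"
    unfolding im by (rule smooth_on_has_vector_derivative[OF \<psi> mt])
  moreover have "(uminus has_vector_derivative -1) (at t within ?S)"
    by (auto intro!: derivative_eq_intros)
  ultimately have "((\<psi> \<circ> uminus) has_vector_derivative - deriv_on ?S \<psi> (- t)) (at t within ?S)"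
    using vector_diff_chain_within[of uminus "-1" t ?S \<psi>] by simp
  then have "(\<psi> has_vector_derivative - deriv_on ?S \<psi> (- t)) (at t within ?S)"
    by (rule has_vector_derivative_transform[OF t, rotated]) (simp add: ev)
  from nderiv_real_eq[OF fat_Icc t this, of 1] show ?thesis by simp
qed

lemma smooth_on_even_quotient:
  assumes "smooth_on {-1..1} \<psi>"
  shows "smooth_on {-1..1} (even_quotient \<psi>)"
  unfolding even_quotient_def[abs_def]
  by (intro smooth_on_bilinear[OF _ bounded_bilinear_mult] smooth_on_const smooth_on_avg smooth_on_nderiv assms fat_Icc) auto

lemma even_quotient_deriv:
  assumes \<psi>: "smooth_on {-1..1} \<psi>" and ev: "\<And>t. t \<in> {-1..1} \<Longrightarrow> \<psi> (- t) = \<psi> t" and t: "t \<in> {-1..1}"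
  shows "2 * t * even_quotient \<psi> t = deriv_on {-1..1} \<psi> t"
proof -
  have "deriv_on {-1..1} \<psi> 0 = 0" using even_deriv[OF \<psi> ev, of 0] by simp
  moreover have "nderiv {-1..1} \<psi> [1, 1] = deriv_on {-1..1} (deriv_on {-1..1} \<psi>)" by simp
  ultimately show ?thesis
    using avg_deriv[OF _ _ smooth_on_nderiv[OF \<psi>] t, of "[1]"] by (simp add: even_quotient_def del: nderiv.simps)
qed

lemma even_quotient_even:
  assumes \<psi>: "smooth_on {-1..1} \<psi>" and ev: "\<And>t. t \<in> {-1..1} \<Longrightarrow> \<psi> (- t) = \<psi> t" and t: "t \<in> {-1..1}"
  shows "even_quotient \<psi> (- t) = even_quotient \<psi> t"
proof (cases "t = 0")
  case False
  have mt: "- t \<in> {-1..1}" using t by auto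
  have "2 * (- t) * even_quotient \<psi> (- t) = deriv_on {-1..1} \<psi> (- t)"
    by (rule even_quotient_deriv[OF \<psi> ev mt])
  also have "\<dots> = - deriv_on {-1..1} \<psi> t" by (rule even_deriv[OF \<psi> ev t])
  also have "deriv_on {-1..1} \<psi> t = 2 * t * even_quotient \<psi> t"
    by (rule even_quotient_deriv[OF \<psi> ev t, symmetric])
  finally have "2 * (- t) * even_quotient \<psi> (- t) = - (2 * t * even_quotient \<psi> t)" .
  then show ?thesis using False by simp
qed simp

text \<open>Whitney's theorem on even functions: if \<open>\<psi> t = \<phi> (t\<^sup>2)\<close> is smooth on \<open>[-1, 1]\<close> then
  \<open>\<phi>' (t\<^sup>2) = \<psi>' t / (2 t) = 1/2 \<integral> \<psi>'' (u t) du\<close>, again a smooth even function of \<open>t\<close>.\<close>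

lemma has_vector_derivative_even_quotient:
  assumes \<psi>: "smooth_on {-1..1} \<psi>" and eq: "\<And>t. t \<in> {-1..1} \<Longrightarrow> \<psi> t = \<phi> (t\<^sup>2)" and s: "s \<in> {0..1}"
  shows "(\<phi> has_vector_derivative even_quotient \<psi> (sqrt s)) (at s within {0..1})"
proof -
  have ev: "\<psi> (- t) = \<psi> t" if "t \<in> {-1..1}" for t using that eq[of t] eq[of "- t"] by simp
  have sq: "sqrt s \<in> {-1..1}" if "s \<in> {0..1}" for s
    using that real_sqrt_ge_zero[of s] by (auto intro: order_trans[of _ 0])
  have \<phi>: "\<phi> s = \<psi> (sqrt s)" if "s \<in> {0..1}" for s using that eq[OF sq[OF that]] by simp
  define \<phi>1 where "\<phi>1 s = even_quotient \<psi> (sqrt s)" for s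
  have c_sqrt: "continuous_on {0..1} (\<lambda>s. w (sqrt s))" if "continuous_on {-1..1} w" for w :: "real \<Rightarrow> real"
    by (rule continuous_on_compose2[OF that]) (use sq in \<open>auto intro!: continuous_intros simp del: atLeastAtMost_iff\<close>)
  have c: "continuous_on {0..1} \<phi>"
    by (rule continuous_on_eq[OF c_sqrt[OF smooth_on_imp_continuous[OF \<psi>]]]) (simp add: \<phi>)
  have c1: "continuous_on {0..1} \<phi>1"
    unfolding \<phi>1_def[abs_def] by (rule c_sqrt[OF smooth_on_imp_continuous[OF smooth_on_even_quotient[OF \<psi>]]])
  have D: "(\<phi> has_vector_derivative \<phi>1 s) (at s)" if s: "0 < s" "s < 1" for s
  proof -
    define t where "t = sqrt s"
    have t: "0 < t" "t < 1" using s by (auto simp: t_def)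
    have "at t within {-1..1} = at t" using t by (intro at_within_interior) (simp add: interior_atLeastAtMost_real)
    then have "(\<psi> has_real_derivative deriv_on {-1..1} \<psi> t) (at t)"
      using smooth_on_has_vector_derivative[OF \<psi>, of t] t by (simp add: has_real_derivative_iff_has_vector_derivative)
    moreover have "(sqrt has_real_derivative inverse t / 2) (at s)"
      using DERIV_real_sqrt[OF s(1)] by (simp add: t_def)
    ultimately have "((\<lambda>s. \<psi> (sqrt s)) has_real_derivative deriv_on {-1..1} \<psi> t * (inverse t / 2)) (at s)"
      unfolding t_def by (rule DERIV_chain2)
    moreover have "deriv_on {-1..1} \<psi> t * (inverse t / 2) = \<phi>1 s"
      using even_quotient_deriv[OF \<psi> ev, of t] t by (simp add: \<phi>1_def t_def[symmetric] field_simps)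
    ultimately have "((\<lambda>s. \<psi> (sqrt s)) has_real_derivative \<phi>1 s) (at s)" by simp
    moreover have "\<forall>\<^sub>F x in nhds s. \<psi> (sqrt x) = \<phi> x"
      using s \<phi> by (intro eventually_nhds[THEN iffD2] exI[of _ "{0<..<1}"]) auto
    ultimately show ?thesis
      using DERIV_cong_ev[of s s "\<lambda>s. \<psi> (sqrt s)" \<phi> "\<phi>1 s" "\<phi>1 s"]
      by (simp add: has_real_derivative_iff_has_vector_derivative)
  qed
  \<comment> \<open>The square root has no derivative at 0. So \<open>\<phi>\<close> is
    differentiated in the open interval only and recovered as the integral of the continuous
    \<open>\<phi>1\<close>, which has the right one-sided derivatives at both ends.\<close>
  have int: "\<phi> 0 + integral {0..s} \<phi>1 = \<phi> s" if "s \<in> {0..1}" for s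
  proof -
    have "(\<phi>1 has_integral (\<phi> s - \<phi> 0)) {0..s}"
      using that by (intro fundamental_theorem_of_calculus_interior continuous_on_subset[OF c] D) auto
    from integral_unique[OF this] show ?thesis by simp
  qed
  have "((\<lambda>s. \<phi> 0 + integral {0..s} \<phi>1) has_vector_derivative 0 + \<phi>1 s) (at s within {0..1})"
    by (intro has_vector_derivative_add has_vector_derivative_const integral_has_vector_derivative c1 s)
  then have "(\<phi> has_vector_derivative 0 + \<phi>1 s) (at s within {0..1})"
    by (rule has_vector_derivative_transform[OF s, rotated]) (simp add: int)
  then show ?thesis by (simp add: \<phi>1_def)
qed

lemma even_quotient_sqrt:
  assumes "smooth_on {-1..1} \<psi>" "\<And>t. t \<in> {-1..1} \<Longrightarrow> \<psi> t = \<phi> (t\<^sup>2)" "t \<in> {-1..1}"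
  shows "even_quotient \<psi> t = even_quotient \<psi> (sqrt (t\<^sup>2))"
proof -
  have "\<psi> (- t) = \<psi> t" if "t \<in> {-1..1}" for t using that assms(2)[of t] assms(2)[of "- t"] by simp
  from even_quotient_even[OF assms(1) this assms(3)] show ?thesis by (auto simp: abs_if)
qed

text \<open>The derivative of \<open>\<phi>\<close> is
  \<open>\<lambda>s. even_quotient \<psi> (sqrt s)\<close>. Together with the smooth function
  \<open>even_quotient \<psi>\<close> it satisfies the same hypotheses, so the induction on the
  order runs over all such pairs.\<close>

lemma smooth_on_if_even:
  fixes \<phi> \<psi> :: "real \<Rightarrow> real"
  assumes "smooth_on {-1..1} \<psi>" "\<And>t. t \<in> {-1..1} \<Longrightarrow> \<psi> t = \<phi> (t\<^sup>2)"
  shows "smooth_on {0..1} \<phi>"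
proof -
  have "diff_to_order k {0..1} \<phi>" for k
    using assms
  proof (induction k arbitrary: \<phi> \<psi>)
    case 0
    then show ?case
      using has_vector_derivative_even_quotient[OF 0]
      unfolding diff_to_order_0 differentiable_on_def by (blast intro: differentiableI_vector)
  next
    case (Suc k)
    note D = has_vector_derivative_even_quotient[OF Suc.prems]
    have IH: "diff_to_order k {0..1} (\<lambda>s. even_quotient \<psi> (sqrt s))"
      by (rule Suc.IH[OF smooth_on_even_quotient[OF Suc.prems(1)] even_quotient_sqrt[OF Suc.prems]])
    have "diff_to_order k {0..1} (nderiv {0..1} \<phi> [v])" for v
    proof (rule diff_to_order_cong)
      show "diff_to_order k {0..1} (\<lambda>s. v * even_quotient \<psi> (sqrt s))"
        by (intro diff_to_order_bilinear[OF _ bounded_bilinear_mult] IH diff_to_order_const fat_Icc) auto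
    qed (use nderiv_real_eq[OF fat_Icc _ D] in simp)
    moreover have "\<phi> differentiable_on {0..1}"
      using D unfolding differentiable_on_def by (blast intro: differentiableI_vector)
    ultimately show ?case by (simp add: diff_to_order_Suc del: nderiv.simps)
  qed
  then show ?thesis by (simp add: smooth_on_iff_order)
qed

text \<open>Each derivative of \<open>\<phi>\<close> uses two of \<open>\<psi>\<close>; hence
  convergence of \<open>\<psi>\<close> is assumed in all orders, while the conclusion is proved
  order by order.\<close>

lemma smooth_lim_if_even:
  fixes \<phi> \<psi> :: "'i \<Rightarrow> real \<Rightarrow> real"
  assumes "\<And>n. smooth_lim n F {-1..1} {-1..1} \<psi> \<psi>0"
    and "\<forall>\<^sub>F i in F. \<forall>t\<in>{-1..1}. \<psi> i t = \<phi> i (t\<^sup>2)" and "\<And>t. t \<in> {-1..1} \<Longrightarrow> \<psi>0 t = \<phi>0 (t\<^sup>2)"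
  shows "smooth_lim n F {0..1} {0..1} \<phi> \<phi>0"
  using assms
proof (induction n arbitrary: \<phi> \<phi>0 \<psi> \<psi>0)
  case 0
  note \<psi> = smooth_lim_D[OF 0(1), unfolded smooth_near_self]
  have sq: "sqrt s \<in> {-1..1}" if "s \<in> {0..1}" for s
    using that real_sqrt_ge_zero[of s] by (auto intro: order_trans[of _ 0])
  have "uniform_limit {0..1} (\<lambda>i s. \<psi> i (sqrt s)) (\<lambda>s. \<psi>0 (sqrt s)) F"
    by (rule uniform_limit_compose'[OF \<psi>(3)]) (use sq in blast)
  moreover have "\<forall>\<^sub>F i in F. \<forall>s\<in>{0..1}. \<psi> i (sqrt s) = \<phi> i s"
    using 0(2) by (rule eventually_mono) (use sq in \<open>auto simp del: atLeastAtMost_iff\<close>, simp)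
  moreover have "\<psi>0 (sqrt s) = \<phi>0 s" if "s \<in> {0..1}" for s
    using 0(3)[OF sq[OF that]] that by simp
  ultimately have "uniform_limit {0..1} \<phi> \<phi>0 F"
    using uniform_limit_cong[of "{0..1}" "\<lambda>i s. \<psi> i (sqrt s)" \<phi> F "\<lambda>s. \<psi>0 (sqrt s)" \<phi>0] by blast
  moreover have "\<forall>\<^sub>F i in F. smooth_on {0..1} (\<phi> i)"
    using \<psi>(2) 0(2) by (rule eventually_elim2) (erule smooth_on_if_even, blast)
  ultimately show ?case
    using smooth_on_if_even[OF \<psi>(1) 0(3)] by (simp add: smooth_lim_0 smooth_near_self)
next
  case (Suc n)
  note \<psi> = smooth_lim_D[OF Suc.prems(1), unfolded smooth_near_self]
  have q: "smooth_lim m F {-1..1} {-1..1} (\<lambda>i. even_quotient (\<psi> i)) (even_quotient \<psi>0)" for m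
  proof -
    have "smooth_lim m F {-1..1} {-1..1} (\<lambda>i. nderiv {-1..1} (\<psi> i) [1, 1]) (nderiv {-1..1} \<psi>0 [1, 1])"
      using smooth_lim_SucD(2)[OF smooth_lim_SucD(2)[OF Suc.prems(1)], of m 1 1] by simp
    from smooth_lim_avg[OF _ _ _ this, of 0] show ?thesis
      unfolding even_quotient_def[abs_def]
      by (intro smooth_lim_bilinear[OF _ bounded_bilinear_mult] smooth_lim_const smooth_on_imp_near smooth_on_const fat_Icc) auto
  qed
  have lim1: "smooth_lim n F {0..1} {0..1} (\<lambda>i s. even_quotient (\<psi> i) (sqrt s)) (\<lambda>s. even_quotient \<psi>0 (sqrt s))"
  proof (rule Suc.IH[OF q])
    show "\<forall>\<^sub>F i in F. \<forall>t\<in>{-1..1}. even_quotient (\<psi> i) t = even_quotient (\<psi> i) (sqrt (t\<^sup>2))"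
      using \<psi>(2) Suc.prems(2) by (rule eventually_elim2) (intro ballI, erule even_quotient_sqrt, auto)
  qed (rule even_quotient_sqrt[OF \<psi>(1) Suc.prems(3)])
  show ?case
  proof (rule smooth_lim_Suc_I)
    have "smooth_lim n F {0..1} {0..1} \<phi> \<phi>0" by (rule Suc.IH[OF Suc.prems])
    then show "smooth_lim 0 F {0..1} {0..1} \<phi> \<phi>0" by (rule smooth_lim_mono) simp
    fix v
    show "smooth_lim n F {0..1} {0..1} (\<lambda>i. nderiv {0..1} (\<phi> i) [v]) (nderiv {0..1} \<phi>0 [v])"
    proof (rule smooth_lim_cong)
      show "smooth_lim n F {0..1} {0..1} (\<lambda>i s. v * even_quotient (\<psi> i) (sqrt s)) (\<lambda>s. v * even_quotient \<psi>0 (sqrt s))"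
        by (intro smooth_lim_bilinear[OF _ bounded_bilinear_mult] lim1 smooth_lim_const smooth_on_imp_near smooth_on_const fat_Icc) auto
      have *: "eq_near {0..1} {0..1} (\<lambda>s. v * even_quotient \<psi> (sqrt s)) (nderiv {0..1} \<phi> [v])"
        if "smooth_on {-1..1} \<psi>" "\<And>t. t \<in> {-1..1} \<Longrightarrow> \<psi> t = \<phi> (t\<^sup>2)" for \<phi> \<psi>
        unfolding eq_near_def
        using nderiv_real_eq[OF fat_Icc _ has_vector_derivative_even_quotient[OF that]]
        by (intro exI[of _ UNIV]) simp
      show "eq_near {0..1} {0..1} (\<lambda>s. v * even_quotient \<psi>0 (sqrt s)) (nderiv {0..1} \<phi>0 [v])"
        by (rule *[OF \<psi>(1) Suc.prems(3)])
      show "\<forall>\<^sub>F i in F. eq_near {0..1} {0..1} (\<lambda>s. v * even_quotient (\<psi> i) (sqrt s)) (nderiv {0..1} (\<phi> i) [v])"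
        using \<psi>(2) Suc.prems(2) by (rule eventually_elim2) (erule *, blast)
    qed simp
  qed
qed

subsection \<open>The line as a manifold\<close>

lemma inv_into_UNIV_id [simp]: "inv_into UNIV id = (id :: 'a \<Rightarrow> 'a)"
  by (rule ext) (simp add: inv_into_f_eq)

lemma smooth_atlas_line: "smooth_atlas line_atlas"
  using smooth_on_ident[OF fat_UNIV]
  by (simp add: smooth_atlas_def line_atlas_def homeomorphism_def continuous_on_id' id_def flip: id_def)

lemma fat_domain_line: "a < b \<Longrightarrow> fat_domain line_atlas {a..b}"
  using fat_Icc[of a b] by (simp add: fat_domain_def smooth_atlas_line) (simp add: line_atlas_def)

lemma smooth_map_line_iff:
  "smooth_map line_atlas X line_atlas Y h \<longleftrightarrow> smooth_on X h \<and> h ` X \<subseteq> Y"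
  using smooth_on_imp_continuous[of X h] by (auto simp: smooth_map_def line_atlas_def)

text \<open>There is a single chart and the interval is compact, so the test set
  \<open>K = {a..b}\<close> covers all others.\<close>

lemma chart_lim_line_iff:
  assumes "a < b"
  shows "chart_lim line_atlas {a..b} line_atlas F h h0 \<longleftrightarrow> (\<forall>n. smooth_lim n F {a..b} {a..b} h h0)"
proof
  assume "chart_lim line_atlas {a..b} line_atlas F h h0"
  from chart_limD(2)[OF this, of UNIV id UNIV id "{a..b}"]
  show "\<forall>n. smooth_lim n F {a..b} {a..b} h h0" by (simp add: line_atlas_def)
next
  assume *: "\<forall>n. smooth_lim n F {a..b} {a..b} h h0"
  show "chart_lim line_atlas {a..b} line_atlas F h h0"
    by (rule chart_limI) (use * in \<open>auto simp: line_atlas_def intro: smooth_lim_subset\<close>)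
qed

lemma limitin_line_iff:
  assumes "a < b"
  shows "limitin (cinf_topology line_atlas {a..b} line_atlas Y) h h0 F \<longleftrightarrow>
    h0 ` {a..b} \<subseteq> Y \<and> (\<forall>\<^sub>F i in F. h i ` {a..b} \<subseteq> Y) \<and> (\<forall>n. smooth_lim n F {a..b} {a..b} h h0)"
  unfolding limitin_cinf_iff[OF fat_domain_line[OF assms] smooth_atlas_line] chart_lim_line_iff[OF assms]
    smooth_map_line_iff
  using smooth_lim_D(1,2)[of 0 F "{a..b}" "{a..b}" h h0, unfolded smooth_near_self]
  by (auto simp: eventually_conj_iff)

section \<open>Diffeomorphisms of the unit interval\<close>

lemma D01_iff:
  "\<phi> \<in> D01 \<longleftrightarrow> \<phi> permutes {0..1} \<and> smooth_on {0..1} \<phi> \<and> smooth_on {0..1} (inv_into UNIV \<phi>)"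
proof -
  have "\<phi> ` {0..1} = {0..1}" "inv_into UNIV \<phi> ` {0..1} = {0..1}" if "\<phi> permutes {0..1}"
    using permutes_image[OF that] permutes_image[OF permutes_inv[OF that]] by blast+
  then show ?thesis
    unfolding D01_def diffeos_def mem_Collect_eq smooth_map_line_iff by blast
qed

lemma fat_unit: "fat {0..1::real}"
  by (rule fat_Icc) simp

lemma fat_domain_unit: "fat_domain line_atlas {0..1}"
  by (rule fat_domain_line) simp

lemma D01_D:
  assumes "\<phi> \<in> D01"
  shows "\<phi> permutes {0..1}" "bij \<phi>" "smooth_on {0..1} \<phi>" "smooth_on {0..1} (inv_into UNIV \<phi>)"
    "\<And>t. t \<in> {0..1} \<Longrightarrow> \<phi> t \<in> {0..1}" "\<And>t. t \<notin> {0..1} \<Longrightarrow> \<phi> t = t" "\<phi> ` {0..1} = {0..1}"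
  using assms diffeosD[of \<phi> line_atlas "{0..1}"] unfolding D01_iff by (auto simp: D01_def[symmetric] D01_iff simp del: atLeastAtMost_iff)

lemma vector_derivative_eq_deriv_on:
  assumes "smooth_on {0..1} \<phi>" "t \<in> {0..1}"
  shows "vector_derivative \<phi> (at t within {0..1}) = deriv_on {0..1} \<phi> t"
  using vector_derivative_within_closed_interval[OF _ assms(2) smooth_on_has_vector_derivative[OF assms]] by simp

lemma D01_plus_iff: "\<phi> \<in> D01_plus \<longleftrightarrow> \<phi> \<in> D01 \<and> (\<forall>t\<in>{0..1}. deriv_on {0..1} \<phi> t > 0)"
  using vector_derivative_eq_deriv_on[of \<phi>] D01_D(3)[of \<phi>] unfolding D01_plus_def mem_Collect_eq by metis

lemma D01_plus_imp_D01: "\<phi> \<in> D01_plus \<Longrightarrow> \<phi> \<in> D01"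
  unfolding D01_plus_iff by blast

lemma deriv_on_comp:
  assumes "smooth_on {0..1} \<phi>" "smooth_on {0..1} \<eta>" "\<eta> ` {0..1} \<subseteq> {0..1}" "t \<in> {0..1}"
  shows "deriv_on {0..1} (\<phi> \<circ> \<eta>) t = deriv_on {0..1} \<phi> (\<eta> t) * deriv_on {0..1} \<eta> t"
proof -
  have "\<eta> t \<in> {0..1}" using assms by blast
  then have "(\<phi> has_vector_derivative deriv_on {0..1} \<phi> (\<eta> t)) (at (\<eta> t) within \<eta> ` {0..1})"
    using smooth_on_has_vector_derivative[OF assms(1)] has_vector_derivative_within_subset assms(3) by blast
  from vector_diff_chain_within[OF smooth_on_has_vector_derivative[OF assms(2,4)] this]
  show ?thesis using nderiv_real_eq[OF fat_unit assms(4)] by (simp add: mult.commute del: nderiv.simps)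
qed

lemma deriv_on_id:
  assumes "t \<in> {0..1}"
  shows "deriv_on {0..1} id t = 1"
proof -
  have "(id has_vector_derivative 1) (at t within {0..1})"
    unfolding id_def by (rule has_vector_derivative_id)
  from nderiv_real_eq[OF fat_unit assms this, of 1] show ?thesis by simp
qed

lemma D01_deriv_inv:
  assumes "\<phi> \<in> D01" "t \<in> {0..1}"
  shows "deriv_on {0..1} \<phi> (inv_into UNIV \<phi> t) * deriv_on {0..1} (inv_into UNIV \<phi>) t = 1"
proof -
  note \<phi> = D01_D[OF assms(1)]
  have "\<phi> \<circ> inv_into UNIV \<phi> = id" using \<phi>(2) by (auto simp: bij_is_surj surj_f_inv_f)
  moreover have "inv_into UNIV \<phi> ` {0..1} \<subseteq> {0..1}"
    using permutes_image[OF permutes_inv[OF \<phi>(1)]] by blast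
  ultimately show ?thesis
    using deriv_on_comp[OF \<phi>(3,4) _ assms(2)] deriv_on_id[OF assms(2)] by metis
qed

lemma D01_inv_mem: "\<phi> \<in> D01 \<Longrightarrow> t \<in> {0..1} \<Longrightarrow> inv_into UNIV \<phi> t \<in> {0..1}"
  using permutes_in_image[OF permutes_inv[OF D01_D(1)]] by blast

lemma D01_deriv_nonzero:
  assumes "\<phi> \<in> D01" "t \<in> {0..1}"
  shows "deriv_on {0..1} \<phi> t \<noteq> 0"
proof -
  have "inv_into UNIV \<phi> (\<phi> t) = t" using D01_D(2)[OF assms(1)] by (simp add: bij_is_inj)
  then show ?thesis using D01_deriv_inv[OF assms(1) D01_D(5)[OF assms]]
    by (metis mult_zero_left zero_neq_one)
qed

lemma D01_id: "id \<in> D01" and D01_comp: "\<phi> \<in> D01 \<Longrightarrow> \<eta> \<in> D01 \<Longrightarrow> \<phi> \<circ> \<eta> \<in> D01"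
  and D01_inv: "\<phi> \<in> D01 \<Longrightarrow> inv_into UNIV \<phi> \<in> D01"
  unfolding D01_def using diffeos_id[OF fat_domain_unit] diffeos_comp[OF fat_domain_unit] diffeos_inv by blast+

section \<open>Orientation preserving diffeomorphisms of the interval\<close>

lemma D01_plus_id: "id \<in> D01_plus"
  by (simp add: D01_plus_iff D01_id deriv_on_id del: nderiv.simps)

lemma D01_plus_comp:
  assumes "\<phi> \<in> D01_plus" "\<eta> \<in> D01_plus"
  shows "\<phi> \<circ> \<eta> \<in> D01_plus"
proof -
  note D = D01_plus_imp_D01[OF assms(1)] D01_plus_imp_D01[OF assms(2)]
  have "\<eta> ` {0..1} \<subseteq> {0..1}" using D01_D(7)[OF D(2)] by blast
  note comp = deriv_on_comp[OF D01_D(3)[OF D(1)] D01_D(3)[OF D(2)] this]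
  have "deriv_on {0..1} (\<phi> \<circ> \<eta>) t > 0" if "t \<in> {0..1}" for t
    unfolding comp[OF that]
    using assms[unfolded D01_plus_iff] D01_D(5)[OF D(2) that] that by (intro mult_pos_pos) blast+
  then show ?thesis using D01_comp[OF D] by (simp add: D01_plus_iff del: nderiv.simps)
qed

lemma D01_plus_inv:
  assumes "\<phi> \<in> D01_plus"
  shows "inv_into UNIV \<phi> \<in> D01_plus"
  unfolding D01_plus_iff
proof (intro conjI ballI D01_inv D01_plus_imp_D01 assms)
  fix t :: real assume t: "t \<in> {0..1}"
  have \<phi>: "\<phi> \<in> D01" using D01_plus_imp_D01[OF assms] .
  have "deriv_on {0..1} \<phi> (inv_into UNIV \<phi> t) > 0"
    using assms D01_inv_mem[OF \<phi> t] unfolding D01_plus_iff by blast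
  then show "deriv_on {0..1} (inv_into UNIV \<phi>) t > 0"
    using D01_deriv_inv[OF \<phi> t] by (metis zero_less_mult_pos zero_less_one)
qed

lemma strict_mono_on_if_deriv_pos:
  assumes "smooth_on {0..1} \<phi>" "\<And>t. t \<in> {0..1} \<Longrightarrow> deriv_on {0..1} \<phi> t > 0" "0 \<le> s" "s < t" "t \<le> 1"
  shows "\<phi> s < \<phi> t"
proof (rule DERIV_pos_imp_increasing_open[OF assms(4)])
  fix x assume x: "s < x" "x < t"
  then have x': "0 < x" "x < 1" using assms(3,5) by simp_all
  then have mem: "x \<in> {0..1}" and at: "at x within {0..1} = at x"
    by (simp, intro at_within_interior) (simp add: interior_atLeastAtMost_real)
  have "(\<phi> has_real_derivative deriv_on {0..1} \<phi> x) (at x)"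
    using smooth_on_has_vector_derivative[OF assms(1) mem]
    unfolding at has_real_derivative_iff_has_vector_derivative .
  then show "\<exists>y. DERIV \<phi> x :> y \<and> y > 0" using assms(2)[OF mem] by blast
next
  show "continuous_on {s..t} \<phi>"
    by (rule continuous_on_subset[OF smooth_on_imp_continuous[OF assms(1)]]) (use assms(3,5) in auto)
qed

lemma D01_plus_ends:
  assumes "\<phi> \<in> D01_plus"
  shows "\<phi> 0 = 0" "\<phi> 1 = 1"
proof -
  note \<phi> = D01_D[OF D01_plus_imp_D01[OF assms]]
  have mono: "\<phi> s < \<phi> t" if "0 \<le> s" "s < t" "t \<le> 1" for s t
    using strict_mono_on_if_deriv_pos[OF \<phi>(3)] assms that unfolding D01_plus_iff by blast
  obtain a where a: "a \<in> {0..1}" "\<phi> a = 0" using \<phi>(7) by (metis atLeastAtMost_iff imageE order_refl zero_le_one)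
  obtain b where b: "b \<in> {0..1}" "\<phi> b = 1" using \<phi>(7) by (metis atLeastAtMost_iff imageE order_refl zero_le_one)
  show "\<phi> 0 = 0" using mono[of 0 a] a \<phi>(5)[of 0] by (cases "a = 0") auto
  show "\<phi> 1 = 1" using mono[of b 1] b \<phi>(5)[of 1] by (cases "b = 1") auto
qed

text \<open>An injective continuous function on an interval is strictly monotone, and a decreasing
  one would send 1 to 0. Difference quotients then give a nonnegative derivative, and invertibility
  makes it nonzero.\<close>

lemma D01_plusI:
  assumes "\<phi> \<in> D01" "\<phi> 1 \<noteq> 0"
  shows "\<phi> \<in> D01_plus"
proof -
  note \<phi> = D01_D[OF assms(1)]
  have cont: "continuous_on {0..1} \<phi>" using smooth_on_imp_continuous[OF \<phi>(3)] .
  have "inj_on \<phi> {0..1}" using \<phi>(2) by (metis bij_def inj_on_subset subset_UNIV)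
  then have "strict_mono_on {0..1} \<phi> \<or> strict_antimono_on {0..1} \<phi>"
    using injective_eq_monotone_map[OF _ cont] by (simp add: is_interval_cc)
  moreover have "\<not> strict_antimono_on {0..1} \<phi>"
  proof
    assume anti: "strict_antimono_on {0..1} \<phi>"
    obtain a where a: "a \<in> {0..1}" "\<phi> a = 0" using \<phi>(7) by (metis atLeastAtMost_iff imageE order_refl zero_le_one)
    then have "a < 1" using assms(2) by (cases "a = 1") auto
    then have "\<phi> 1 < \<phi> a" using monotone_onD[OF anti a(1), of 1] by simp
    then show False using a \<phi>(5)[of 1] by auto
  qed
  ultimately have mono: "strict_mono_on {0..1} \<phi>" by blast
  have "deriv_on {0..1} \<phi> t > 0" if t: "t \<in> {0..1}" for t
  proof -
    have "((\<lambda>s. (\<phi> s - \<phi> t) / (s - t)) \<longlongrightarrow> deriv_on {0..1} \<phi> t) (at t within {0..1})"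
      using smooth_on_has_vector_derivative[OF \<phi>(3) t]
      by (simp only: has_real_derivative_iff_has_vector_derivative[symmetric] has_field_derivative_iff)
    moreover have "\<forall>\<^sub>F s in at t within {0..1}. (\<phi> s - \<phi> t) / (s - t) \<ge> 0"
      unfolding eventually_at_filter
    proof (rule always_eventually, intro allI impI)
      fix s assume s: "s \<noteq> t" "s \<in> {0..1}"
      show "0 \<le> (\<phi> s - \<phi> t) / (s - t)"
        using strict_mono_onD[OF mono s(2) t] strict_mono_onD[OF mono t s(2)] s(1)
        by (cases "s < t") (simp_all add: zero_le_divide_iff)
    qed
    moreover have "at t within {0..1} \<noteq> bot"
      using t by (simp add: trivial_limit_within islimpt_Icc)
    ultimately have "deriv_on {0..1} \<phi> t \<ge> 0" by (rule tendsto_lowerbound)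
    then show ?thesis using D01_deriv_nonzero[OF assms(1) t] by linarith
  qed
  then show ?thesis using assms(1) unfolding D01_plus_iff by blast
qed

text \<open>The inverse function theorem with one-sided derivatives at the ends. The first
  derivative comes from inverting difference quotients, the higher ones from
  \<open>\<psi>' = 1 / (\<phi>' \<circ> \<psi>)\<close> by the bootstrap.\<close>

lemma smooth_on_inverse_function:
  assumes \<phi>: "smooth_on {0..1} \<phi>" "\<And>t. t \<in> {0..1} \<Longrightarrow> deriv_on {0..1} \<phi> t > 0" "\<phi> ` {0..1} = {0..1}"
    and \<psi>: "\<And>t. t \<in> {0..1} \<Longrightarrow> \<psi> (\<phi> t) = t"
  shows "smooth_on {0..1} \<psi>"
proof -
  have \<psi>_mem: "\<psi> y \<in> {0..1}" "\<phi> (\<psi> y) = y" if y: "y \<in> {0..1}" for y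
  proof -
    have "y \<in> \<phi> ` {0..1}" using y by (simp only: \<phi>(3))
    then obtain t where "t \<in> {0..1}" "y = \<phi> t" by blast
    then show "\<psi> y \<in> {0..1}" "\<phi> (\<psi> y) = y" using \<psi>[of t] by simp_all
  qed
  have cont: "continuous_on {0..1} \<psi>"
    using continuous_on_inv[OF smooth_on_imp_continuous[OF \<phi>(1)] compact_Icc] \<psi> unfolding \<phi>(3) by blast
  have D: "(\<psi> has_vector_derivative inverse (deriv_on {0..1} \<phi> (\<psi> y))) (at y within {0..1})" if y: "y \<in> {0..1}" for y
  proof -
    have "((\<lambda>t. (\<phi> t - \<phi> (\<psi> y)) / (t - \<psi> y)) \<longlongrightarrow> deriv_on {0..1} \<phi> (\<psi> y)) (at (\<psi> y) within {0..1})"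
      using smooth_on_has_vector_derivative[OF \<phi>(1) \<psi>_mem(1)[OF y]]
      by (simp only: has_real_derivative_iff_has_vector_derivative[symmetric] has_field_derivative_iff)
    moreover have "filterlim \<psi> (at (\<psi> y) within {0..1}) (at y within {0..1})"
      unfolding filterlim_at
    proof
      show "(\<psi> \<longlongrightarrow> \<psi> y) (at y within {0..1})" using cont y by (simp add: continuous_on_def)
      show "\<forall>\<^sub>F x in at y within {0..1}. \<psi> x \<in> {0..1} \<and> \<psi> x \<noteq> \<psi> y"
        unfolding eventually_at_filter by (rule always_eventually) (metis \<psi>_mem y)
    qed
    ultimately have "((\<lambda>x. (\<phi> (\<psi> x) - \<phi> (\<psi> y)) / (\<psi> x - \<psi> y)) \<longlongrightarrow> deriv_on {0..1} \<phi> (\<psi> y)) (at y within {0..1})"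
      by (rule filterlim_compose)
    then have "((\<lambda>x. inverse ((\<phi> (\<psi> x) - \<phi> (\<psi> y)) / (\<psi> x - \<psi> y))) \<longlongrightarrow> inverse (deriv_on {0..1} \<phi> (\<psi> y))) (at y within {0..1})"
      by (rule tendsto_inverse) (use \<phi>(2)[OF \<psi>_mem(1)[OF y]] in linarith)
    then have "((\<lambda>x. (\<psi> x - \<psi> y) / (x - y)) \<longlongrightarrow> inverse (deriv_on {0..1} \<phi> (\<psi> y))) (at y within {0..1})"
      by (rule Lim_transform_eventually)
        (auto simp: eventually_at_filter \<psi>_mem y simp del: atLeastAtMost_iff intro!: always_eventually)
    then show ?thesis
      by (simp only: has_real_derivative_iff_has_vector_derivative[symmetric] has_field_derivative_iff)
  qed
  show ?thesis
  proof (rule smooth_on_Suc_I[OF fat_unit])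
    show "\<psi> differentiable_on {0..1}"
      unfolding differentiable_on_def using D by (blast intro: differentiableI_vector)
    fix k assume k: "diff_to_order k {0..1} \<psi>"
    show "\<forall>v. diff_to_order k {0..1} (nderiv {0..1} \<psi> [v])"
    proof
      fix v
      have "diff_to_order k {0..1} (\<lambda>y. deriv_on {0..1} \<phi> (\<psi> y))"
        using diff_to_order_compose[OF fat_unit _ k, of "{0..1}" "deriv_on {0..1} \<phi>"] \<psi>_mem(1)
          smooth_on_nderiv[OF \<phi>(1)] unfolding smooth_on_iff_order by blast
      then have "diff_to_order k {0..1} (\<lambda>y. inverse (deriv_on {0..1} \<phi> (\<psi> y)))"
        using diff_to_order_compose[OF fat_unit, of "\<lambda>y. deriv_on {0..1} \<phi> (\<psi> y)" "{0<..}" k inverse]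
          smooth_on_inverse \<phi>(2) \<psi>_mem(1) unfolding smooth_on_iff_order by (meson greaterThan_iff image_subsetI)
      then have *: "diff_to_order k {0..1} (\<lambda>y. v * inverse (deriv_on {0..1} \<phi> (\<psi> y)))"
        by (intro diff_to_order_bilinear[OF fat_unit bounded_bilinear_mult] diff_to_order_const[OF fat_unit])
      show "diff_to_order k {0..1} (nderiv {0..1} \<psi> [v])"
        by (rule diff_to_order_cong[OF *]) (rule nderiv_real_eq[OF fat_unit _ D, symmetric])
    qed
  qed
qed

text \<open>A convex combination of \<open>id\<close> and \<open>\<phi>\<close> has positive
  derivative and the same end points, hence is a diffeomorphism. The conditional keeps the extension
  by the identity.\<close>

lemma D01_plus_convex:
  assumes "\<phi> \<in> D01_plus" "a \<in> {0..1}"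
  shows "(\<lambda>s. if s \<in> {0..1} then (1 - a) * s + a * \<phi> s else s) \<in> D01_plus" (is "?\<eta> \<in> _")
proof -
  note \<phi> = D01_D[OF D01_plus_imp_D01[OF assms(1)]]
  have sm: "smooth_on {0..1} (\<lambda>s. (1 - a) * s + a * \<phi> s)"
    by (intro smooth_on_add smooth_on_bilinear[OF _ bounded_bilinear_mult] smooth_on_const smooth_on_ident \<phi>(3) fat_unit)
  then have sm\<eta>: "smooth_on {0..1} ?\<eta>" by (rule smooth_on_cong) simp
  have D: "(?\<eta> has_vector_derivative (1 - a) * 1 + a * deriv_on {0..1} \<phi> t) (at t within {0..1})" if t: "t \<in> {0..1}" for t
  proof -
    have "((\<lambda>s. (1 - a) * s + a * \<phi> s) has_vector_derivative (1 - a) * 1 + a * deriv_on {0..1} \<phi> t) (at t within {0..1})"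
      by (intro has_vector_derivative_add has_vector_derivative_mult_right has_vector_derivative_id
          smooth_on_has_vector_derivative \<phi>(3) t)
    then show ?thesis by (rule has_vector_derivative_transform[OF t, rotated]) simp
  qed
  have pos: "deriv_on {0..1} ?\<eta> t > 0" if t: "t \<in> {0..1}" for t
  proof -
    have "deriv_on {0..1} \<phi> t > 0" using assms(1) t unfolding D01_plus_iff by blast
    then have "(1 - a) * 1 + a * deriv_on {0..1} \<phi> t > 0"
      using assms(2) by (cases "a = 0") (auto intro: add_nonneg_pos)
    moreover have "deriv_on {0..1} ?\<eta> t = (1 - a) * 1 + a * deriv_on {0..1} \<phi> t"
      using nderiv_real_eq[OF fat_unit t D[OF t], of 1] by simp
    ultimately show ?thesis by simp
  qed
  have mono: "?\<eta> s < ?\<eta> t" if "0 \<le> s" "s < t" "t \<le> 1" for s t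
    using strict_mono_on_if_deriv_pos[OF sm\<eta> pos that] .
  have ends: "?\<eta> 0 = 0" "?\<eta> 1 = 1" using D01_plus_ends[OF assms(1)] by auto
  have inj: "inj_on ?\<eta> {0..1}"
    by (rule linorder_inj_onI) (use mono in \<open>force\<close>)+
  have im: "?\<eta> ` {0..1} = {0..1}"
  proof
    show "?\<eta> ` {0..1} \<subseteq> {0..1}"
    proof
      fix y assume "y \<in> ?\<eta> ` {0..1}"
      then obtain t where t: "t \<in> {0..1}" "y = ?\<eta> t" by blast
      then show "y \<in> {0..1}"
        using mono[of 0 t] mono[of t 1] ends by (cases "t = 0"; cases "t = 1") force+
    qed
    show "{0..1} \<subseteq> ?\<eta> ` {0..1}"
    proof
      fix y :: real assume "y \<in> {0..1}"
      then show "y \<in> ?\<eta> ` {0..1}"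
        using IVT'[of ?\<eta> 0 y 1] ends smooth_on_imp_continuous[OF sm\<eta>] by auto
    qed
  qed
  have perm: "?\<eta> permutes {0..1}"
  proof (rule bij_imp_permutes)
    show "bij_betw ?\<eta> {0..1} {0..1}" unfolding bij_betw_def using inj im by (rule conjI)
  qed (auto split: if_splits)
  have "inv_into UNIV ?\<eta> (?\<eta> t) = t" for t using permutes_inj[OF perm] by (rule inv_into_f_f) simp
  then have "smooth_on {0..1} (inv_into UNIV ?\<eta>)"
    by (intro smooth_on_inverse_function[OF sm\<eta> pos im])
  then have "?\<eta> \<in> D01" using perm sm\<eta> by (simp only: D01_iff)
  then show ?thesis using pos unfolding D01_plus_iff by blast
qed

subsection \<open>The quotient \<open>\<phi>(t) / t\<close>\<close>

lemma g_fun_eq_avg: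
  assumes "smooth_on {0..1} \<phi>" "t \<in> {0..1}"
  shows "g_fun \<phi> t = avg 0 (deriv_on {0..1} \<phi>) t"
  unfolding g_fun_def avg_def
proof (rule integral_cong)
  fix u :: real assume "u \<in> {0..1}"
  then have "u * t \<in> {0..1}" using scaled_mem_interval[of 0 1 t u] assms(2) by simp
  from vector_derivative_eq_deriv_on[OF assms(1) this]
  show "vector_derivative \<phi> (at (u * t) within {0..1}) = u ^ 0 * deriv_on {0..1} \<phi> (u * t)" by simp
qed

lemma smooth_on_g_fun:
  assumes "smooth_on {0..1} \<phi>"
  shows "smooth_on {0..1} (g_fun \<phi>)"
  by (rule smooth_on_cong[OF smooth_on_avg[OF _ _ _ smooth_on_nderiv[OF assms]]])
    (auto simp: g_fun_eq_avg[OF assms] simp del: nderiv.simps)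

lemma g_fun_mult:
  assumes "\<phi> \<in> D01_plus" "t \<in> {0..1}"
  shows "t * g_fun \<phi> t = \<phi> t"
  using avg_deriv[of 0 1 \<phi> t] D01_D(3)[OF D01_plus_imp_D01[OF assms(1)]] assms(2) D01_plus_ends(1)[OF assms(1)]
  by (simp add: g_fun_eq_avg del: nderiv.simps)

text \<open>The derivative has a positive minimum on the compact interval, and its average cannot
  fall below that.\<close>

lemma g_fun_pos:
  assumes "\<phi> \<in> D01_plus" "t \<in> {0..1}"
  shows "g_fun \<phi> t > 0"
proof -
  note \<phi> = D01_D[OF D01_plus_imp_D01[OF assms(1)]]
  have c: "continuous_on {0..1} (deriv_on {0..1} \<phi>)" using smooth_on_imp_continuous[OF smooth_on_nderiv[OF \<phi>(3)]] .
  obtain x0 where x0: "x0 \<in> {0..1}" "\<And>x. x \<in> {0..1} \<Longrightarrow> deriv_on {0..1} \<phi> x0 \<le> deriv_on {0..1} \<phi> x"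
    using continuous_attains_inf[OF compact_Icc _ c] by auto
  have "integral {0..1} (\<lambda>u::real. deriv_on {0..1} \<phi> x0) \<le> avg 0 (deriv_on {0..1} \<phi>) t"
    unfolding avg_def
  proof (rule integral_le)
    show "(\<lambda>u. u ^ 0 * deriv_on {0..1} \<phi> (u * t)) integrable_on {0..1}"
      by (rule integrable_continuous_real[OF avg_integrand_continuous[OF _ _ c assms(2)]]) auto
    fix u :: real assume "u \<in> {0..1}"
    then have "u * t \<in> {0..1}" using scaled_mem_interval[of 0 1 t u] assms(2) by simp
    from x0(2)[OF this] show "deriv_on {0..1} \<phi> x0 \<le> u ^ 0 * deriv_on {0..1} \<phi> (u * t)" by simp
  qed auto
  moreover have "deriv_on {0..1} \<phi> x0 > 0" using assms(1) x0(1) unfolding D01_plus_iff by blast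
  ultimately show ?thesis unfolding g_fun_eq_avg[OF \<phi>(3) assms(2)] by simp
qed

text \<open>A multiplicative cocycle rule for the quotients, obtained by cancelling
  \<open>t\<close>. Level 0 is left to the zero section, on which every rescaling is the
  identity.\<close>

lemma g_fun_comp:
  assumes "\<phi> \<in> D01_plus" "\<eta> \<in> D01_plus" "t \<in> {0..1}" "t \<noteq> 0"
  shows "g_fun (\<phi> \<circ> \<eta>) t = g_fun \<phi> (\<eta> t) * g_fun \<eta> t"
proof -
  have \<eta>t: "\<eta> t \<in> {0..1}" using D01_D(5)[OF D01_plus_imp_D01[OF assms(2)] assms(3)] .
  have "t * g_fun (\<phi> \<circ> \<eta>) t = \<phi> (\<eta> t)"
    using g_fun_mult[OF D01_plus_comp[OF assms(1,2)] assms(3)] by simp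
  also have "\<dots> = \<eta> t * g_fun \<phi> (\<eta> t)" using g_fun_mult[OF assms(1) \<eta>t] by simp
  also have "\<dots> = t * (g_fun \<phi> (\<eta> t) * g_fun \<eta> t)" using g_fun_mult[OF assms(2,3)] by simp
  finally show ?thesis using assms(4) by simp
qed

lemma g_fun_eq_quotient:
  assumes "\<phi> \<in> D01_plus" "t \<in> {0..1}" "t \<noteq> 0"
  shows "g_fun \<phi> t = \<phi> t / t"
  using g_fun_mult[OF assms(1,2)] assms(3) by (simp add: field_simps)

lemma smooth_lim_g_fun:
  assumes "\<And>n. smooth_lim n F {0..1} {0..1} \<phi> \<phi>0"
  shows "smooth_lim n F {0..1} {0..1} (\<lambda>i. g_fun (\<phi> i)) (g_fun \<phi>0)"
proof (rule smooth_lim_cong)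
  show "smooth_lim n F {0..1} {0..1} (\<lambda>i. avg 0 (deriv_on {0..1} (\<phi> i))) (avg 0 (deriv_on {0..1} \<phi>0))"
    by (intro smooth_lim_avg smooth_lim_SucD(2) assms) auto
  note D = smooth_lim_D(1,2)[OF assms[of 0], unfolded smooth_near_self]
  have *: "eq_near {0..1} {0..1} (avg 0 (deriv_on {0..1} \<phi>)) (g_fun \<phi>)" if "smooth_on {0..1} \<phi>" for \<phi>
    unfolding eq_near_def using g_fun_eq_avg[OF that] by (intro exI[of _ UNIV]) auto
  show "eq_near {0..1} {0..1} (avg 0 (deriv_on {0..1} \<phi>0)) (g_fun \<phi>0)" by (rule *[OF D(1)])
  show "\<forall>\<^sub>F i in F. eq_near {0..1} {0..1} (avg 0 (deriv_on {0..1} (\<phi> i))) (g_fun (\<phi> i))"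
    using D(2) by (rule eventually_mono) (rule *)
qed simp

section \<open>The tube of a definite homogeneous function\<close>

lemma smooth_map_restrict:
  assumes "smooth_map A UNIV A' Y h" "fat_domain A X" "smooth_atlas A'"
  shows "smooth_map A X A' Y h"
proof (rule smooth_mapI)
  show cont: "continuous_on X h" using smooth_mapD(1)[OF assms(1)] continuous_on_subset by blast
  show "h ` X \<subseteq> Y" using smooth_mapD(2)[OF assms(1)] by blast
  fix U c V d assume c: "(U, c) \<in> A" and d: "(V, d) \<in> A'"
  show "smooth_on (c ` (U \<inter> X \<inter> h -` V)) (d \<circ> h \<circ> inv_into U c)"
    by (rule smooth_on_subset[OF smooth_mapD(3)[OF assms(1) c d]
          _ fat_local_domain[OF assms(2) c cont smooth_atlasD(1)[OF assms(3) d]]]) blast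
qed

locale tube_bundle = smooth_vector_bundle p add scal A \<Phi>
  for p :: "'e::topological_space \<Rightarrow> 'b::t2_space"
    and add :: "'e \<Rightarrow> 'e \<Rightarrow> 'e"
    and scal :: "real \<Rightarrow> 'e \<Rightarrow> 'e"
    and A :: "('b, 'm::{real_normed_vector,heine_borel}) chart set"
    and \<Phi> :: "('b set \<times> ('e \<Rightarrow> 'v::euclidean_space)) set" +
  fixes f :: "'e \<Rightarrow> real"
  assumes f_smooth: "smooth_map (bundle_atlas p A \<Phi>) UNIV line_atlas UNIV f"
    and f_homogeneous: "homogeneous scal 2 f"
    and f_definite: "definite scal f"
begin

abbreviation EA :: "('e, 'm \<times> 'v) chart set" where
  "EA \<equiv> bundle_atlas p A \<Phi>"

abbreviation T :: "'e set" where
  "T \<equiv> tube f"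

text \<open>All that is used later about the shape of bundle charts: the domain is a union of
  fibres, \<open>scal\<close> acts on the second coordinate only, and the image contains the whole
  vertical fibre through each of its points.\<close>

lemma EA_chart:
  assumes "(P, c) \<in> EA"
  shows "\<And>x y. x \<in> P \<Longrightarrow> p y = p x \<Longrightarrow> y \<in> P"
    and "\<And>x t. scal t x \<in> P \<longleftrightarrow> x \<in> P"
    and "\<And>x t. x \<in> P \<Longrightarrow> c (scal t x) = (fst (c x), t *\<^sub>R snd (c x))"
    and "\<And>z v. z \<in> c ` P \<Longrightarrow> (fst z, v) \<in> c ` P"
proof -
  obtain W c0 U \<tau> where *: "(W, c0) \<in> A" "(U, \<tau>) \<in> \<Phi>"
    "P = p -` (W \<inter> U)" "c = (\<lambda>x. (c0 (p x), \<tau> x))"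
    using assms unfolding bundle_atlas_def by blast
  show "\<And>x y. x \<in> P \<Longrightarrow> p y = p x \<Longrightarrow> y \<in> P" by (simp add: *)
  show "\<And>x t. scal t x \<in> P \<longleftrightarrow> x \<in> P" by (simp add: * proj_scal)
  show "\<And>x t. x \<in> P \<Longrightarrow> c (scal t x) = (fst (c x), t *\<^sub>R snd (c x))"
    using triv_scal[OF *(2)] by (simp add: * proj_scal)
  fix z v assume "z \<in> c ` P"
  then obtain x where x: "p x \<in> W" "p x \<in> U" "z = c x" by (auto simp: *)
  obtain g where g: "homeomorphism (p -` U) (U \<times> UNIV) (\<lambda>x. (p x, \<tau> x)) g"
    using triv_homeo[OF *(2)] by blast
  have "(p x, v) \<in> (\<lambda>x. (p x, \<tau> x)) ` (p -` U)"
    using homeomorphism_image1[OF g] x by blast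
  then obtain y where "p y = p x" "\<tau> y = v" by auto
  then show "(fst z, v) \<in> c ` P" using x by (auto simp: * intro!: image_eqI[of _ _ y])
qed

lemma EA_cover: obtains P c where "(P, c) \<in> EA" "x \<in> P"
  using smooth_atlas_cover[OF total_atlas] .

lemmas EA_inj = smooth_atlasD(4)[OF total_atlas]
  and EA_open = smooth_atlasD(1)[OF total_atlas]
  and EA_image_open = smooth_atlasD(2)[OF total_atlas]

lemma EA_eqI:
  assumes "(P, c) \<in> EA" "x \<in> P" "y \<in> P" "c x = c y"
  shows "x = y"
  using EA_inj[OF assms(1)] assms(2-4) by (auto dest: inj_onD)

text \<open>Laws of scalar multiplication are read off in a chart, where they are laws of the model
  fibre, and carried back by injectivity of the chart.\<close>

lemma scal_1 [simp]: "scal 1 x = x"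
proof -
  obtain P c where c: "(P, c) \<in> EA" "x \<in> P" by (rule EA_cover)
  show ?thesis by (rule EA_eqI[OF c(1)]) (simp_all add: c EA_chart[OF c(1)])
qed

lemma scal_scal [simp]: "scal s (scal t x) = scal (s * t) x"
proof -
  obtain P c where c: "(P, c) \<in> EA" "x \<in> P" by (rule EA_cover)
  show ?thesis by (rule EA_eqI[OF c(1)]) (simp_all add: c EA_chart(2,3)[OF c(1)])
qed

lemma f_scal: "t \<ge> 0 \<Longrightarrow> f (scal t x) = t\<^sup>2 * f x"
  using f_homogeneous by (simp add: homogeneous_def)

lemma f_nonneg: "f x \<ge> 0"
proof (cases "x \<in> range (scal 0)")
  case True
  then show ?thesis using f_scal[of 0] by auto
qed (use f_definite in \<open>auto simp: definite_def less_imp_le\<close>)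

text \<open>By definiteness \<open>x\<close> is \<open>scal 0 y\<close> for some \<open>y\<close>.
  This settles the later cases in which a quotient at level 0 would be needed.\<close>

lemma scal_zero_section:
  assumes "f x = 0"
  shows "scal t x = x"
proof -
  have "x \<in> range (scal 0)" using f_definite assms unfolding definite_def by force
  then show ?thesis by auto
qed

lemma f_pos: "x \<notin> range (scal 0) \<Longrightarrow> f x > 0"
  using f_definite by (simp add: definite_def)

lemma T_iff: "x \<in> T \<longleftrightarrow> f x \<le> 1"
  using f_nonneg by (simp add: tube_def)

lemma f_mem: "x \<in> T \<Longrightarrow> f x \<in> {0..1}"
  by (simp add: tube_def)

section \<open>The function \<open>f\<close> in charts and along fibres\<close>

lemma f_chart_smooth:
  assumes "(P, c) \<in> EA"
  shows "smooth_on (c ` P) (f \<circ> inv_into P c)"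
  using smooth_mapD(3)[OF f_smooth assms, of UNIV id] by (simp add: line_atlas_def)

lemma f_continuous: "continuous_on UNIV f"
  using smooth_mapD(1)[OF f_smooth] .

lemma inv_chart_scal:
  assumes c: "(P, c) \<in> EA" and x: "x \<in> P"
  shows "inv_into P c (fst (c x), t *\<^sub>R snd (c x)) = scal t x"
  using EA_chart(3)[OF c x, of t] inv_into_f_f[OF EA_inj[OF c], of "scal t x"] EA_chart(2)[OF c] x by metis

lemma smooth_on_vertical_line:
  assumes "fat S"
  shows "smooth_on S (\<lambda>t::real. (y, t *\<^sub>R v))"
  by (intro smooth_on_Pair smooth_on_const smooth_on_linear[OF _ bounded_linear_scaleR_left] smooth_on_ident assms)

lemma f_line_smooth: "smooth_on UNIV (\<lambda>t. f (scal t x))"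
proof -
  obtain P c where c: "(P, c) \<in> EA" "x \<in> P" by (rule EA_cover)
  have "(\<lambda>t. (fst (c x), t *\<^sub>R snd (c x))) ` UNIV \<subseteq> c ` P"
    using EA_chart(4)[OF c(1)] c(2) by blast
  from smooth_on_compose[OF fat_UNIV smooth_on_vertical_line[OF fat_UNIV] f_chart_smooth[OF c(1)] this]
  show ?thesis by (simp add: inv_chart_scal[OF c])
qed

lemma second_deriv_square:
  fixes S :: "real set"
  assumes "fat S" "0 \<in> S"
  shows "nderiv S (\<lambda>t. t\<^sup>2 * a) [1, 1] 0 = 2 * a"
proof -
  have 1: "deriv_on S (\<lambda>t. t\<^sup>2 * a) t = 2 * t * a" if "t \<in> S" for t
  proof -
    have "((\<lambda>t. t\<^sup>2 * a) has_vector_derivative 2 * t * a) (at t within S)"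
      unfolding has_real_derivative_iff_has_vector_derivative[symmetric]
      by (auto intro!: derivative_eq_intros)
    from nderiv_real_eq[OF assms(1) that this, of 1] show ?thesis by simp
  qed
  have "((\<lambda>t. 2 * t * a) has_vector_derivative 2 * a) (at 0 within S)"
    unfolding has_real_derivative_iff_has_vector_derivative[symmetric]
    by (auto intro!: derivative_eq_intros)
  from nderiv_real_eq[OF assms this, of 1] have "deriv_on S (\<lambda>t. 2 * t * a) 0 = 2 * a" by simp
  moreover have "nderiv S (deriv_on S (\<lambda>t. t\<^sup>2 * a)) [1] 0 = nderiv S (\<lambda>t. 2 * t * a) [1] 0"
    by (rule nderiv_cong[OF 1 assms(2)])
  ultimately show ?thesis by simp
qed

text \<open>The point 0 may be an end point of the interval: a smooth function has the same
  derivatives within any fat subset, so one-sided knowledge of \<open>k\<close> fixes its second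
  derivative.\<close>

lemma second_deriv_if_square:
  fixes k :: "real \<Rightarrow> real"
  assumes k: "smooth_on UNIV k" and ab: "a < b" "0 \<in> {a..b}" and q: "\<And>t. t \<in> {a..b} \<Longrightarrow> k t = t\<^sup>2 * q"
  shows "nderiv UNIV k [1, 1] 0 = 2 * q"
proof -
  have "nderiv UNIV k [1, 1] 0 = nderiv {a..b} k [1, 1] 0"
    by (rule nderiv_subset[OF k subset_UNIV fat_Icc[OF ab(1)] ab(2), symmetric])
  also have "\<dots> = nderiv {a..b} (\<lambda>t. t\<^sup>2 * q) [1, 1] 0"
    by (rule nderiv_cong[OF q ab(2)])
  also have "\<dots> = 2 * q"
    by (rule second_deriv_square[OF fat_Icc[OF ab(1)] ab(2)])
  finally show ?thesis .
qed

text \<open>Homogeneity only concerns \<open>t \<ge> 0\<close>, but \<open>t \<mapsto> f (t x)\<close> has a second derivative at \<open>0\<close>, so its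
  two quadratic halves agree: \<open>f\<close> is even on fibres.\<close>

lemma f_uminus: "f (scal (-1) x) = f x"
proof -
  have "nderiv UNIV (\<lambda>t. f (scal t x)) [1, 1] 0 = 2 * f x"
    by (rule second_deriv_if_square[OF f_line_smooth, of 0 1]) (auto simp: f_scal)
  moreover have neg: "f (scal t x) = t\<^sup>2 * f (scal (-1) x)" if "t \<in> {-1..0}" for t
    using f_scal[of "- t" "scal (-1) x"] that by simp
  have "nderiv UNIV (\<lambda>t. f (scal t x)) [1, 1] 0 = 2 * f (scal (-1) x)"
    by (rule second_deriv_if_square[OF f_line_smooth _ _ neg]) auto
  ultimately show ?thesis by linarith
qed

lemma f_scal_real: "f (scal t x) = t\<^sup>2 * f x"
proof (cases "t \<ge> 0")
  case False
  then have "f (scal (- t) (scal (-1) x)) = t\<^sup>2 * f x" using f_scal[of "- t" "scal (-1) x"] by (simp add: f_uminus)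
  then show ?thesis by simp
qed (rule f_scal)

text \<open>Below the boundary level every direction is admissible by continuity. On the boundary
  the directions with \<open>L w < 0\<close> are; they form a nonempty open half-space, which
  spans.\<close>

lemma tube_chart_fat:
  assumes c: "(P, c) \<in> EA"
  shows "fat (c ` (P \<inter> T))"
  unfolding fat_def
proof
  fix z assume "z \<in> c ` (P \<inter> T)"
  then obtain x where x: "x \<in> P" "x \<in> T" "z = c x" by blast
  let ?S = "c ` (P \<inter> T)" and ?F = "f \<circ> inv_into P c"
  let ?W = "{w. \<forall>\<^sub>F t in at_right 0. z + t *\<^sub>R w \<in> ?S}"
  have inv: "inv_into P c (c y) = y" if "y \<in> P" for y using EA_inj[OF c] that by simp
  have S: "?S = c ` P \<inter> {y. ?F y \<le> 1}" by (auto simp: inv T_iff)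
  have zP: "z \<in> c ` P" using x by blast
  have opn: "open (c ` P)" using EA_image_open[OF c] .
  have Fz: "?F z = f x" using x inv by simp
  have "?F differentiable (at z within c ` P)"
    using smooth_on_imp_differentiable[OF f_chart_smooth[OF c]] zP unfolding differentiable_on_def by (rule bspec)
  then obtain L where L: "(?F has_derivative L) (at z)"
    using at_within_open[OF zP opn] unfolding differentiable_def by metis
  have lin: "linear L" using has_derivative_linear[OF L] .
  have line: "((\<lambda>t. ?F (z + t *\<^sub>R w)) has_real_derivative L w) (at 0)" for w
  proof -
    have "((\<lambda>t. z + t *\<^sub>R w) has_derivative (\<lambda>t. t *\<^sub>R w)) (at 0)"
      by (auto intro!: derivative_eq_intros)
    from has_derivative_compose[OF this, of ?F L] L
    have "((\<lambda>t. ?F (z + t *\<^sub>R w)) has_derivative (\<lambda>t. L (t *\<^sub>R w))) (at 0)" by simp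
    then show ?thesis by (simp add: linear_scale[OF lin] has_field_derivative_def mult.commute[of "L w"] mult_commute_abs)
  qed
  have evP: "\<forall>\<^sub>F t in at_right 0. z + t *\<^sub>R w \<in> c ` P" for w
    by (rule eventually_at_right_line[OF opn zP])
  have W: "w \<in> ?W" if "f x < 1 \<or> L w < 0" for w
  proof -
    have "\<forall>\<^sub>F t in at_right 0. ?F (z + t *\<^sub>R w) \<le> 1"
    proof (cases "f x < 1")
      case True
      have "((\<lambda>t. ?F (z + t *\<^sub>R w)) \<longlongrightarrow> ?F (z + 0 *\<^sub>R w)) (at 0)"
        using DERIV_isCont[OF line[of w]] by (simp add: isCont_def)
      then have "((\<lambda>t. ?F (z + t *\<^sub>R w)) \<longlongrightarrow> f x) (at_right 0)"
        using Fz by (auto intro: filterlim_at_split[THEN iffD1, THEN conjunct2])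
      from order_tendstoD(2)[OF this True] show ?thesis by (rule eventually_mono) simp
    next
      case False
      then have "L w < 0" using that by blast
      from DERIV_neg_dec_right[OF line this] obtain d where d: "d > 0"
        "\<And>t. 0 < t \<Longrightarrow> t < d \<Longrightarrow> ?F (z + t *\<^sub>R w) < ?F (z + 0 *\<^sub>R w)" by auto
      have "\<forall>\<^sub>F t in at_right 0. 0 < t \<and> t < d"
        using d(1) eventually_at_right_field by blast
      then show ?thesis
        by (rule eventually_mono) (use d(2) Fz f_mem[OF x(2)] in fastforce)
    qed
    then show ?thesis using evP[of w] unfolding S by (simp add: eventually_conj_iff)
  qed
  show "span ?W = UNIV"
  proof (cases "f x < 1")
    case True
    then show ?thesis using W by (metis (no_types, lifting) UNIV_eq_I span_base)
  next
    case False
    then have fx: "f x = 1" using x T_iff by force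
    \<comment> \<open>The inward radial direction: along it \<open>f\<close> equals
      \<open>(1 - t)^2\<close>, so its derivative at 0 is -2.\<close>
    let ?w0 = "(0, - snd z)"
    have "L ?w0 = - 2"
    proof -
      have "((\<lambda>t. ?F (z + t *\<^sub>R ?w0)) has_real_derivative - 2) (at 0)"
      proof -
        have "z + t *\<^sub>R ?w0 = (fst (c x), (1 - t) *\<^sub>R snd (c x))" for t
          using x by (intro prod_eqI) (simp_all add: scaleR_left_diff_distrib)
        then have "?F (z + t *\<^sub>R ?w0) = (1 - t)\<^sup>2" for t
          using inv_chart_scal[OF c x(1)] f_scal_real fx by simp
        then show ?thesis by (auto intro!: derivative_eq_intros)
      qed
      then show ?thesis using DERIV_unique line by blast
    qed
    then have w0: "?w0 \<in> ?W" using W[of ?w0] by simp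
    have "w \<in> span ?W" for w
    proof -
      \<comment> \<open>Large enough that adding \<open>l\<close> times the inward direction to
        \<open>w\<close> makes the derivative \<open>L w - 2 * l\<close> negative; then
        \<open>w\<close> is a combination of two admissible directions.\<close>
      define l where "l = \<bar>L w\<bar> + 1"
      have "L (w + l *\<^sub>R ?w0) = L w - 2 * l"
        using \<open>L ?w0 = - 2\<close> by (simp only: linear_add[OF lin] linear_scale[OF lin]) simp
      moreover have "L w - 2 * l < 0"
        unfolding l_def using abs_ge_self[of "L w"] abs_ge_zero[of "L w"] by argo
      ultimately have "L (w + l *\<^sub>R ?w0) < 0" by (simp only:)
      then have "w + l *\<^sub>R ?w0 \<in> ?W" using W by blast
      then have "(w + l *\<^sub>R ?w0) - l *\<^sub>R ?w0 \<in> span ?W"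
        using w0 by (intro span_diff span_scale span_base)
      then show ?thesis by simp
    qed
    then show ?thesis by blast
  qed
qed

lemma fat_domain_T: "fat_domain EA T"
  unfolding fat_domain_def using total_atlas tube_chart_fat by blast

lemma f_smooth_T: "smooth_map EA T line_atlas UNIV f"
  by (rule smooth_map_restrict[OF f_smooth fat_domain_T smooth_atlas_line])

text \<open>Rank at least 1 enters through a nonzero fibre coordinate \<open>v\<close>; a point with
  this coordinate is off the zero section, and rescaling normalises \<open>f\<close> there.\<close>

lemma exists_unit: "\<exists>x. f x = 1"
proof -
  obtain P c where c: "(P, c) \<in> EA" "undefined \<in> P" by (rule EA_cover)
  obtain v :: 'v where v: "v \<in> Basis" using nonempty_Basis by blast
  obtain x where x: "x \<in> P" "c x = (fst (c undefined), v)"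
    using EA_chart(4)[OF c(1), of "c undefined" v] c(2) by (metis image_iff)
  have "x \<notin> range (scal 0)"
  proof
    assume "x \<in> range (scal 0)"
    then obtain y where y: "x = scal 0 y" by blast
    then have "c x = (fst (c y), 0)" using EA_chart(2,3)[OF c(1)] x by simp
    then show False using x v nonzero_Basis by auto
  qed
  then have "f x > 0" by (rule f_pos)
  then have "f (scal (1 / sqrt (f x)) x) = 1" by (simp add: f_scal_real power_divide)
  then show ?thesis by blast
qed

section \<open>A segment in one fibre that meets every leaf\<close>

definition unit_pt :: 'e where "unit_pt = (SOME x. f x = 1)"

definition ray :: "real \<Rightarrow> 'e" where "ray t = scal t unit_pt"

lemma f_unit_pt: "f unit_pt = 1"
  unfolding unit_pt_def by (rule someI_ex[OF exists_unit])

lemma f_ray: "f (ray t) = t\<^sup>2"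
  by (simp add: ray_def f_scal_real f_unit_pt)

lemma ray_T: "t \<in> {-1..1} \<Longrightarrow> ray t \<in> T"
  by (simp add: T_iff f_ray abs_square_le_1 abs_le_iff)

lemma fat_ray_domain: "fat {-1..1::real}"
  by (rule fat_Icc) simp

lemma ray_chart:
  assumes "(P, c) \<in> EA" "unit_pt \<in> P"
  shows "ray t \<in> P" "c (ray t) = (fst (c unit_pt), t *\<^sub>R snd (c unit_pt))"
  using EA_chart(2,3)[OF assms(1)] assms(2) by (simp_all add: ray_def)

lemma ray_continuous: "continuous_on UNIV ray"
proof -
  obtain P c where c: "(P, c) \<in> EA" "unit_pt \<in> P" by (rule EA_cover)
  have cont: "continuous_on (c ` P) (inv_into P c)"
    using smooth_atlasD(3)[OF total_atlas c(1)] unfolding homeomorphism_def by blast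
  have sub: "(\<lambda>t. (fst (c unit_pt), t *\<^sub>R snd (c unit_pt))) ` UNIV \<subseteq> c ` P"
    using EA_chart(4)[OF c(1)] c(2) by blast
  have "continuous_on UNIV (\<lambda>t. inv_into P c (fst (c unit_pt), t *\<^sub>R snd (c unit_pt)))"
    by (rule continuous_on_compose2[OF cont _ sub]) (intro continuous_intros)
  then show ?thesis using inv_chart_scal[OF c] by (simp add: ray_def[abs_def])
qed

lemma ray_smooth: "smooth_map line_atlas {-1..1} EA T ray"
proof (rule smooth_mapI)
  show cont: "continuous_on {-1..1} ray" using ray_continuous continuous_on_subset by blast
  show "ray ` {-1..1} \<subseteq> T" using ray_T by blast
  fix U V and c :: "real \<Rightarrow> real" and d assume c: "(U, c) \<in> line_atlas" and d: "(V, d) \<in> EA"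
  have [simp]: "U = UNIV" "c = id" using c by (auto simp: line_atlas_def)
  show "smooth_on (c ` (U \<inter> {-1..1} \<inter> ray -` V)) (d \<circ> ray \<circ> inv_into U c)"
  proof (cases "unit_pt \<in> V")
    case True
    have "smooth_on UNIV (d \<circ> ray)"
      by (rule smooth_on_cong[OF smooth_on_vertical_line[OF fat_UNIV, of "fst (d unit_pt)" "snd (d unit_pt)"]])
        (simp add: ray_chart[OF d True])
    from smooth_on_subset[OF this _ fat_local_domain[OF fat_domain_line[of "-1" 1] c cont EA_open[OF d]]]
    show ?thesis by simp
  next
    case False
    \<comment> \<open>The ray lies in a single fibre, which is either contained in the chart domain
      \<open>V\<close> or disjoint from it.\<close>
    then have "ray t \<notin> V" for t using EA_chart(2)[OF d] by (simp add: ray_def)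
    then have "{-1..1} \<inter> ray -` V = {}" by blast
    then show ?thesis by (simp add: smooth_on_def differentiable_on_def)
  qed
qed

end

section \<open>The induced diffeomorphism of the interval\<close>

context tube_bundle
begin

abbreviation Dfol where "Dfol \<equiv> D_fol EA f"
abbreviation Dlp where "Dlp \<equiv> D_lp EA f"

section \<open>Leaf permuting diffeomorphisms\<close>

lemma DT_D:
  assumes "h \<in> DT EA f"
  shows "h permutes T" "bij h" "smooth_map EA T EA T h" "smooth_map EA T EA T (inv_into UNIV h)"
    "\<And>x. x \<in> T \<Longrightarrow> h x \<in> T" "\<And>x. x \<notin> T \<Longrightarrow> h x = x" "h ` T = T"
  using diffeosD[OF assms[unfolded DT_def]] by blast+

lemma DT_inv_apply:
  assumes "h \<in> DT EA f"
  shows "inv_into UNIV h (h x) = x" "h (inv_into UNIV h x) = x" "x \<in> T \<Longrightarrow> inv_into UNIV h x \<in> T"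
  using DT_D(2)[OF assms] permutes_in_image[OF permutes_inv[OF DT_D(1)[OF assms]], of x]
  by (simp_all add: bij_is_inj bij_is_surj surj_f_inv_f)

lemma Dfol_D: "h \<in> Dfol \<Longrightarrow> h \<in> DT EA f"
  by (simp add: D_fol_def)

text \<open>Every level in the unit interval is attained, at \<open>ray (sqrt t)\<close>, so each
  leaf passes through a point of the tube.\<close>

lemma leaves_iff: "L \<in> leaves f \<longleftrightarrow> (\<exists>x\<in>T. L = f -` {f x})"
proof
  assume "L \<in> leaves f"
  then obtain t where t: "L = f -` {t}" "t \<in> {0..1}" by (auto simp: leaves_def)
  have ft: "f (ray (sqrt t)) = t" using t f_ray by simp
  then have "ray (sqrt t) \<in> T" using t T_iff by simp
  then show "\<exists>x\<in>T. L = f -` {f x}" using t ft by (intro bexI[of _ "ray (sqrt t)"]) simp_all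
next
  assume "\<exists>x\<in>T. L = f -` {f x}"
  then obtain x where "x \<in> T" "L = f -` {f x}" by blast
  then show "L \<in> leaves f" unfolding leaves_def using f_mem by blast
qed

lemma ray_sqrt: "t \<in> {0..1} \<Longrightarrow> f (ray (sqrt t)) = t" "t \<in> {0..1} \<Longrightarrow> ray (sqrt t) \<in> T"
  by (simp_all add: f_ray T_iff)

lemma Dfol_leaf:
  assumes "h \<in> Dfol" "x \<in> T" "y \<in> T" "f x = f y"
  shows "f (h x) = f (h y)"
proof -
  have "h ` (f -` {f x}) \<in> leaves f"
    using assms leaves_iff unfolding D_fol_def by blast
  then obtain z where z: "h ` (f -` {f x}) = f -` {f z}" unfolding leaves_iff by blast
  have "h x \<in> h ` (f -` {f x})" "h y \<in> h ` (f -` {f x})" using assms(4) by auto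
  then show ?thesis unfolding z by simp
qed

text \<open>Compatibility with \<open>f\<close> only sends a leaf into a leaf. That the image is the
  whole leaf follows from surjectivity of \<open>h\<close> on the tube and injectivity of
  \<open>\<phi>\<close>.\<close>

lemma Dfol_I:
  assumes h: "h \<in> DT EA f" and \<phi>: "\<And>x. x \<in> T \<Longrightarrow> f (h x) = \<phi> (f x)" "inj_on \<phi> {0..1}"
  shows "h \<in> Dfol"
proof -
  have "h ` (f -` {f x}) = f -` {f (h x)}" if x: "x \<in> T" for x
  proof
    show "h ` (f -` {f x}) \<subseteq> f -` {f (h x)}"
    proof
      fix w assume "w \<in> h ` (f -` {f x})"
      then obtain y where "f y = f x" "w = h y" by blast
      then show "w \<in> f -` {f (h x)}" using \<phi>(1)[of x] \<phi>(1)[of y] x T_iff by simp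
    qed
    show "f -` {f (h x)} \<subseteq> h ` (f -` {f x})"
    proof
      fix y assume "y \<in> f -` {f (h x)}"
      then have y: "f y = f (h x)" by simp
      then have "y \<in> T" using DT_D(5)[OF h x] T_iff by simp
      define z where "z = inv_into UNIV h y"
      have z: "z \<in> T" "h z = y" using DT_inv_apply[OF h, of y] \<open>y \<in> T\<close> by (simp_all add: z_def)
      have "\<phi> (f z) = \<phi> (f x)" using \<phi>(1) z x y by metis
      then have "f z = f x" using inj_onD[OF \<phi>(2)] f_mem[OF z(1)] f_mem[OF x] by blast
      then show "y \<in> h ` (f -` {f x})" using z(2) by blast
    qed
  qed
  then have "h ` L \<in> leaves f" if "L \<in> leaves f" for L
    using that DT_D(5)[OF h] unfolding leaves_iff by metis
  then show ?thesis using h by (simp add: D_fol_def)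
qed

lemma DT_id: "id \<in> DT EA f" and DT_comp: "h \<in> DT EA f \<Longrightarrow> k \<in> DT EA f \<Longrightarrow> h \<circ> k \<in> DT EA f"
  and DT_inv: "h \<in> DT EA f \<Longrightarrow> inv_into UNIV h \<in> DT EA f"
  unfolding DT_def using diffeos_id[OF fat_domain_T] diffeos_comp[OF fat_domain_T] diffeos_inv by blast+

lemma Dfol_id: "id \<in> Dfol"
  by (rule Dfol_I[OF DT_id, of id]) auto

lemma Dfol_comp: "h \<in> Dfol \<Longrightarrow> k \<in> Dfol \<Longrightarrow> h \<circ> k \<in> Dfol"
  using DT_comp by (simp add: D_fol_def image_comp[symmetric] del: o_apply)

lemma Dfol_inv:
  assumes "h \<in> Dfol"
  shows "inv_into UNIV h \<in> Dfol"
proof -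
  note hT = Dfol_D[OF assms]
  have "inv_into UNIV h ` L \<in> leaves f" if L: "L \<in> leaves f" for L
  proof -
    obtain x where x: "x \<in> T" "L = f -` {f x}" using L leaves_iff by blast
    define y where "y = inv_into UNIV h x"
    have y: "y \<in> T" "h y = x" using DT_inv_apply[OF hT, of x] x by (simp_all add: y_def)
    have "f -` {f y} \<in> leaves f" using y leaves_iff by blast
    then have "h ` (f -` {f y}) \<in> leaves f" using assms by (auto simp: D_fol_def)
    then obtain z where "h ` (f -` {f y}) = f -` {f z}" unfolding leaves_iff by blast
    moreover have "h y \<in> h ` (f -` {f y})" by blast
    ultimately have "h ` (f -` {f y}) = L" using x y by auto
    then have "inv_into UNIV h ` L = f -` {f y}"
      using DT_inv_apply(1)[OF hT] by (auto simp: image_image)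
    then show ?thesis using y leaves_iff by blast
  qed
  then show ?thesis using DT_inv[OF hT] by (simp add: D_fol_def)
qed

text \<open>An explicit substitute for \<open>sigma_map\<close>, available before existence and
  uniqueness are known: the ray meets level \<open>s\<close> at \<open>sqrt s\<close>. The value
  \<open>s\<close> off the unit interval is the extension convention for diffeomorphisms.\<close>

definition sig :: "('e \<Rightarrow> 'e) \<Rightarrow> real \<Rightarrow> real" where
  "sig h s = (if s \<in> {0..1} then f (h (ray (sqrt s))) else s)"

lemma sig_f:
  assumes "h \<in> Dfol" "x \<in> T"
  shows "sig h (f x) = f (h x)"
  using f_mem[OF assms(2)] Dfol_leaf[OF assms(1) ray_sqrt(2) assms(2) ray_sqrt(1)]
  by (simp add: sig_def)

lemma sig_inv:
  assumes "h \<in> Dfol"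
  shows "sig (inv_into UNIV h) (sig h s) = s" "sig h (sig (inv_into UNIV h) s) = s"
proof -
  have *: "sig k (sig h s) = s" if h: "h \<in> Dfol" and k: "k \<in> Dfol" and kh: "\<And>x. k (h x) = x" for h k s
  proof (cases "s \<in> {0..1}")
    case True
    have "sig h s = f (h (ray (sqrt s)))" using True by (simp add: sig_def)
    then show ?thesis
      using sig_f[OF k DT_D(5)[OF Dfol_D[OF h] ray_sqrt(2)[OF True]]] kh ray_sqrt(1)[OF True] by simp
  qed (auto simp: sig_def)
  note inv = DT_inv_apply(1,2)[OF Dfol_D[OF assms]]
  show "sig (inv_into UNIV h) (sig h s) = s" by (rule *[OF assms Dfol_inv[OF assms] inv(1)])
  show "sig h (sig (inv_into UNIV h) s) = s" by (rule *[OF Dfol_inv[OF assms] assms inv(2)])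
qed

lemma smooth_map_along_ray:
  assumes "smooth_map EA T EA T h"
  shows "smooth_map line_atlas {-1..1} EA T (h \<circ> ray)"
  by (rule smooth_map_compose[OF fat_domain_line total_atlas total_atlas ray_smooth assms]) simp

lemma smooth_on_along_ray:
  assumes "smooth_map EA T EA T h"
  shows "smooth_on {-1..1} (\<lambda>t. f (h (ray t)))"
proof -
  have "smooth_map line_atlas {-1..1} line_atlas UNIV (f \<circ> (h \<circ> ray))"
    by (rule smooth_map_compose[OF fat_domain_line total_atlas smooth_atlas_line smooth_map_along_ray[OF assms] f_smooth_T]) simp
  then show ?thesis by (simp add: smooth_map_line_iff o_def)
qed

lemma sig_square:
  assumes "h \<in> Dfol" "t \<in> {-1..1}"
  shows "f (h (ray t)) = sig h (t\<^sup>2)"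
  using sig_f[OF assms(1) ray_T[OF assms(2)]] f_ray by simp

lemma sig_smooth:
  assumes "h \<in> Dfol"
  shows "smooth_on {0..1} (sig h)"
  by (rule smooth_on_if_even[OF smooth_on_along_ray[OF DT_D(3)[OF Dfol_D[OF assms]]] sig_square[OF assms]])

text \<open>The inverse of \<open>sig h\<close> is \<open>sig\<close> of the inverse of
  \<open>h\<close>, which is smooth for the same reason as \<open>sig h\<close>.\<close>

lemma sig_D01:
  assumes "h \<in> Dfol"
  shows "sig h \<in> D01"
proof -
  have "bij (sig h)" using sig_inv[OF assms] by (intro bijI') metis+
  moreover have "sig h s = s" if "s \<notin> {0..1}" for s using that by (auto simp: sig_def)
  ultimately have perm: "sig h permutes {0..1}" unfolding permutes_def bij_iff by blast
  have "inv_into UNIV (sig h) = sig (inv_into UNIV h)"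
    using sig_inv[OF assms] by (intro inv_equality)
  then show ?thesis unfolding D01_iff using perm sig_smooth[OF assms] sig_smooth[OF Dfol_inv[OF assms]] by simp
qed

text \<open>A leaf permuting diffeomorphism cannot turn the tube inside out: if it moved the boundary leaf
  to the zero section, \<open>f \<circ> h\<close> would have zero derivative along a ray at its end point, since
  \<open>df = 0\<close> on the zero section; but that derivative is \<open>2 \<sigma>(h)'(1)\<close>.\<close>

lemma sig_1_nonzero:
  assumes h: "h \<in> Dfol"
  shows "sig h 1 \<noteq> 0"
proof
  assume s1: "sig h 1 = 0"
  define \<psi> where "\<psi> t = f (h (ray t))" for t
  define z where "z = h (ray 1)"
  have fz: "f z = 0" using sig_square[OF h, of 1] s1 by (simp add: z_def)
  obtain V d where d: "(V, d) \<in> EA" "z \<in> V" by (rule EA_cover)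
  \<comment> \<open>The parameters whose image lies in the chart \<open>V\<close>: a relatively open
    set, hence still fat, that contains the end point 1.\<close>
  let ?S = "{-1..1} \<inter> (h \<circ> ray) -` V"
  note hr = smooth_map_along_ray[OF DT_D(3)[OF Dfol_D[OF h]]]
  have c: "(UNIV, id) \<in> line_atlas" by (simp add: line_atlas_def)
  have S1: "1 \<in> ?S" using d(2) by (simp add: z_def)
  have fat: "fat ?S"
    using fat_local_domain[OF fat_domain_line[of "-1" 1] c smooth_mapD(1)[OF hr] EA_open[OF d(1)]] by simp
  have sm: "smooth_on ?S (d \<circ> (h \<circ> ray))" using smooth_mapD(3)[OF hr c d(1)] by simp
  have F: "smooth_on (d ` V) (f \<circ> inv_into V d)" by (rule f_chart_smooth[OF d(1)])
  have inv: "inv_into V d (d y) = y" if "y \<in> V" for y using EA_inj[OF d(1)] that by simp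
  have dz: "d z \<in> d ` V" using d by blast
  have "(f \<circ> inv_into V d) differentiable (at (d z) within d ` V)"
    using smooth_on_imp_differentiable[OF F] dz unfolding differentiable_on_def by (rule bspec)
  then obtain L where L: "((f \<circ> inv_into V d) has_derivative L) (at (d z))"
    using at_within_open[OF dz EA_image_open[OF d(1)]] unfolding differentiable_def by metis
  \<comment> \<open>The nonnegative function \<open>f\<close> has a minimum at its zero
    \<open>z\<close>, so its differential vanishes there.\<close>
  have "\<forall>y\<in>d ` V. (f \<circ> inv_into V d) (d z) \<le> (f \<circ> inv_into V d) y"
    using inv d fz f_nonneg by auto
  from differential_zero_maxmin[OF dz EA_image_open[OF d(1)] L disjI2[OF this]] have L0: "L = (\<lambda>v. 0)" .
  have "(d \<circ> (h \<circ> ray)) differentiable (at 1 within ?S)"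
    using smooth_on_imp_differentiable[OF sm] S1 unfolding differentiable_on_def by (rule bspec)
  then obtain M where M: "((d \<circ> (h \<circ> ray)) has_derivative M) (at 1 within ?S)"
    unfolding differentiable_def by blast
  have "(d \<circ> (h \<circ> ray)) 1 = d z" by (simp add: z_def)
  then have "((f \<circ> inv_into V d) has_derivative L) (at ((d \<circ> (h \<circ> ray)) 1) within (d \<circ> (h \<circ> ray)) ` ?S)"
    using has_derivative_at_withinI[OF L] by simp
  from has_derivative_in_compose[OF M this]
  have "((\<lambda>x. (f \<circ> inv_into V d) ((d \<circ> (h \<circ> ray)) x)) has_derivative (\<lambda>v. 0)) (at 1 within ?S)"
    by (simp only: L0)
  then have D0: "(\<psi> has_derivative (\<lambda>v. 0)) (at 1 within ?S)"
    by (rule has_derivative_transform[OF S1, rotated]) (simp add: \<psi>_def inv)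
  have "((\<lambda>t. t\<^sup>2) has_vector_derivative 2) (at 1 within {-1..1::real})"
    unfolding has_real_derivative_iff_has_vector_derivative[symmetric] by (auto intro!: derivative_eq_intros)
  moreover have "(sig h has_vector_derivative deriv_on {0..1} (sig h) 1) (at 1 within (\<lambda>t. t\<^sup>2) ` {-1..1})"
    by (rule has_vector_derivative_within_subset[OF smooth_on_has_vector_derivative[OF sig_smooth[OF h]]])
      (auto simp: abs_square_le_1 abs_le_iff)
  then have "(sig h has_vector_derivative deriv_on {0..1} (sig h) 1) (at (1\<^sup>2) within (\<lambda>t. t\<^sup>2) ` {-1..1})"
    by (simp only: power_one)
  ultimately have "((sig h \<circ> (\<lambda>t. t\<^sup>2)) has_vector_derivative 2 *\<^sub>R deriv_on {0..1} (sig h) 1) (at 1 within {-1..1})"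
    by (rule vector_diff_chain_within)
  then have "(\<psi> has_vector_derivative 2 *\<^sub>R deriv_on {0..1} (sig h) 1) (at 1 within {-1..1})"
    by (rule has_vector_derivative_transform[rotated 2]) (use sig_square[OF h] in \<open>auto simp: \<psi>_def\<close>)
  then have "(\<psi> has_vector_derivative 2 *\<^sub>R deriv_on {0..1} (sig h) 1) (at 1 within ?S)"
    by (rule has_vector_derivative_within_subset) blast
  then have "(\<lambda>v. 0) = (\<lambda>v. v *\<^sub>R (2 *\<^sub>R deriv_on {0..1} (sig h) 1))"
    unfolding has_vector_derivative_def by (rule has_derivative_unique_fat[OF fat S1 D0])
  from fun_cong[OF this, of 1] have "deriv_on {0..1} (sig h) 1 = 0" by simp
  then show False using D01_deriv_nonzero[OF sig_D01[OF h], of 1] by simp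
qed

lemma sig_D01_plus: "h \<in> Dfol \<Longrightarrow> sig h \<in> D01_plus"
  by (intro D01_plusI sig_D01 sig_1_nonzero)

section \<open>Uniqueness of the induced map and the stabilizer as its graph\<close>

lemma D01_eq_if_semiconj:
  assumes "\<phi> \<in> D01" "\<psi> \<in> D01" "\<And>x. x \<in> T \<Longrightarrow> \<phi> (f x) = \<psi> (f x)"
  shows "\<phi> = \<psi>"
proof
  fix s :: real
  show "\<phi> s = \<psi> s"
  proof (cases "s \<in> {0..1}")
    case True
    from assms(3)[OF ray_sqrt(2)[OF True]] show ?thesis by (simp only: ray_sqrt(1)[OF True])
  next
    case False
    then show ?thesis using D01_D(6)[OF assms(1)] D01_D(6)[OF assms(2)] by metis
  qed
qed

text \<open>Stated for all of \<open>D01\<close>, so that it applies to pairs in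
  \<open>S_LR\<close>, whose first component is not assumed to preserve orientation.\<close>

lemma sigma_unique:
  assumes "h \<in> Dfol" "\<phi> \<in> D01" "\<And>x. x \<in> T \<Longrightarrow> \<phi> (f x) = f (h x)"
  shows "\<phi> = sig h"
  by (rule D01_eq_if_semiconj[OF assms(2) sig_D01[OF assms(1)]]) (simp add: assms(3) sig_f[OF assms(1)])

lemma sigma_map_eq:
  assumes "h \<in> Dfol"
  shows "sigma_map f h = sig h"
  unfolding sigma_map_def
proof (rule the_equality)
  show "sig h \<in> D01_plus \<and> (\<forall>x\<in>T. sig h (f x) = f (h x))"
    using sig_D01_plus[OF assms] sig_f[OF assms] by blast
  fix \<phi> assume "\<phi> \<in> D01_plus \<and> (\<forall>x\<in>T. \<phi> (f x) = f (h x))"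
  then show "\<phi> = sig h" using sigma_unique[OF assms D01_plus_imp_D01] by blast
qed

text \<open>The second component determines the first, which is \<open>sig h\<close> and hence
  preserves orientation. This is why \<open>fst\<close> maps the stabilizer into
  \<open>D01_plus\<close>.\<close>

lemma S_LR_iff: "(\<phi>, h) \<in> S_LR EA f \<longleftrightarrow> h \<in> Dfol \<and> \<phi> = sig h"
proof
  assume "(\<phi>, h) \<in> S_LR EA f"
  then have *: "\<phi> \<in> D01" "h \<in> DT EA f" "\<And>x. x \<in> T \<Longrightarrow> \<phi> (f x) = f (h x)" by (auto simp: S_LR_def)
  have "inj_on \<phi> {0..1}" using D01_D(2)[OF *(1)] by (metis bij_def inj_on_subset subset_UNIV)
  then have "h \<in> Dfol" using *(3) by (intro Dfol_I[OF *(2), of \<phi>]) auto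
  then show "h \<in> Dfol \<and> \<phi> = sig h" using sigma_unique[OF _ *(1,3)] by blast
next
  assume "h \<in> Dfol \<and> \<phi> = sig h"
  then show "(\<phi>, h) \<in> S_LR EA f"
    using sig_D01 sig_f Dfol_D by (auto simp: S_LR_def)
qed

lemma sig_comp:
  assumes "h \<in> Dfol" "k \<in> Dfol"
  shows "sig (h \<circ> k) = sig h \<circ> sig k"
proof (rule sigma_unique[OF Dfol_comp[OF assms], symmetric])
  show "sig h \<circ> sig k \<in> D01" by (intro D01_comp sig_D01 assms)
  fix x assume x: "x \<in> T"
  show "(sig h \<circ> sig k) (f x) = f ((h \<circ> k) x)"
    using sig_f[OF assms(2) x] sig_f[OF assms(1) DT_D(5)[OF Dfol_D[OF assms(2)] x]] by simp
qed

lemma Dlp_iff: "h \<in> Dlp \<longleftrightarrow> h \<in> Dfol \<and> sig h = id"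
proof
  assume h: "h \<in> Dlp"
  then have hT: "h \<in> DT EA f" and L: "\<And>L. L \<in> leaves f \<Longrightarrow> h ` L = L" by (auto simp: D_lp_def)
  have "f (h x) = f x" if "x \<in> T" for x
  proof -
    have "f -` {f x} \<in> leaves f" using that leaves_iff by blast
    then have "h x \<in> f -` {f x}" using L by blast
    then show ?thesis by simp
  qed
  moreover have "h \<in> Dfol" using hT L by (simp add: D_fol_def)
  ultimately show "h \<in> Dfol \<and> sig h = id" using sigma_unique[OF _ D01_id, of h] by simp
next
  assume h: "h \<in> Dfol \<and> sig h = id"
  have fh: "f (h x) = f x" if "x \<in> T" for x using sig_f[of h x] h that by simp
  have "h ` L = L" if L: "L \<in> leaves f" for L
  proof -
    obtain x where x: "x \<in> T" "L = f -` {f x}" using L leaves_iff by blast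
    have "h ` L \<in> leaves f" using h L by (simp add: D_fol_def)
    then obtain y where "h ` L = f -` {f y}" unfolding leaves_iff by blast
    moreover have "h x \<in> h ` L" using x by blast
    ultimately show ?thesis using x fh[OF x(1)] by auto
  qed
  then show "h \<in> Dlp" using h by (simp add: D_lp_def D_fol_def)
qed

lemma S_R_eq: "S_R EA f = Dlp"
proof (rule subset_antisym; rule subsetI)
  fix h assume "h \<in> S_R EA f"
  then have *: "h \<in> DT EA f" "\<And>x. x \<in> T \<Longrightarrow> f (h x) = f x" by (auto simp: S_R_def)
  then have "h \<in> Dfol" by (intro Dfol_I[of h id]) auto
  then show "h \<in> Dlp" unfolding Dlp_iff using sigma_unique[OF _ D01_id, of h] *(2) by simp
next
  fix h assume "h \<in> Dlp"
  then have "h \<in> Dfol" "sig h = id" unfolding Dlp_iff by blast+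
  then show "h \<in> S_R EA f" using sig_f[of h] Dfol_D by (auto simp: S_R_def)
qed

end

section \<open>Continuity of the induced diffeomorphism\<close>

text \<open>The compact target required by \<open>smooth_lim_compose\<close> is the closed
  \<open>e / 2\<close>-neighbourhood of the image of the limit. It is compact as a sum of compact
  sets, lies in \<open>Q\<close>, and eventually contains the images.\<close>

lemma smooth_lim_open_compose:
  fixes u :: "'i \<Rightarrow> 'a::real_normed_vector \<Rightarrow> 'b::{real_normed_vector,heine_borel}"
  assumes S: "fat S" "K \<subseteq> S" "compact K" and G: "open Q" "smooth_on Q G"
    and u: "smooth_lim n F S K u u0" "u0 ` K \<subseteq> Q"
  shows "smooth_lim n F S K (\<lambda>i x. G (u i x)) (\<lambda>x. G (u0 x))"
proof -
  note uD = smooth_lim_D[OF u(1)]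
  have "compact (u0 ` K)"
    using smooth_near_imp_continuous_on[OF uD(1) S(2), of "[]"] S(3) by (simp add: compact_continuous_image)
  then obtain e where e: "e > 0" "(\<Union>x\<in>u0 ` K. ball x e) \<subseteq> Q"
    using compact_subset_open_imp_ball_epsilon_subset[OF _ G(1) u(2)] by blast
  define K2 where "K2 = {x + y | x y. x \<in> u0 ` K \<and> y \<in> cball 0 (e / 2)}"
  have K2: "compact K2"
    unfolding K2_def using \<open>compact (u0 ` K)\<close> by (intro compact_sums) auto
  have K2Q: "K2 \<subseteq> Q"
  proof
    fix z assume "z \<in> K2"
    then obtain x y where xy: "x \<in> u0 ` K" "norm y \<le> e / 2" "z = x + y" by (auto simp: K2_def)
    then have "dist x z < e" using e(1) by (simp add: dist_norm)
    then have "z \<in> (\<Union>x\<in>u0 ` K. ball x e)" using xy(1) by (intro UN_I[of x]) simp_all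
    then show "z \<in> Q" using e(2) by (rule rev_subsetD)
  qed
  have near: "maps_near S K Q w" if "smooth_near S K w" "w ` K \<subseteq> Q" for w
  proof -
    have "maps_near S K UNIV w" unfolding maps_near_def by blast
    from near_compose_common[OF that(1) this G(1) that(2) S(2)]
    obtain P where "open P" "K \<subseteq> P" "w ` (S \<inter> P) \<subseteq> UNIV \<inter> Q" by metis
    then show ?thesis unfolding maps_near_def by blast
  qed
  have "e / 2 > 0" using e by simp
  from uniform_limitD[OF uD(3) this]
  have evK2: "\<forall>\<^sub>F i in F. u i ` K \<subseteq> K2"
  proof (rule eventually_mono)
    fix i assume *: "\<forall>x\<in>K. dist (u i x) (u0 x) < e / 2"
    show "u i ` K \<subseteq> K2"
    proof
      fix z assume "z \<in> u i ` K"
      then obtain x where x: "x \<in> K" "z = u i x" by blast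
      show "z \<in> K2" unfolding K2_def mem_Collect_eq
      proof (intro exI conjI)
        show "z = u0 x + (u i x - u0 x)" using x by simp
        show "u0 x \<in> u0 ` K" using x(1) by blast
        have "dist (u i x) (u0 x) \<le> e / 2" using x(1) * by (simp add: less_imp_le)
        then show "u i x - u0 x \<in> cball 0 (e / 2)" by (simp only: dist_norm mem_cball_0)
      qed
    qed
  qed
  have u0K2: "u0 ` K \<subseteq> K2"
  proof
    fix z assume "z \<in> u0 ` K"
    then show "z \<in> K2" unfolding K2_def mem_Collect_eq
      using e(1) by (intro exI[of _ z] exI[of _ 0] conjI) auto
  qed
  have ev: "\<forall>\<^sub>F i in F. maps_near S K Q (u i) \<and> u i ` K \<subseteq> K2"
    using uD(2) evK2 by (rule eventually_elim2) (use near K2Q in blast)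
  show ?thesis
    by (rule smooth_lim_compose[OF S K2 K2Q ev near[OF uD(1) u(2)] u0K2 u(1)
          smooth_lim_const[OF smooth_on_imp_near[OF G(2)]]])
qed

lemma smooth_lim_const_fun:
  fixes a :: "'i \<Rightarrow> 'c::real_normed_vector"
  assumes "fat S" "K \<subseteq> S" "(a \<longlongrightarrow> a0) F"
  shows "smooth_lim n F S K (\<lambda>i x. a i) (\<lambda>x. a0)"
proof -
  have sm: "smooth_near S K (\<lambda>x. b)" for b :: 'c
    by (intro smooth_on_imp_near smooth_on_const assms(1))
  have "uniform_limit K (\<lambda>i x. a i) (\<lambda>x. a0) F"
    using assms(3) unfolding uniform_limit_iff tendsto_iff by (auto elim!: eventually_mono)
  then have 0: "smooth_lim 0 F S K (\<lambda>i x. a i) (\<lambda>x. a0)"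
    using sm by (simp add: smooth_lim_0)
  have eq: "eq_near S K (\<lambda>x. 0) (nderiv S (\<lambda>x. b) [v])" for b :: 'c and v
    unfolding eq_near_def using nderiv_const[OF assms(1)] by (intro exI[of _ UNIV]) auto
  show ?thesis
  proof (cases n)
    case (Suc m)
    show ?thesis unfolding Suc
    proof (rule smooth_lim_Suc_I[OF 0])
      fix v
      show "smooth_lim m F S K (\<lambda>i. nderiv S (\<lambda>x. a i) [v]) (nderiv S (\<lambda>x. a0) [v])"
        by (rule smooth_lim_cong[OF smooth_lim_const[OF sm[of 0]] always_eventually eq assms(2)]) (intro allI eq)
    qed
  qed (use 0 in simp)
qed

text \<open>Uniform convergence on a compact set may be checked on finitely many pieces. Each piece
  may be enlarged to a set \<open>K\<close>, so that rules requiring compactness can be applied on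
  it.\<close>

lemma smooth_lim_locally:
  fixes u :: "'i \<Rightarrow> 'a::real_normed_vector \<Rightarrow> 'c::real_normed_vector"
  assumes S: "compact S" and u: "smooth_on S u0" "\<forall>\<^sub>F i in F. smooth_on S (u i)"
    and loc: "\<And>x. x \<in> S \<Longrightarrow> \<exists>Q. open Q \<and> x \<in> Q \<and> (\<exists>K. S \<inter> Q \<subseteq> K \<and> smooth_lim n F S K u u0)"
  shows "smooth_lim n F S S u u0"
  unfolding smooth_lim_def
proof (intro conjI allI impI)
  show "smooth_near S S u0" using u(1) by (rule smooth_on_imp_near)
  show "\<forall>\<^sub>F i in F. smooth_near S S (u i)" using u(2) by (rule eventually_mono) (rule smooth_on_imp_near)
  fix vs :: "'a list" assume vs: "length vs \<le> n"
  define \<Q> where "\<Q> = {Q. open Q \<and> (\<exists>K. S \<inter> Q \<subseteq> K \<and> smooth_lim n F S K u u0)}"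
  have "S \<subseteq> \<Union>\<Q>"
  proof
    fix x assume "x \<in> S"
    from loc[OF this] obtain Q where "x \<in> Q" "Q \<in> \<Q>" unfolding \<Q>_def mem_Collect_eq by metis
    then show "x \<in> \<Union>\<Q>" by blast
  qed
  moreover have "\<And>Q. Q \<in> \<Q> \<Longrightarrow> open Q" unfolding \<Q>_def by blast
  ultimately obtain \<F> where X: "\<F> \<subseteq> \<Q>" "finite \<F>" "S \<subseteq> \<Union>\<F>"
    using compactE[OF S] by metis
  have "uniform_limit (\<Union>Q\<in>\<F>. S \<inter> Q) (\<lambda>i. nderiv S (u i) vs) (nderiv S u0 vs) F"
  proof (rule uniform_limit_on_UNION[OF X(2)])
    fix Q assume "Q \<in> \<F>"
    then have "Q \<in> \<Q>" using X(1) by blast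
    then obtain K where K: "S \<inter> Q \<subseteq> K" "smooth_lim n F S K u u0" unfolding \<Q>_def by blast
    then have "uniform_limit K (\<lambda>i. nderiv S (u i) vs) (nderiv S u0 vs) F"
      using vs unfolding smooth_lim_def by blast
    then show "uniform_limit (S \<inter> Q) (\<lambda>i. nderiv S (u i) vs) (nderiv S u0 vs) F"
      using K(1) by (rule uniform_limit_on_subset)
  qed
  moreover have "S \<subseteq> (\<Union>Q\<in>\<F>. S \<inter> Q)" using X(3) by blast
  ultimately show "uniform_limit S (\<lambda>i. nderiv S (u i) vs) (nderiv S u0 vs) F"
    by (rule uniform_limit_on_subset)
qed

context tube_bundle
begin

text \<open>Chart convergence speaks of compact sets that \<open>h0\<close> sends into a single
  chart, while the image of the ray may need several. The parameter interval is therefore cut into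
  pieces; one source chart serves all of them, since the ray lies in one fibre.\<close>

lemma smooth_lim_along_ray:
  assumes h0: "smooth_map EA T EA T h0" and h: "\<forall>\<^sub>F i in F. smooth_map EA T EA T (h i)"
    and lim: "chart_lim EA T EA F h h0"
  shows "smooth_lim n F {-1..1} {-1..1} (\<lambda>i t. f (h i (ray t))) (\<lambda>t. f (h0 (ray t)))"
proof (rule smooth_lim_locally)
  show "smooth_on {-1..1} (\<lambda>t. f (h0 (ray t)))" by (rule smooth_on_along_ray[OF h0])
  show "\<forall>\<^sub>F i in F. smooth_on {-1..1} (\<lambda>t. f (h i (ray t)))"
    using h by (rule eventually_mono) (rule smooth_on_along_ray)
  fix t0 :: real assume t0: "t0 \<in> {-1..1}"
  let ?S = "{-1..1::real}"
  obtain P c where c: "(P, c) \<in> EA" "unit_pt \<in> P" by (rule EA_cover)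
  obtain V d where d: "(V, d) \<in> EA" "h0 (ray t0) \<in> V" by (rule EA_cover)
  have V: "open V" using EA_open[OF d(1)] .
  have cont: "continuous_on ?S (k \<circ> ray)" if "smooth_map EA T EA T k" for k
    using smooth_mapD(1)[OF smooth_map_along_ray[OF that]] .
  have near: "\<exists>Q. open Q \<and> ?S \<inter> (k \<circ> ray) -` V = ?S \<inter> Q" if "smooth_map EA T EA T k" for k
    using continuous_preimage_open[OF cont[OF that] V] by metis
  obtain Q where Q: "open Q" "?S \<inter> (h0 \<circ> ray) -` V = ?S \<inter> Q" using near[OF h0] by blast
  have "t0 \<in> ?S \<inter> (h0 \<circ> ray) -` V" using t0 d(2) by simp
  then have "t0 \<in> Q" unfolding Q(2) by (rule IntD2)
  then obtain e where e: "e > 0" "cball t0 e \<subseteq> Q" using Q(1) open_contains_cball by blast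
  define I where "I = ?S \<inter> cball t0 e"
  have I: "compact I" "I \<subseteq> ?S" unfolding I_def by (auto intro: compact_Int)
  define K where "K = ray ` I"
  have K: "compact K" "K \<subseteq> P \<inter> T" "h0 ` K \<subseteq> V"
  proof -
    show "compact K" unfolding K_def
      using I(1) continuous_on_subset[OF ray_continuous subset_UNIV] by (intro compact_continuous_image)
    show "K \<subseteq> P \<inter> T" unfolding K_def using ray_chart(1)[OF c] ray_T I(2) by blast
    show "h0 ` K \<subseteq> V"
    proof
      fix y assume "y \<in> h0 ` K"
      then obtain t where t: "t \<in> I" "y = h0 (ray t)" unfolding K_def by blast
      then have "t \<in> ?S \<inter> Q" using e(2) by (auto simp: I_def)
      then show "y \<in> V" unfolding Q(2)[symmetric] t(2) by simp
    qed
  qed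
  define w where "w t = (fst (c unit_pt), t *\<^sub>R snd (c unit_pt))" for t :: real
  have w: "w t = c (ray t)" for t using ray_chart(2)[OF c] by (simp add: w_def)
  have inv: "inv_into P c (w t) = ray t" for t
    unfolding w using EA_inj[OF c(1)] ray_chart(1)[OF c] by simp
  have wI: "w ` I = c ` K" unfolding K_def by (auto simp: w)
  have wS: "w ` ?S \<subseteq> c ` (P \<inter> T)" using w ray_chart(1)[OF c] ray_T by auto
  have near_w: "maps_near ?S I (c ` (P \<inter> T)) w"
    unfolding maps_near_def using wS by (intro exI[of _ UNIV]) auto
  note sl = chart_limD(2)[OF lim c(1) d(1) K, of n]
  have "smooth_lim n F ?S I (\<lambda>i t. (d \<circ> h i \<circ> inv_into P c) (w t)) (\<lambda>t. (d \<circ> h0 \<circ> inv_into P c) (w t))"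
  proof (rule smooth_lim_compose[OF fat_ray_domain I(2,1) _ _ _ near_w _ _ sl])
    show "compact (c ` K)" using compact_chart_image[OF total_atlas c(1) K(1)] K(2) by blast
    show "smooth_lim n F ?S I (\<lambda>i. w) w"
      unfolding w_def[abs_def] by (intro smooth_lim_const smooth_on_imp_near smooth_on_vertical_line fat_ray_domain)
  qed (use K(2) wI near_w in auto)
  then have 1: "smooth_lim n F ?S I (\<lambda>i t. d (h i (ray t))) (\<lambda>t. d (h0 (ray t)))"
    by (simp add: inv)
  have "(\<lambda>t. d (h0 (ray t))) ` I \<subseteq> d ` V" using K(3) unfolding K_def by blast
  from smooth_lim_open_compose[OF fat_ray_domain I(2,1) EA_image_open[OF d(1)] f_chart_smooth[OF d(1)] 1 this]
  have 2: "smooth_lim n F ?S I (\<lambda>i t. (f \<circ> inv_into V d) (d (h i (ray t)))) (\<lambda>t. (f \<circ> inv_into V d) (d (h0 (ray t))))" .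
  \<comment> \<open>Going through the chart \<open>d\<close> and back is the identity only while the
    image stays in \<open>V\<close>, so the two functions agree near \<open>I\<close> but perhaps
    not on the whole interval.\<close>
  have eq: "eq_near ?S I (\<lambda>t. (f \<circ> inv_into V d) (d (k (ray t)))) (\<lambda>t. f (k (ray t)))"
    if k: "smooth_map EA T EA T k" "k ` K \<subseteq> V" for k
  proof -
    obtain Q where Q: "open Q" "?S \<inter> (k \<circ> ray) -` V = ?S \<inter> Q" using near[OF k(1)] by blast
    have "I \<subseteq> Q"
    proof
      fix t assume "t \<in> I"
      then have "t \<in> ?S \<inter> (k \<circ> ray) -` V" using k(2) I(2) unfolding K_def by auto
      then show "t \<in> Q" using Q(2) by blast
    qed
    moreover have "(f \<circ> inv_into V d) (d (k (ray t))) = f (k (ray t))" if "t \<in> ?S \<inter> Q" for t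
    proof -
      have "k (ray t) \<in> V" using that unfolding Q(2)[symmetric] by simp
      then show ?thesis using EA_inj[OF d(1)] by simp
    qed
    ultimately show ?thesis unfolding eq_near_def using Q(1) by blast
  qed
  have "smooth_lim n F ?S I (\<lambda>i t. f (h i (ray t))) (\<lambda>t. f (h0 (ray t)))"
  proof (rule smooth_lim_cong[OF 2 _ eq[OF h0 K(3)] I(2)])
    show "\<forall>\<^sub>F i in F. eq_near ?S I (\<lambda>t. (f \<circ> inv_into V d) (d (h i (ray t)))) (\<lambda>t. f (h i (ray t)))"
      using h chart_limD(1)[OF lim c(1) d(1) K] by (rule eventually_elim2) (rule eq)
  qed
  then show "\<exists>Q. open Q \<and> t0 \<in> Q \<and> (\<exists>K. ?S \<inter> Q \<subseteq> K \<and> smooth_lim n F ?S K (\<lambda>i t. f (h i (ray t))) (\<lambda>t. f (h0 (ray t))))"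
    using e(1) by (intro exI[of _ "ball t0 e"] conjI exI[of _ I]) (auto simp: I_def)
qed simp

lemma smooth_lim_sig:
  assumes "h0 \<in> Dfol" "\<forall>\<^sub>F i in F. h i \<in> Dfol" "chart_lim EA T EA F h h0"
  shows "smooth_lim n F {0..1} {0..1} (\<lambda>i. sig (h i)) (sig h0)"
proof (rule smooth_lim_if_even)
  have ev: "\<forall>\<^sub>F i in F. smooth_map EA T EA T (h i)"
    using assms(2) by (rule eventually_mono) (rule DT_D(3)[OF Dfol_D])
  show "smooth_lim n F {-1..1} {-1..1} (\<lambda>i t. f (h i (ray t))) (\<lambda>t. f (h0 (ray t)))" for n
    by (rule smooth_lim_along_ray[OF DT_D(3)[OF Dfol_D[OF assms(1)]] ev assms(3)])
  show "\<forall>\<^sub>F i in F. \<forall>t\<in>{-1..1}. f (h i (ray t)) = sig (h i) (t\<^sup>2)"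
    using assms(2) by (rule eventually_mono) (intro ballI sig_square)
qed (rule sig_square[OF assms(1)])

section \<open>Fibrewise rescaling\<close>

lemma f_chart_maps: "(P, c) \<in> EA \<Longrightarrow> (\<lambda>y. f (inv_into P c y)) ` (c ` (P \<inter> T)) \<subseteq> {0..1}"
  using f_mem EA_inj by auto

lemma smooth_on_f_chart:
  assumes "(P, c) \<in> EA"
  shows "smooth_on (c ` (P \<inter> T)) (\<lambda>y. f (inv_into P c y))"
  using smooth_on_subset[OF f_chart_smooth[OF assms] _ tube_chart_fat[OF assms]] by (simp add: o_def image_mono)

lemma rescaling_continuous:
  assumes r: "continuous_on {0..1} r"
  shows "continuous_on T (\<lambda>x. scal (r (f x)) x)"
  unfolding continuous_on_def
proof
  fix x assume x: "x \<in> T"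
  obtain P c where c: "(P, c) \<in> EA" "x \<in> P" by (rule EA_cover)
  have cP: "continuous_on (P \<inter> T) c"
    using smooth_atlasD(5)[OF total_atlas c(1)] continuous_on_subset by blast
  have cinv: "continuous_on (c ` P) (inv_into P c)"
    using smooth_atlasD(3)[OF total_atlas c(1)] unfolding homeomorphism_def by blast
  have cr: "continuous_on (P \<inter> T) (\<lambda>x. r (f x))"
    by (rule continuous_on_compose2[OF r continuous_on_subset[OF f_continuous subset_UNIV]]) (use f_mem in blast)
  have "continuous_on (P \<inter> T) (\<lambda>x. inv_into P c (fst (c x), r (f x) *\<^sub>R snd (c x)))"
  proof (rule continuous_on_compose2[OF cinv])
    show "continuous_on (P \<inter> T) (\<lambda>x. (fst (c x), r (f x) *\<^sub>R snd (c x)))"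
      by (intro continuous_intros cP cr)
    show "(\<lambda>x. (fst (c x), r (f x) *\<^sub>R snd (c x))) ` (P \<inter> T) \<subseteq> c ` P"
      using EA_chart(4)[OF c(1) imageI] by blast
  qed
  then have "continuous_on (P \<inter> T) (\<lambda>x. scal (r (f x)) x)"
    by (rule continuous_on_eq) (simp add: inv_chart_scal[OF c(1)])
  then have "((\<lambda>x. scal (r (f x)) x) \<longlongrightarrow> scal (r (f x)) x) (at x within P \<inter> T)"
    using x c(2) unfolding continuous_on_def by blast
  moreover have "at x within P \<inter> T = at x within T"
    by (rule at_within_nhd[OF c(2) EA_open[OF c(1)]]) blast
  ultimately show "((\<lambda>x. scal (r (f x)) x) \<longlongrightarrow> scal (r (f x)) x) (at x within T)" by simp
qed

text \<open>In charts \<open>c\<close> and \<open>d\<close> the map is the transition map with its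
  fibre component multiplied by \<open>r \<circ> f\<close>.\<close>

lemma rescaling_smooth:
  assumes r: "smooth_on {0..1} r" and m: "\<And>x. x \<in> T \<Longrightarrow> m x = scal (r (f x)) x" "m ` T \<subseteq> T"
  shows "smooth_map EA T EA T m"
proof (rule smooth_mapI[OF _ m(2)])
  show cont: "continuous_on T m"
    by (rule continuous_on_eq[OF rescaling_continuous[OF smooth_on_imp_continuous[OF r]]]) (simp add: m)
  fix P c V d assume c: "(P, c) \<in> EA" and d: "(V, d) \<in> EA"
  let ?S = "c ` (P \<inter> T \<inter> m -` V)"
  have fat: "fat ?S" by (rule fat_local_domain[OF fat_domain_T c cont EA_open[OF d]])
  \<comment> \<open>Rescaling stays in the fibre, and chart domains are unions of fibres, so the
    transition map is defined at \<open>x\<close> itself.\<close>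
  have mV: "x \<in> V" if "x \<in> T" "m x \<in> V" for x using that m(1) EA_chart(2)[OF d] by simp
  have tr: "smooth_on ?S (d \<circ> inv_into P c)"
    by (rule smooth_on_subset[OF smooth_atlasD(6)[OF total_atlas c d] _ fat]) (use mV in blast)
  have fS: "smooth_on ?S (\<lambda>y. f (inv_into P c y))"
    by (rule smooth_on_subset[OF smooth_on_f_chart[OF c] _ fat]) blast
  have "(\<lambda>y. f (inv_into P c y)) ` ?S \<subseteq> {0..1}" using f_chart_maps[OF c] by blast
  then have rf: "smooth_on ?S (\<lambda>y. r (f (inv_into P c y)))"
    by (rule smooth_on_compose[OF fat fS r])
  have "smooth_on ?S (\<lambda>y. (fst ((d \<circ> inv_into P c) y), r (f (inv_into P c y)) *\<^sub>R snd ((d \<circ> inv_into P c) y)))"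
    by (intro smooth_on_Pair[OF fat] smooth_on_bilinear[OF fat bounded_bilinear_scaleR] rf
        smooth_on_linear[OF fat bounded_linear_fst tr] smooth_on_linear[OF fat bounded_linear_snd tr])
  then show "smooth_on ?S (d \<circ> m \<circ> inv_into P c)"
  proof (rule smooth_on_cong)
    fix y assume "y \<in> ?S"
    then obtain x where x: "x \<in> P" "x \<in> T" "m x \<in> V" "y = c x" by blast
    have "inv_into P c y = x" using EA_inj[OF c] x by simp
    then show "(fst ((d \<circ> inv_into P c) y), r (f (inv_into P c y)) *\<^sub>R snd ((d \<circ> inv_into P c) y))
        = (d \<circ> m \<circ> inv_into P c) y"
      using EA_chart(3)[OF d mV[OF x(2,3)]] m(1)[OF x(2)] by simp
  qed
qed

text \<open>In bundle charts rescaling is multiplication of the fibre coordinate by a function, so no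
  change of charts is needed to see that it is continuous in all its data.\<close>

lemma rescaling_lim:
  assumes h0: "smooth_map EA T EA T h0" and h: "\<forall>\<^sub>F i in F. smooth_map EA T EA T (h i)"
    and lim: "chart_lim EA T EA F h h0"
    and r: "\<And>n. smooth_lim n F {0..1} {0..1} r r0"
    and m0: "\<And>x. x \<in> T \<Longrightarrow> m0 x = scal (r0 (f x)) (h0 x)"
    and m: "\<forall>\<^sub>F i in F. \<forall>x\<in>T. m i x = scal (r i (f x)) (h i x)"
  shows "chart_lim EA T EA F m m0"
proof (rule chart_limI)
  fix P c V d K
  assume c: "(P, c) \<in> EA" and d: "(V, d) \<in> EA" and K: "compact K" "K \<subseteq> P \<inter> T" "m0 ` K \<subseteq> V"
  have KT: "x \<in> T" if "x \<in> K" for x using K(2) that by blast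
  \<comment> \<open>\<open>m0 x\<close> and \<open>h0 x\<close> lie in the same fibre, so the chart
    that receives one receives the other, and the pair of charts tested for \<open>m0\<close> can be
    used for \<open>h0\<close>.\<close>
  have h0K: "h0 ` K \<subseteq> V"
  proof
    fix y assume "y \<in> h0 ` K"
    then obtain x where "x \<in> K" "y = h0 x" by blast
    then show "y \<in> V" using K(3) m0[OF KT] EA_chart(2)[OF d] by (metis image_subset_iff)
  qed
  let ?S = "c ` (P \<inter> T)"
  have fat: "fat ?S" by (rule tube_chart_fat[OF c])
  note hK = chart_limD(1)[OF lim c d K(1,2) h0K]
  note sl = chart_limD(2)[OF lim c d K(1,2) h0K]
  have cK: "compact (c ` K)" "c ` K \<subseteq> ?S"
    using compact_chart_image[OF total_atlas c K(1)] K(2) by blast+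
  have eq: "eq_near ?S (c ` K)
      (\<lambda>y. (fst ((d \<circ> k \<circ> inv_into P c) y), s (f (inv_into P c y)) *\<^sub>R snd ((d \<circ> k \<circ> inv_into P c) y)))
      (d \<circ> q \<circ> inv_into P c)"
    if k: "smooth_map EA T EA T k" "k ` K \<subseteq> V" and q: "\<And>x. x \<in> T \<Longrightarrow> q x = scal (s (f x)) (k x)" for k s q
  proof -
    obtain Q where Q: "open Q" "c ` (P \<inter> T \<inter> k -` V) = ?S \<inter> Q"
      using smooth_map_local_domain[OF total_atlas c smooth_mapD(1)[OF k(1)] EA_open[OF d]] .
    have "c ` K \<subseteq> Q"
    proof -
      have "c ` K \<subseteq> c ` (P \<inter> T \<inter> k -` V)" using K(2) k(2) by blast
      then show ?thesis using Q(2) by blast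
    qed
    moreover have "(fst ((d \<circ> k \<circ> inv_into P c) y), s (f (inv_into P c y)) *\<^sub>R snd ((d \<circ> k \<circ> inv_into P c) y))
        = (d \<circ> q \<circ> inv_into P c) y" if "y \<in> ?S \<inter> Q" for y
    proof -
      have "y \<in> c ` (P \<inter> T \<inter> k -` V)" using that Q(2) by blast
      then obtain x where x: "x \<in> P" "x \<in> T" "k x \<in> V" "y = c x" by blast
      have "inv_into P c y = x" using EA_inj[OF c] x by simp
      then show ?thesis using EA_chart(3)[OF d x(3)] q[OF x(2)] by simp
    qed
    ultimately show ?thesis unfolding eq_near_def using Q(1) by blast
  qed
  have rf: "smooth_lim n F ?S (c ` K) (\<lambda>i y. r i (f (inv_into P c y))) (\<lambda>y. r0 (f (inv_into P c y)))" for n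
  proof (rule smooth_lim_compose[OF fat cK(2,1) compact_Icc subset_refl _ _ _ _ r])
    have "maps_near ?S (c ` K) {0..1} (\<lambda>y. f (inv_into P c y))"
      unfolding maps_near_def using f_chart_maps[OF c] by (intro exI[of _ UNIV]) auto
    moreover have "(\<lambda>y. f (inv_into P c y)) ` (c ` K) \<subseteq> {0..1}"
      using f_chart_maps[OF c] image_mono[OF cK(2)] by (rule subset_trans[rotated])
    ultimately show "maps_near ?S (c ` K) {0..1} (\<lambda>y. f (inv_into P c y))"
      "(\<lambda>y. f (inv_into P c y)) ` (c ` K) \<subseteq> {0..1}"
      "\<forall>\<^sub>F i in F. maps_near ?S (c ` K) {0..1} (\<lambda>y. f (inv_into P c y)) \<and> (\<lambda>y. f (inv_into P c y)) ` (c ` K) \<subseteq> {0..1}"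
      by simp_all
    show "smooth_lim n F ?S (c ` K) (\<lambda>i y. f (inv_into P c y)) (\<lambda>y. f (inv_into P c y))"
      by (intro smooth_lim_const smooth_on_imp_near smooth_on_f_chart c)
  qed
  have main: "smooth_lim n F ?S (c ` K)
      (\<lambda>i y. (fst ((d \<circ> h i \<circ> inv_into P c) y), r i (f (inv_into P c y)) *\<^sub>R snd ((d \<circ> h i \<circ> inv_into P c) y)))
      (\<lambda>y. (fst ((d \<circ> h0 \<circ> inv_into P c) y), r0 (f (inv_into P c y)) *\<^sub>R snd ((d \<circ> h0 \<circ> inv_into P c) y)))" for n
    by (intro smooth_lim_Pair[OF fat cK(2)] smooth_lim_bilinear[OF fat bounded_bilinear_scaleR cK(2,1)] rf
        smooth_lim_linear[OF fat bounded_linear_fst cK(2) sl] smooth_lim_linear[OF fat bounded_linear_snd cK(2) sl])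
  have hm: "\<forall>\<^sub>F i in F. smooth_map EA T EA T (h i) \<and> h i ` K \<subseteq> V \<and> (\<forall>x\<in>T. m i x = scal (r i (f x)) (h i x))"
    using h hK m by eventually_elim blast
  have "smooth_lim n F ?S (c ` K) (\<lambda>i. d \<circ> m i \<circ> inv_into P c) (d \<circ> m0 \<circ> inv_into P c)" for n
  proof (rule smooth_lim_cong[OF main _ eq[OF h0 h0K m0] cK(2)])
    show "\<forall>\<^sub>F i in F. eq_near ?S (c ` K)
      (\<lambda>y. (fst ((d \<circ> h i \<circ> inv_into P c) y), r i (f (inv_into P c y)) *\<^sub>R snd ((d \<circ> h i \<circ> inv_into P c) y)))
      (d \<circ> m i \<circ> inv_into P c)"
      using hm by (rule eventually_mono) (rule eq, blast+)
  qed
  moreover have "\<forall>\<^sub>F i in F. m i ` K \<subseteq> V"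
    using hm
  proof (rule eventually_mono)
    fix i assume i: "smooth_map EA T EA T (h i) \<and> h i ` K \<subseteq> V \<and> (\<forall>x\<in>T. m i x = scal (r i (f x)) (h i x))"
    show "m i ` K \<subseteq> V"
    proof
      fix y assume "y \<in> m i ` K"
      then obtain x where x: "x \<in> K" "y = m i x" by blast
      then have "h i x \<in> V" "y = scal (r i (f x)) (h i x)" using i KT[OF x(1)] by blast+
      then show "y \<in> V" using EA_chart(2)[OF d] by simp
    qed
  qed
  ultimately show "(\<forall>\<^sub>F i in F. m i ` K \<subseteq> V) \<and>
      (\<forall>n. smooth_lim n F ?S (c ` K) (\<lambda>i. d \<circ> m i \<circ> inv_into P c) (d \<circ> m0 \<circ> inv_into P c))" by blast
qed

section \<open>The section \<open>\<theta>\<close>\<close>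

abbreviation \<theta> where "\<theta> \<equiv> theta_map scal f"

lemma theta_T: "x \<in> T \<Longrightarrow> \<theta> \<phi> x = scal (sqrt (g_fun \<phi> (f x))) x"
  by (simp add: theta_map_def)

lemma f_theta:
  assumes "\<phi> \<in> D01_plus" "x \<in> T"
  shows "f (\<theta> \<phi> x) = \<phi> (f x)"
  using g_fun_pos[OF assms(1) f_mem[OF assms(2)]] g_fun_mult[OF assms(1) f_mem[OF assms(2)]]
  by (simp add: theta_T[OF assms(2)] f_scal_real mult.commute)

lemma theta_mem:
  assumes "\<phi> \<in> D01_plus" "x \<in> T"
  shows "\<theta> \<phi> x \<in> T"
  using D01_D(5)[OF D01_plus_imp_D01[OF assms(1)] f_mem[OF assms(2)]] f_theta[OF assms]
  by (simp add: T_iff)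

text \<open>Off the zero section this is \<open>g_fun_comp\<close> under the square root; where
  \<open>f x = 0\<close>, both sides are \<open>x\<close>.\<close>

lemma theta_comp:
  assumes "\<phi> \<in> D01_plus" "\<eta> \<in> D01_plus"
  shows "\<theta> (\<phi> \<circ> \<eta>) = \<theta> \<phi> \<circ> \<theta> \<eta>"
proof
  fix x
  show "\<theta> (\<phi> \<circ> \<eta>) x = (\<theta> \<phi> \<circ> \<theta> \<eta>) x"
  proof (cases "x \<in> T")
    case True
    have *: "(\<theta> \<phi> \<circ> \<theta> \<eta>) x = scal (sqrt (g_fun \<phi> (\<eta> (f x)))) (scal (sqrt (g_fun \<eta> (f x))) x)"
      using theta_T[OF theta_mem[OF assms(2) True]] f_theta[OF assms(2) True] theta_T[OF True] by simp
    show ?thesis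
    proof (cases "f x = 0")
      case True
      then show ?thesis unfolding * theta_T[OF \<open>x \<in> T\<close>] by (simp add: scal_zero_section)
    next
      case False
      then show ?thesis unfolding * theta_T[OF True]
        by (simp add: g_fun_comp[OF assms f_mem[OF True]] real_sqrt_mult)
    qed
  qed (simp add: theta_map_def)
qed

lemma theta_id: "\<theta> id = id"
proof
  fix x
  show "\<theta> id x = id x"
  proof (cases "x \<in> T \<and> f x \<noteq> 0")
    case True
    then show ?thesis using g_fun_eq_quotient[OF D01_plus_id f_mem, of x] by (simp add: theta_T)
  qed (auto simp: theta_map_def scal_zero_section)
qed

lemma theta_inv:
  assumes "\<phi> \<in> D01_plus"
  shows "\<theta> (inv_into UNIV \<phi>) \<circ> \<theta> \<phi> = id" "\<theta> \<phi> \<circ> \<theta> (inv_into UNIV \<phi>) = id"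
proof -
  have b: "bij \<phi>" using D01_D(2)[OF D01_plus_imp_D01[OF assms]] .
  have "inv_into UNIV \<phi> \<circ> \<phi> = id" "\<phi> \<circ> inv_into UNIV \<phi> = id"
    using b by (auto simp: bij_is_inj bij_is_surj surj_f_inv_f)
  then show "\<theta> (inv_into UNIV \<phi>) \<circ> \<theta> \<phi> = id" "\<theta> \<phi> \<circ> \<theta> (inv_into UNIV \<phi>) = id"
    using theta_comp[OF D01_plus_inv[OF assms] assms] theta_comp[OF assms D01_plus_inv[OF assms]] theta_id
    by simp_all
qed

lemma smooth_on_sqrt_g_fun:
  assumes "\<phi> \<in> D01_plus"
  shows "smooth_on {0..1} (\<lambda>s. sqrt (g_fun \<phi> s))"
  by (rule smooth_on_compose[OF fat_unit smooth_on_g_fun[OF D01_D(3)[OF D01_plus_imp_D01[OF assms]]] smooth_on_sqrt])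
    (use g_fun_pos[OF assms] in blast)

lemma theta_smooth:
  assumes "\<phi> \<in> D01_plus"
  shows "smooth_map EA T EA T (\<theta> \<phi>)"
  by (rule rescaling_smooth[OF smooth_on_sqrt_g_fun[OF assms] theta_T]) (use theta_mem[OF assms] in blast)+

lemma theta_DT:
  assumes "\<phi> \<in> D01_plus"
  shows "\<theta> \<phi> \<in> DT EA f"
proof -
  note inv = theta_inv[OF assms, unfolded fun_eq_iff o_apply id_apply, rule_format]
  have bij: "bij (\<theta> \<phi>)" using inv by (intro bijI') metis+
  have "\<theta> \<phi> x = x" if "x \<notin> T" for x using that by (simp add: theta_map_def)
  then have "\<theta> \<phi> permutes T" using bij unfolding permutes_def bij_iff by blast
  moreover have "inv_into UNIV (\<theta> \<phi>) = \<theta> (inv_into UNIV \<phi>)"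
    by (rule inv_equality) (use inv in blast)+
  ultimately show ?thesis
    unfolding DT_def diffeos_def mem_Collect_eq using theta_smooth[OF assms] theta_smooth[OF D01_plus_inv[OF assms]] by simp
qed

lemma theta_Dfol:
  assumes "\<phi> \<in> D01_plus"
  shows "\<theta> \<phi> \<in> Dfol"
proof (rule Dfol_I[OF theta_DT[OF assms] f_theta[OF assms]])
  show "inj_on \<phi> {0..1}"
    using D01_D(2)[OF D01_plus_imp_D01[OF assms]] by (metis bij_def inj_on_subset subset_UNIV)
qed

lemma sig_theta: "\<phi> \<in> D01_plus \<Longrightarrow> sig (\<theta> \<phi>) = \<phi>"
  using sigma_unique[OF theta_Dfol D01_plus_imp_D01] f_theta by metis

section \<open>The deformation\<close>

text \<open>The factor is evaluated at \<open>f x\<close> and involves \<open>h\<close> through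
  \<open>sig h\<close> only, so its continuity in \<open>h\<close> reduces to that of
  \<open>sig\<close>. The last branch makes \<open>deform (0, h) = h\<close> true for every
  function, since \<open>homotopic_with\<close> asks for this equation on the whole type.\<close>

definition deform :: "real \<times> ('e \<Rightarrow> 'e) \<Rightarrow> 'e \<Rightarrow> 'e" where
  "deform = (\<lambda>(a, h). if h \<in> Dfol then (\<lambda>x. if x \<in> T
     then scal (sqrt (1 - a + a * inverse (g_fun (sig h) (f x)))) (h x) else x) else h)"

abbreviation convex_inv :: "real \<Rightarrow> (real \<Rightarrow> real) \<Rightarrow> real \<Rightarrow> real" where
  "convex_inv a \<phi> \<equiv> (\<lambda>s. if s \<in> {0..1} then (1 - a) * s + a * inv_into UNIV \<phi> s else s)"

text \<open>With \<open>\<phi> = sig h\<close> and \<open>s = f (h x) = \<phi> (f x)\<close>, the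
  quotient of the convex combination at \<open>s\<close> is \<open>1 - a + a * (f x / s)\<close>,
  and \<open>f x / s\<close> is the reciprocal of \<open>g_fun \<phi> (f x)\<close>. Membership in
  the group is taken from this form, continuity from the definition.\<close>

lemma deform_eq:
  assumes h: "h \<in> Dfol" and a: "a \<in> {0..1}"
  shows "deform (a, h) = \<theta> (convex_inv a (sig h)) \<circ> h"
proof
  fix x
  let ?\<phi> = "sig h" and ?\<eta> = "convex_inv a (sig h)"
  have \<phi>: "?\<phi> \<in> D01_plus" by (rule sig_D01_plus[OF h])
  have \<eta>: "?\<eta> \<in> D01_plus" by (rule D01_plus_convex[OF D01_plus_inv[OF \<phi>] a])
  show "deform (a, h) x = (\<theta> ?\<eta> \<circ> h) x"
  proof (cases "x \<in> T")
    case True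
    note hx = DT_D(5)[OF Dfol_D[OF h] True]
    have fh: "f (h x) = ?\<phi> (f x)" using sig_f[OF h True] by simp
    have g: "f x * g_fun ?\<phi> (f x) = ?\<phi> (f x)" "g_fun ?\<phi> (f x) > 0"
      using g_fun_mult[OF \<phi> f_mem[OF True]] g_fun_pos[OF \<phi> f_mem[OF True]] by blast+
    have "scal (sqrt (1 - a + a * inverse (g_fun ?\<phi> (f x)))) (h x) = scal (sqrt (g_fun ?\<eta> (f (h x)))) (h x)"
    proof (cases "f x = 0")
      case True
      then have "f (h x) = 0" using fh g(1) by simp
      then show ?thesis by (simp add: scal_zero_section)
    next
      case False
      have nz: "f (h x) \<noteq> 0" unfolding fh g(1)[symmetric] using False g(2) by simp
      have "inv_into UNIV ?\<phi> (f (h x)) = f x"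
        unfolding fh using D01_D(2)[OF D01_plus_imp_D01[OF \<phi>]] by (simp add: bij_is_inj)
      then have "g_fun ?\<eta> (f (h x)) = ((1 - a) * f (h x) + a * f x) / f (h x)"
        using g_fun_eq_quotient[OF \<eta> f_mem[OF hx] nz] f_mem[OF hx] by simp
      also have "\<dots> = 1 - a + a * (f x / f (h x))" using nz by (simp add: field_simps)
      also have "f x / f (h x) = inverse (g_fun ?\<phi> (f x))"
        unfolding fh g(1)[symmetric] using False g(2) by (simp add: field_simps)
      finally show ?thesis by simp
    qed
    then show ?thesis using h True theta_T[OF hx] by (simp add: deform_def)
  next
    case False
    then show ?thesis using h DT_D(6)[OF Dfol_D[OF h] False] by (simp add: deform_def theta_map_def)
  qed
qed

lemma deform_Dfol:
  assumes "h \<in> Dfol" "a \<in> {0..1}"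
  shows "deform (a, h) \<in> Dfol" "sig (deform (a, h)) = convex_inv a (sig h) \<circ> sig h"
proof -
  have \<eta>: "convex_inv a (sig h) \<in> D01_plus"
    by (rule D01_plus_convex[OF D01_plus_inv[OF sig_D01_plus[OF assms(1)]] assms(2)])
  show "deform (a, h) \<in> Dfol" "sig (deform (a, h)) = convex_inv a (sig h) \<circ> sig h"
    unfolding deform_eq[OF assms]
    using Dfol_comp[OF theta_Dfol[OF \<eta>] assms(1)] sig_comp[OF theta_Dfol[OF \<eta>] assms(1)] sig_theta[OF \<eta>] by simp_all
qed

lemma deform_0: "deform (0, h) = h"
proof (cases "h \<in> Dfol")
  case True
  then show ?thesis using DT_D(6)[OF Dfol_D[OF True]] by (auto simp: deform_def fun_eq_iff)
qed (simp add: deform_def)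

text \<open>At \<open>a = 1\<close> the map \<open>sig h\<close> is composed with its own
  inverse.\<close>

lemma deform_1:
  assumes "h \<in> Dfol"
  shows "deform (1, h) \<in> Dlp"
proof -
  have "convex_inv 1 (sig h) \<circ> sig h = id"
  proof
    fix s
    have "inv_into UNIV (sig h) (sig h s) = s"
      using D01_D(2)[OF sig_D01[OF assms]] by (simp add: bij_is_inj)
    moreover have "sig h s = s" if "sig h s \<notin> {0..1}"
      using that D01_D(5,6)[OF sig_D01[OF assms], of s] by blast
    ultimately show "(convex_inv 1 (sig h) \<circ> sig h) s = id s" by auto
  qed
  then show ?thesis unfolding Dlp_iff using deform_Dfol[OF assms, of 1] by simp
qed

lemma deform_Dlp:
  assumes "h \<in> Dlp" "a \<in> {0..1}"
  shows "deform (a, h) = h"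
proof
  fix x
  have h: "h \<in> Dfol" "sig h = id" using assms(1) unfolding Dlp_iff by blast+
  show "deform (a, h) x = h x"
  proof (cases "x \<in> T")
    case True
    show ?thesis
    proof (cases "f x = 0")
      case True
      then have "f (h x) = 0" using sig_f[OF h(1) \<open>x \<in> T\<close>] h(2) by simp
      then show ?thesis using h by (simp add: deform_def scal_zero_section \<open>x \<in> T\<close>)
    next
      case False
      have "g_fun id (f x) = 1" using g_fun_eq_quotient[OF D01_plus_id f_mem[OF True] False] False by simp
      then show ?thesis using h True by (simp add: deform_def)
    qed
  next
    case False
    then show ?thesis using h DT_D(6)[OF Dfol_D[OF h(1)] False] by (simp add: deform_def)
  qed
qed

text \<open>Since \<open>sig h\<close> fixes 1, \<open>g_fun (sig h) 1 = 1\<close>, and the factor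
  on the boundary is the square root of \<open>1 - a + a\<close>.\<close>

lemma deform_boundary:
  assumes "h \<in> D_fol_bd EA f" "a \<in> {0..1}"
  shows "deform (a, h) \<in> D_fol_bd EA f"
proof -
  have h: "h \<in> Dfol" "\<And>x. f x = 1 \<Longrightarrow> h x = x" using assms(1) by (auto simp: D_fol_bd_def)
  have "deform (a, h) x = x" if x: "f x = 1" for x
  proof -
    have "g_fun (sig h) 1 = 1"
      using g_fun_mult[OF sig_D01_plus[OF h(1)], of 1] D01_plus_ends(2)[OF sig_D01_plus[OF h(1)]] by simp
    then show ?thesis using h x T_iff[of x] by (simp add: deform_def)
  qed
  then show ?thesis using deform_Dfol(1)[OF h(1) assms(2)] by (simp add: D_fol_bd_def)
qed

lemma D_lp_bd_eq: "D_lp_bd EA f = Dlp \<inter> D_fol_bd EA f"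
  using Dlp_iff by (auto simp: D_lp_bd_def D_fol_bd_def)

section \<open>Topologies\<close>

text \<open>The hypothesis is applied to the filter \<open>atin X x\<close> alone, but a statement
  for all filters passes through products and subspaces unchanged.\<close>

lemma continuous_map_limI:
  assumes "\<And>x F. limitin X (\<lambda>y. y) x F \<Longrightarrow> limitin Y g (g x) F"
  shows "continuous_map X Y g"
  unfolding continuous_map_atin
proof
  fix x assume "x \<in> topspace X"
  then have "limitin X (\<lambda>y. y) x (atin X x)"
    by (intro limitin_continuous_map[where f = "\<lambda>y. y"]) (simp_all add: continuous_map_id[unfolded id_def])
  then show "limitin Y g (g x) (atin X x)" by (rule assms)
qed

lemma limitin_D01_iff:
  assumes "G \<subseteq> D01"
  shows "limitin (D01_topology G) u u0 F \<longleftrightarrow>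
    u0 \<in> G \<and> (\<forall>\<^sub>F i in F. u i \<in> G) \<and> (\<forall>n. smooth_lim n F {0..1} {0..1} u u0)"
proof -
  have *: "\<phi> ` {0..1} \<subseteq> {0..1}" if "\<phi> \<in> G" for \<phi>
    using D01_D(7)[of \<phi>] assms that by blast
  have "(\<forall>\<^sub>F i in F. u i ` {0..1} \<subseteq> {0..1})" if "\<forall>\<^sub>F i in F. u i \<in> G"
    using that by (rule eventually_mono) (rule *)
  then show ?thesis
    unfolding D01_topology_def limitin_subtopology limitin_line_iff[OF zero_less_one] using * by blast
qed

lemma limitin_DT_iff:
  assumes "G \<subseteq> DT EA f"
  shows "limitin (DT_topology EA f G) u u0 F \<longleftrightarrow>
    u0 \<in> G \<and> (\<forall>\<^sub>F i in F. u i \<in> G) \<and> chart_lim EA T EA F u u0"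
proof -
  have *: "smooth_map EA T EA T h" if "h \<in> G" for h using DT_D(3) assms that by blast
  have "\<forall>\<^sub>F i in F. smooth_map EA T EA T (u i)" if "\<forall>\<^sub>F i in F. u i \<in> G"
    using that by (rule eventually_mono) (rule *)
  then show ?thesis
    unfolding DT_topology_def limitin_subtopology limitin_cinf_iff[OF fat_domain_T total_atlas] using * by blast
qed

lemma topspace_DT:
  assumes "G \<subseteq> DT EA f"
  shows "topspace (DT_topology EA f G) = G"
proof -
  have "smooth_map EA T EA T h" if "h \<in> G" for h using DT_D(3) assms that by blast
  then show ?thesis
    unfolding DT_topology_def topspace_subtopology topspace_cinf_topology[OF total_atlas total_atlas] by blast
qed

lemma subset_DT: "Dfol \<subseteq> DT EA f" "Dlp \<subseteq> DT EA f" "S_R EA f \<subseteq> DT EA f" "Dlp \<subseteq> Dfol"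
  using Dfol_D Dlp_iff S_R_eq by blast+

lemma D01_plus_subset: "D01_plus \<subseteq> D01"
  using D01_plus_imp_D01 by blast

lemma limitin_S_LR_iff:
  "limitin (S_LR_topology EA f) u u0 F \<longleftrightarrow>
    u0 \<in> S_LR EA f \<and> (\<forall>\<^sub>F i in F. u i \<in> S_LR EA f) \<and>
    limitin (D01_topology D01) (fst \<circ> u) (fst u0) F \<and> limitin (DT_topology EA f (DT EA f)) (snd \<circ> u) (snd u0) F"
  unfolding S_LR_topology_def limitin_subtopology limitin_pairwise by blast

section \<open>Convergence of \<open>\<sigma>\<close>, \<open>\<theta>\<close> and the
  deformation\<close>

lemma sig_lim:
  assumes "limitin (DT_topology EA f Dfol) u u0 F"
  shows "limitin (D01_topology D01_plus) (\<lambda>i. sig (u i)) (sig u0) F"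
proof -
  have *: "u0 \<in> Dfol" "\<forall>\<^sub>F i in F. u i \<in> Dfol" "chart_lim EA T EA F u u0"
    using assms unfolding limitin_DT_iff[OF subset_DT(1)] by blast+
  have "\<forall>\<^sub>F i in F. sig (u i) \<in> D01_plus" using *(2) by (rule eventually_mono) (rule sig_D01_plus)
  then show ?thesis
    unfolding limitin_D01_iff[OF D01_plus_subset] using sig_D01_plus[OF *(1)] smooth_lim_sig[OF *] by blast
qed

lemma sigma_continuous: "continuous_map (DT_topology EA f Dfol) (D01_topology D01_plus) (sigma_map f)"
proof (rule continuous_map_eq)
  show "continuous_map (DT_topology EA f Dfol) (D01_topology D01_plus) sig"
    by (rule continuous_map_limI) (rule sig_lim)
qed (simp add: topspace_DT[OF subset_DT(1)] sigma_map_eq)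

lemma smooth_lim_sqrt:
  fixes u0 :: "real \<Rightarrow> real"
  assumes "\<And>s. s \<in> {0..1} \<Longrightarrow> u0 s > 0" "smooth_lim n F {0..1} {0..1} u u0"
  shows "smooth_lim n F {0..1} {0..1} (\<lambda>i s. sqrt (u i s)) (\<lambda>s. sqrt (u0 s))"
  by (rule smooth_lim_open_compose[OF fat_unit subset_refl compact_Icc _ smooth_on_sqrt assms(2)])
    (use assms(1) in auto)

text \<open>\<open>\<theta>\<close> gives rescalings of the identity, so
  \<open>rescaling_lim\<close> is applied to the constant family \<open>id\<close>; positivity of
  the limit keeps the square root smooth.\<close>

lemma theta_lim:
  assumes "limitin (D01_topology D01_plus) u u0 F"
  shows "limitin (DT_topology EA f Dfol) (\<lambda>i. \<theta> (u i)) (\<theta> u0) F"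
proof -
  have *: "u0 \<in> D01_plus" "\<forall>\<^sub>F i in F. u i \<in> D01_plus" "\<And>n. smooth_lim n F {0..1} {0..1} u u0"
    using assms unfolding limitin_D01_iff[OF D01_plus_subset] by blast+
  have id: "smooth_map EA T EA T id" by (rule smooth_map_id[OF fat_domain_T])
  have lim_id: "chart_lim EA T EA F (\<lambda>i. id) id"
  proof -
    have "limitin (cinf_topology EA T EA T) (\<lambda>i. id) id F"
      by (rule limitin_eventually) (use id in \<open>simp_all add: topspace_cinf_topology[OF total_atlas total_atlas]\<close>)
    then show ?thesis unfolding limitin_cinf_iff[OF fat_domain_T total_atlas] by blast
  qed
  have "chart_lim EA T EA F (\<lambda>i. \<theta> (u i)) (\<theta> u0)"
  proof (rule rescaling_lim[OF id always_eventually lim_id])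
    show "smooth_lim n F {0..1} {0..1} (\<lambda>i s. sqrt (g_fun (u i) s)) (\<lambda>s. sqrt (g_fun u0 s))" for n
      by (rule smooth_lim_sqrt[OF g_fun_pos[OF *(1)] smooth_lim_g_fun[OF *(3)]])
  qed (use id in \<open>auto simp: theta_T\<close>)
  moreover have "\<forall>\<^sub>F i in F. \<theta> (u i) \<in> Dfol" using *(2) by (rule eventually_mono) (rule theta_Dfol)
  ultimately show ?thesis unfolding limitin_DT_iff[OF subset_DT(1)] using theta_Dfol[OF *(1)] by blast
qed

text \<open>The factor stays positive in the limit, also for \<open>a0 = 0\<close> and
  \<open>a0 = 1\<close>, so reciprocal and square root are applied where they are smooth.\<close>

lemma deform_lim:
  assumes h: "limitin (DT_topology EA f Dfol) h h0 F"
    and a: "(a \<longlongrightarrow> a0) F" "a0 \<in> {0..1}" "\<forall>\<^sub>F i in F. a i \<in> {0..1}"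
  shows "limitin (DT_topology EA f Dfol) (\<lambda>i. deform (a i, h i)) (deform (a0, h0)) F"
proof -
  have *: "h0 \<in> Dfol" "\<forall>\<^sub>F i in F. h i \<in> Dfol" "chart_lim EA T EA F h h0"
    using h unfolding limitin_DT_iff[OF subset_DT(1)] by blast+
  have hs: "\<forall>\<^sub>F i in F. smooth_map EA T EA T (h i)"
    using *(2) by (rule eventually_mono) (rule DT_D(3)[OF Dfol_D])
  note gpos = g_fun_pos[OF sig_D01_plus[OF *(1)]]
  have r: "smooth_lim n F {0..1} {0..1}
      (\<lambda>i s. sqrt (1 - a i + a i * inverse (g_fun (sig (h i)) s)))
      (\<lambda>s. sqrt (1 - a0 + a0 * inverse (g_fun (sig h0) s)))" for n
  proof (rule smooth_lim_sqrt)
    fix s :: real assume "s \<in> {0..1}"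
    from gpos[OF this] show "1 - a0 + a0 * inverse (g_fun (sig h0) s) > 0"
      using a(2) by (cases "a0 = 0") (auto intro!: add_nonneg_pos)
  next
    have g: "smooth_lim n F {0..1} {0..1} (\<lambda>i. g_fun (sig (h i))) (g_fun (sig h0))"
      by (rule smooth_lim_g_fun[OF smooth_lim_sig[OF *]])
    have ginv: "smooth_lim n F {0..1} {0..1} (\<lambda>i s. inverse (g_fun (sig (h i)) s)) (\<lambda>s. inverse (g_fun (sig h0) s))"
      by (rule smooth_lim_open_compose[OF fat_unit subset_refl compact_Icc _ smooth_on_inverse g])
        (use gpos in auto)
    have c: "smooth_lim n F {0..1} {0..1} (\<lambda>i s::real. a i) (\<lambda>s. a0)"
      "smooth_lim n F {0..1} {0..1} (\<lambda>i s::real. 1 - a i) (\<lambda>s. 1 - a0)"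
      by (rule smooth_lim_const_fun[OF fat_unit subset_refl], intro tendsto_intros a(1))+
    show "smooth_lim n F {0..1} {0..1} (\<lambda>i s. 1 - a i + a i * inverse (g_fun (sig (h i)) s))
      (\<lambda>s. 1 - a0 + a0 * inverse (g_fun (sig h0) s))"
      by (intro smooth_lim_add[OF fat_unit subset_refl] c ginv
          smooth_lim_bilinear[OF fat_unit bounded_bilinear_mult subset_refl compact_Icc])
  qed
  have "chart_lim EA T EA F (\<lambda>i. deform (a i, h i)) (deform (a0, h0))"
  proof (rule rescaling_lim[OF DT_D(3)[OF Dfol_D[OF *(1)]] hs *(3) r])
    show "\<forall>\<^sub>F i in F. \<forall>x\<in>T. deform (a i, h i) x =
        scal (sqrt (1 - a i + a i * inverse (g_fun (sig (h i)) (f x)))) (h i x)"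
      using *(2) by (rule eventually_mono) (simp add: deform_def)
  qed (simp add: deform_def *(1))
  moreover have "\<forall>\<^sub>F i in F. deform (a i, h i) \<in> Dfol"
    using *(2) a(3) by (rule eventually_elim2) (rule deform_Dfol(1))
  ultimately show ?thesis unfolding limitin_DT_iff[OF subset_DT(1)] using deform_Dfol(1)[OF *(1) a(2)] by blast
qed

lemma deform_continuous:
  "continuous_map (prod_topology (top_of_set {0..1}) (DT_topology EA f Dfol)) (DT_topology EA f Dfol) deform"
proof (rule continuous_map_limI)
  fix x and F :: "(real \<times> ('e \<Rightarrow> 'e)) filter"
  assume "limitin (prod_topology (top_of_set {0..1}) (DT_topology EA f Dfol)) (\<lambda>y. y) x F"
  then have 1: "limitin (top_of_set {0..1}) fst (fst x) F" and 2: "limitin (DT_topology EA f Dfol) snd (snd x) F"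
    unfolding limitin_pairwise by (simp_all add: o_def)
  from 1 have "(fst \<longlongrightarrow> fst x) F" "fst x \<in> {0..1}" "\<forall>\<^sub>F i in F. fst i \<in> {0..1}"
    unfolding limitin_subtopology by (simp_all add: limitin_canonical_iff)
  from deform_lim[OF 2 this] show "limitin (DT_topology EA f Dfol) deform (deform x) F" by simp
qed

lemma deformation_retract:
  "strong_deformation_retract_pair Dlp (D_lp_bd EA f) (DT_topology EA f Dfol) (D_fol_bd EA f)"
  unfolding strong_deformation_retract_pair_def topspace_DT[OF subset_DT(1)]
proof (intro conjI)
  show "Dlp \<subseteq> Dfol" by (rule subset_DT(4))
  show "D_fol_bd EA f \<subseteq> Dfol" by (auto simp: D_fol_bd_def)
  show "D_lp_bd EA f \<subseteq> Dlp \<inter> D_fol_bd EA f" unfolding D_lp_bd_eq by blast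
  show "\<exists>r. r ` Dfol \<subseteq> Dlp \<and> r ` D_fol_bd EA f \<subseteq> D_lp_bd EA f \<and>
      homotopic_with (\<lambda>k. k ` D_fol_bd EA f \<subseteq> D_fol_bd EA f \<and> (\<forall>a\<in>Dlp. k a = a))
        (DT_topology EA f Dfol) (DT_topology EA f Dfol) id r"
  proof (intro exI conjI)
    show "(\<lambda>h. deform (1, h)) ` Dfol \<subseteq> Dlp" using deform_1 by blast
    show "(\<lambda>h. deform (1, h)) ` D_fol_bd EA f \<subseteq> D_lp_bd EA f"
      unfolding D_lp_bd_eq using deform_1 deform_boundary[of _ 1] by (auto simp: D_fol_bd_def)
    show "homotopic_with (\<lambda>k. k ` D_fol_bd EA f \<subseteq> D_fol_bd EA f \<and> (\<forall>a\<in>Dlp. k a = a))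
        (DT_topology EA f Dfol) (DT_topology EA f Dfol) id (\<lambda>h. deform (1, h))"
      unfolding homotopic_with_def
    proof (intro exI conjI allI ballI)
      show "continuous_map (prod_topology (top_of_set {0..1}) (DT_topology EA f Dfol)) (DT_topology EA f Dfol) deform"
        by (rule deform_continuous)
      fix a :: real assume a: "a \<in> {0..1}"
      show "(\<lambda>h. deform (a, h)) ` D_fol_bd EA f \<subseteq> D_fol_bd EA f" using deform_boundary a by blast
      fix h assume "h \<in> Dlp"
      then show "deform (a, h) = h" using deform_Dlp a by blast
    qed (simp_all add: deform_0)
  qed
qed

section \<open>The exact sequences\<close>

lemma group_D01_plus: "group (map_group D01_plus)"
  using D01_plus_id D01_plus_comp D01_plus_inv D01_D(2)[OF D01_plus_imp_D01]
  by (intro group_map_groupI) blast+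

lemma group_Dfol: "group (map_group Dfol)"
  using Dfol_id Dfol_comp Dfol_inv DT_D(2)[OF Dfol_D] by (intro group_map_groupI) blast+

lemma sig_id: "sig id = id"
  using sigma_unique[OF Dfol_id D01_id] by simp

lemma group_Dlp: "group (map_group Dlp)"
proof (rule group_map_groupI)
  show "id \<in> Dlp" unfolding Dlp_iff using Dfol_id sig_id by blast
  show "h \<circ> k \<in> Dlp" if "h \<in> Dlp" "k \<in> Dlp" for h k
    using that Dfol_comp sig_comp unfolding Dlp_iff by (metis id_comp)
  fix h assume "h \<in> Dlp"
  then have h: "h \<in> Dfol" "sig h = id" unfolding Dlp_iff by blast+
  have "sig (inv_into UNIV h) = id" using sig_inv(1)[OF h(1)] h(2) by auto
  then show "bij h \<and> inv_into UNIV h \<in> Dlp"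
    unfolding Dlp_iff using Dfol_inv[OF h(1)] DT_D(2)[OF Dfol_D[OF h(1)]] by blast
qed

section \<open>The stabilizer as a group isomorphic to the leaf permuting diffeomorphisms\<close>

lemma S_LR_group_simps:
  "carrier (S_LR_group EA f) = S_LR EA f"
  "(\<phi>, h) \<otimes>\<^bsub>S_LR_group EA f\<^esub> (\<eta>, k) = (\<phi> \<circ> \<eta>, h \<circ> k)"
  "\<one>\<^bsub>S_LR_group EA f\<^esub> = (id, id)"
  by (simp_all add: S_LR_group_def DirProd_def)

lemma S_LR_mult:
  "w \<otimes>\<^bsub>S_LR_group EA f\<^esub> z = (fst w \<circ> fst z, snd w \<circ> snd z)"
  using S_LR_group_simps(2)[of "fst w" "snd w" "fst z" "snd z"] by simp

lemma S_LR_D: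
  assumes "w \<in> S_LR EA f"
  shows "snd w \<in> Dfol" "fst w = sig (snd w)" "fst w \<in> D01_plus"
  using assms S_LR_iff[of "fst w" "snd w"] sig_D01_plus by auto

lemma sig_S_LR: "h \<in> Dfol \<Longrightarrow> (sig h, h) \<in> S_LR EA f"
  by (simp add: S_LR_iff)

lemma group_S_LR: "group (S_LR_group EA f)"
proof (rule groupI, unfold S_LR_group_simps(1,3) S_LR_mult)
  show "(fst w \<circ> fst z, snd w \<circ> snd z) \<in> S_LR EA f" if "w \<in> S_LR EA f" "z \<in> S_LR EA f" for w z
    using S_LR_D[OF that(1)] S_LR_D[OF that(2)] Dfol_comp sig_comp by (simp add: S_LR_iff)
  show "(id, id) \<in> S_LR EA f" using sig_S_LR[OF Dfol_id] by (simp add: sig_id)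
  fix w assume w: "w \<in> S_LR EA f"
  let ?k = "inv_into UNIV (snd w)"
  note wD = S_LR_D[OF w]
  have "sig ?k \<circ> sig (snd w) = id" using sig_inv(1)[OF wD(1)] by auto
  moreover have "?k \<circ> snd w = id" using DT_inv_apply(1)[OF Dfol_D[OF wD(1)]] by auto
  ultimately show "\<exists>z\<in>S_LR EA f. (fst z \<circ> fst w, snd z \<circ> snd w) = (id, id)"
    using sig_S_LR[OF Dfol_inv[OF wD(1)]] wD(2) by (intro bexI[of _ "(sig ?k, ?k)"]) simp_all
qed (simp_all add: o_assoc)

lemma snd_hom: "snd \<in> hom (S_LR_group EA f) (map_group Dfol)"
  using S_LR_D(1) by (auto simp: hom_def S_LR_group_simps(1) S_LR_mult)

lemma sigma_hat_eq: "h \<in> Dfol \<Longrightarrow> sigma_hat f h = (sig h, h)"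
  by (simp add: sigma_hat_def sigma_map_eq)

lemma sigma_hat_hom: "sigma_hat f \<in> hom (map_group Dfol) (S_LR_group EA f)"
  using sig_S_LR Dfol_comp sig_comp by (auto simp: hom_def S_LR_group_simps(1) S_LR_mult sigma_hat_eq)

lemma isomorphisms: "group_isomorphisms (S_LR_group EA f) (map_group Dfol) snd (sigma_hat f)"
  unfolding group_isomorphisms_def
proof (intro conjI snd_hom sigma_hat_hom ballI)
  fix w assume "w \<in> carrier (S_LR_group EA f)"
  then have "w \<in> S_LR EA f" by (simp only: S_LR_group_simps(1))
  from S_LR_D(1,2)[OF this] show "sigma_hat f (snd w) = w" by (simp add: sigma_hat_eq prod_eq_iff)
qed (simp add: sigma_hat_def)

lemma theta_hat_hom: "theta_hat scal f \<in> hom (map_group D01_plus) (S_LR_group EA f)"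
  using theta_Dfol sig_theta theta_comp
  by (auto simp: hom_def S_LR_group_simps(1) S_LR_mult theta_hat_def S_LR_iff)

lemma theta_hom: "\<theta> \<in> hom (map_group D01_plus) (map_group Dfol)"
  using theta_Dfol theta_comp by (auto simp: hom_def)

lemma short_exact_S_LR:
  "short_exact (map_group (S_R EA f)) (S_LR_group EA f) (map_group D01_plus) j_incl fst"
  unfolding short_exact_def S_R_eq
proof (intro conjI group_Dlp group_S_LR group_D01_plus)
  have j: "j_incl h \<in> S_LR EA f" if "h \<in> Dlp" for h
    using that unfolding j_incl_def S_LR_iff Dlp_iff by simp
  show "j_incl \<in> mon (map_group Dlp) (S_LR_group EA f)"
    using j by (auto simp: mon_def hom_def S_LR_group_simps(1) S_LR_mult inj_on_def) (simp_all add: j_incl_def)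
  show "fst \<in> epi (S_LR_group EA f) (map_group D01_plus)"
    unfolding epi_def mem_Collect_eq
  proof
    show "fst \<in> hom (S_LR_group EA f) (map_group D01_plus)"
      using S_LR_D(3) by (auto simp: hom_def S_LR_group_simps(1) S_LR_mult)
    show "fst ` carrier (S_LR_group EA f) = carrier (map_group D01_plus)"
      unfolding S_LR_group_simps(1) map_group_simps
    proof
      show "fst ` S_LR EA f \<subseteq> D01_plus" using S_LR_D(3) by blast
      show "D01_plus \<subseteq> fst ` S_LR EA f"
      proof
        fix \<phi> assume "\<phi> \<in> D01_plus"
        \<comment> \<open>The section \<open>theta_hat\<close> supplies the preimage.\<close>
        then have "(\<phi>, \<theta> \<phi>) \<in> S_LR EA f" using sig_S_LR[OF theta_Dfol] sig_theta by metis
        then show "\<phi> \<in> fst ` S_LR EA f" by (rule rev_image_eqI) simp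
      qed
    qed
  qed
  show "j_incl ` carrier (map_group Dlp) = kernel (S_LR_group EA f) (map_group D01_plus) fst"
    unfolding kernel_def S_LR_group_simps(1) map_group_simps
  proof
    show "j_incl ` Dlp \<subseteq> {w \<in> S_LR EA f. fst w = id}" using j by (auto simp: j_incl_def)
    show "{w \<in> S_LR EA f. fst w = id} \<subseteq> j_incl ` Dlp"
    proof
      fix w assume "w \<in> {w \<in> S_LR EA f. fst w = id}"
      then have w: "w \<in> S_LR EA f" "fst w = id" by blast+
      have "snd w \<in> Dlp" unfolding Dlp_iff using S_LR_D(1,2)[OF w(1)] w(2) by simp
      moreover have "w = j_incl (snd w)" using w(2) by (simp add: j_incl_def prod_eq_iff)
      ultimately show "w \<in> j_incl ` Dlp" by blast
    qed
  qed
qed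

lemma short_exact_Dfol:
  "short_exact (map_group Dlp) (map_group Dfol) (map_group D01_plus) id (sigma_map f)"
  unfolding short_exact_def
proof (intro conjI group_Dlp group_Dfol group_D01_plus)
  show "id \<in> mon (map_group Dlp) (map_group Dfol)"
    using subset_DT(4) by (auto simp: mon_def hom_def)
  show "sigma_map f \<in> epi (map_group Dfol) (map_group D01_plus)"
    unfolding epi_def mem_Collect_eq map_group_simps
  proof
    show "sigma_map f \<in> hom (map_group Dfol) (map_group D01_plus)"
      using sig_D01_plus Dfol_comp sig_comp by (auto simp: hom_def sigma_map_eq)
    show "sigma_map f ` Dfol = D01_plus"
    proof
      show "sigma_map f ` Dfol \<subseteq> D01_plus" using sig_D01_plus sigma_map_eq by auto
      show "D01_plus \<subseteq> sigma_map f ` Dfol"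
      proof
        fix \<phi> assume "\<phi> \<in> D01_plus"
        then have "\<theta> \<phi> \<in> Dfol" "sigma_map f (\<theta> \<phi>) = \<phi>" using theta_Dfol sigma_map_eq sig_theta by auto
        then show "\<phi> \<in> sigma_map f ` Dfol" by (metis imageI)
      qed
    qed
  qed
  show "id ` carrier (map_group Dlp) = kernel (map_group Dfol) (map_group D01_plus) (sigma_map f)"
    unfolding kernel_def map_group_simps using Dlp_iff sigma_map_eq by auto
qed

section \<open>Continuity of the homomorphisms\<close>

lemma j_incl_continuous: "continuous_map (DT_topology EA f (S_R EA f)) (S_LR_topology EA f) j_incl"
proof (rule continuous_map_limI)
  fix h and F :: "('e \<Rightarrow> 'e) filter"
  assume "limitin (DT_topology EA f (S_R EA f)) (\<lambda>y. y) h F"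
  then have *: "h \<in> Dlp" "\<forall>\<^sub>F k in F. k \<in> Dlp" "chart_lim EA T EA F (\<lambda>y. y) h"
    unfolding limitin_DT_iff[OF subset_DT(3)] unfolding S_R_eq by blast+
  have j: "j_incl h \<in> S_LR EA f" if "h \<in> Dlp" for h
    using that unfolding j_incl_def S_LR_iff Dlp_iff by simp
  have DT: "\<forall>\<^sub>F k in F. k \<in> DT EA f" using *(2) by (rule eventually_mono) (use subset_DT in blast)
  have "\<forall>\<^sub>F k in F. j_incl k \<in> S_LR EA f" using *(2) by (rule eventually_mono) (rule j)
  moreover have "smooth_lim n F {0..1} {0..1} (\<lambda>k. id) (id :: real \<Rightarrow> real)" for n
    by (rule smooth_lim_const[OF smooth_on_imp_near[OF D01_D(3)[OF D01_id]]])
  then have "limitin (D01_topology D01) (fst \<circ> j_incl) (fst (j_incl h)) F"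
    unfolding j_incl_def o_def fst_conv limitin_D01_iff[OF subset_refl]
    using D01_id by simp
  moreover have "limitin (DT_topology EA f (DT EA f)) (snd \<circ> j_incl) (snd (j_incl h)) F"
    unfolding j_incl_def o_def snd_conv limitin_DT_iff[OF subset_refl] using * DT subset_DT by blast
  ultimately show "limitin (S_LR_topology EA f) j_incl (j_incl h) F"
    unfolding limitin_S_LR_iff using j[OF *(1)] by blast
qed

lemma fst_continuous: "continuous_map (S_LR_topology EA f) (D01_topology D01_plus) fst"
proof (rule continuous_map_limI)
  fix w and F :: "((real \<Rightarrow> real) \<times> ('e \<Rightarrow> 'e)) filter"
  assume "limitin (S_LR_topology EA f) (\<lambda>y. y) w F"
  then have *: "w \<in> S_LR EA f" "\<forall>\<^sub>F z in F. z \<in> S_LR EA f" "limitin (D01_topology D01) fst (fst w) F"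
    unfolding limitin_S_LR_iff by (simp_all add: o_def)
  have "\<forall>\<^sub>F z in F. fst z \<in> D01_plus" using *(2) by (rule eventually_mono) (rule S_LR_D(3))
  then show "limitin (D01_topology D01_plus) fst (fst w) F"
    using *(3) S_LR_D(3)[OF *(1)]
    unfolding limitin_D01_iff[OF subset_refl] limitin_D01_iff[OF D01_plus_subset] by blast
qed

lemma snd_continuous: "continuous_map (S_LR_topology EA f) (DT_topology EA f Dfol) snd"
proof (rule continuous_map_limI)
  fix w and F :: "((real \<Rightarrow> real) \<times> ('e \<Rightarrow> 'e)) filter"
  assume "limitin (S_LR_topology EA f) (\<lambda>y. y) w F"
  then have *: "w \<in> S_LR EA f" "\<forall>\<^sub>F z in F. z \<in> S_LR EA f" "limitin (DT_topology EA f (DT EA f)) snd (snd w) F"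
    unfolding limitin_S_LR_iff by (simp_all add: o_def)
  have "\<forall>\<^sub>F z in F. snd z \<in> Dfol" using *(2) by (rule eventually_mono) (rule S_LR_D(1))
  then show "limitin (DT_topology EA f Dfol) snd (snd w) F"
    using *(3) S_LR_D(1)[OF *(1)]
    unfolding limitin_DT_iff[OF subset_refl] limitin_DT_iff[OF subset_DT(1)] by blast
qed

text \<open>The stabilizer has the subspace topology of a product, so a limit of pairs is a limit in
  each component. Both \<open>sigma_hat\<close> and \<open>theta_hat\<close> are of this
  form.\<close>

lemma S_LR_pair_lim:
  assumes "limitin (D01_topology D01_plus) \<phi> \<phi>0 F" "limitin (DT_topology EA f Dfol) h h0 F"
    and "\<phi>0 = sig h0" "\<forall>\<^sub>F i in F. \<phi> i = sig (h i)"
  shows "limitin (S_LR_topology EA f) (\<lambda>i. (\<phi> i, h i)) (\<phi>0, h0) F"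
proof -
  have \<phi>: "\<phi>0 \<in> D01_plus" "\<forall>\<^sub>F i in F. \<phi> i \<in> D01_plus" "\<forall>n. smooth_lim n F {0..1} {0..1} \<phi> \<phi>0"
    using assms(1) unfolding limitin_D01_iff[OF D01_plus_subset] by blast+
  have h: "h0 \<in> Dfol" "\<forall>\<^sub>F i in F. h i \<in> Dfol" "chart_lim EA T EA F h h0"
    using assms(2) unfolding limitin_DT_iff[OF subset_DT(1)] by blast+
  have "\<forall>\<^sub>F i in F. \<phi> i \<in> D01" using \<phi>(2) by (rule eventually_mono) (rule D01_plus_imp_D01)
  moreover have "\<forall>\<^sub>F i in F. h i \<in> DT EA f" using h(2) by (rule eventually_mono) (rule Dfol_D)
  moreover have "\<forall>\<^sub>F i in F. (\<phi> i, h i) \<in> S_LR EA f"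
    using h(2) assms(4) by (rule eventually_elim2) (simp add: S_LR_iff)
  ultimately show ?thesis
    unfolding limitin_S_LR_iff o_def fst_conv snd_conv limitin_D01_iff[OF subset_refl] limitin_DT_iff[OF subset_refl]
    using \<phi>(3) h(3) D01_plus_imp_D01[OF \<phi>(1)] Dfol_D[OF h(1)] sig_S_LR[OF h(1)] assms(3) by blast
qed

lemma sigma_hat_continuous: "continuous_map (DT_topology EA f Dfol) (S_LR_topology EA f) (sigma_hat f)"
proof (rule continuous_map_eq)
  show "continuous_map (DT_topology EA f Dfol) (S_LR_topology EA f) (\<lambda>h. (sig h, h))"
  proof (rule continuous_map_limI)
    fix h and F :: "('e \<Rightarrow> 'e) filter"
    assume "limitin (DT_topology EA f Dfol) (\<lambda>y. y) h F"
    from S_LR_pair_lim[OF sig_lim[OF this] this refl]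
    show "limitin (S_LR_topology EA f) (\<lambda>h. (sig h, h)) (sig h, h) F" by simp
  qed
qed (simp add: topspace_DT[OF subset_DT(1)] sigma_hat_eq)

lemma theta_continuous: "continuous_map (D01_topology D01_plus) (DT_topology EA f Dfol) \<theta>"
  by (rule continuous_map_limI) (rule theta_lim)

lemma theta_hat_continuous: "continuous_map (D01_topology D01_plus) (S_LR_topology EA f) (theta_hat scal f)"
proof (rule continuous_map_limI)
  fix \<phi> and F :: "(real \<Rightarrow> real) filter"
  assume lim: "limitin (D01_topology D01_plus) (\<lambda>y. y) \<phi> F"
  then have *: "\<phi> \<in> D01_plus" "\<forall>\<^sub>F \<eta> in F. \<eta> \<in> D01_plus" unfolding limitin_D01_iff[OF D01_plus_subset] by blast+
  have ev: "\<forall>\<^sub>F \<eta> in F. \<eta> = sig (\<theta> \<eta>)" using *(2) by (rule eventually_mono) (rule sig_theta[symmetric])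
  from S_LR_pair_lim[OF lim theta_lim[OF lim] sig_theta[OF *(1), symmetric] ev]
  show "limitin (S_LR_topology EA f) (theta_hat scal f) (theta_hat scal f \<phi>) F"
    unfolding theta_hat_def[abs_def] .
qed

lemma homeomorphic_snd: "homeomorphic_maps (S_LR_topology EA f) (DT_topology EA f Dfol) snd (sigma_hat f)"
  unfolding homeomorphic_maps_def
proof (intro conjI snd_continuous sigma_hat_continuous ballI)
  fix w assume "w \<in> topspace (S_LR_topology EA f)"
  then have "w \<in> S_LR EA f" by (simp add: S_LR_topology_def)
  from S_LR_D(1,2)[OF this] show "sigma_hat f (snd w) = w" by (simp add: sigma_hat_eq prod_eq_iff)
qed (simp add: sigma_hat_def)

end

theorem theorem5p7:
  fixes p :: "'e::topological_space \<Rightarrow> 'b::t2_space"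
    and add :: "'e \<Rightarrow> 'e \<Rightarrow> 'e"
    and scal :: "real \<Rightarrow> 'e \<Rightarrow> 'e"
    and A :: "('b, 'm::{real_normed_vector,heine_borel}) chart set"
    and \<Phi> :: "('b set \<times> ('e \<Rightarrow> 'v::euclidean_space)) set"
    and f :: "'e \<Rightarrow> real"
    and EA :: "('e, 'm \<times> 'v) chart set"
  assumes "smooth_vector_bundle p add scal A \<Phi>"
    and "EA = bundle_atlas p A \<Phi>"
    and "compact (UNIV :: 'b set)"
    and "smooth_map EA UNIV line_atlas UNIV f"
    and "homogeneous scal 2 f"
    and "definite scal f"
  shows
   "(\<forall>h\<in>D_fol EA f. \<exists>!\<phi>. \<phi> \<in> D01_plus \<and> (\<forall>x\<in>tube f. \<phi> (f x) = f (h x))) \<and>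
    short_exact (map_group (S_R EA f)) (S_LR_group EA f) (map_group D01_plus) j_incl fst \<and>
    short_exact (map_group (D_lp EA f)) (map_group (D_fol EA f)) (map_group D01_plus) id (sigma_map f) \<and>
    continuous_map (DT_topology EA f (S_R EA f)) (S_LR_topology EA f) j_incl \<and>
    continuous_map (S_LR_topology EA f) (D01_topology D01_plus) fst \<and>
    continuous_map (DT_topology EA f (D_fol EA f)) (D01_topology D01_plus) (sigma_map f) \<and>
    group_isomorphisms (S_LR_group EA f) (map_group (D_fol EA f)) snd (sigma_hat f) \<and>
    homeomorphic_maps (S_LR_topology EA f) (DT_topology EA f (D_fol EA f)) snd (sigma_hat f) \<and>
    S_R EA f = D_lp EA f \<and>
    (\<forall>h\<in>S_R EA f. snd (j_incl h) = id h) \<and>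
    (\<forall>w\<in>S_LR EA f. sigma_map f (snd w) = id (fst w)) \<and>
    theta_hat scal f \<in> hom (map_group D01_plus) (S_LR_group EA f) \<and>
    continuous_map (D01_topology D01_plus) (S_LR_topology EA f) (theta_hat scal f) \<and>
    (\<forall>\<phi>\<in>D01_plus. fst (theta_hat scal f \<phi>) = \<phi>) \<and>
    theta_map scal f \<in> hom (map_group D01_plus) (map_group (D_fol EA f)) \<and>
    continuous_map (D01_topology D01_plus) (DT_topology EA f (D_fol EA f)) (theta_map scal f) \<and>
    (\<forall>\<phi>\<in>D01_plus. sigma_map f (theta_map scal f \<phi>) = \<phi>) \<and>
    strong_deformation_retract_pair (D_lp EA f) (D_lp_bd EA f)
       (DT_topology EA f (D_fol EA f)) (D_fol_bd EA f)"
proof -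
  interpret B: smooth_vector_bundle p add scal A \<Phi> by (rule assms(1))
  interpret tube_bundle p add scal A \<Phi> f
    by unfold_locales (use assms(4-6) in \<open>simp_all only: assms(2)\<close>)
  have "\<exists>!\<phi>. \<phi> \<in> D01_plus \<and> (\<forall>x\<in>T. \<phi> (f x) = f (h x))" if h: "h \<in> Dfol" for h
  proof (rule ex1I)
    show "sig h \<in> D01_plus \<and> (\<forall>x\<in>T. sig h (f x) = f (h x))" using sig_D01_plus[OF h] sig_f[OF h] by blast
    show "\<phi> = sig h" if "\<phi> \<in> D01_plus \<and> (\<forall>x\<in>T. \<phi> (f x) = f (h x))" for \<phi>
      using sigma_unique[OF h D01_plus_imp_D01] that by blast
  qed
  then show ?thesis
    unfolding assms(2)
    by (intro conjI ballI short_exact_S_LR short_exact_Dfol j_incl_continuous fst_continuous sigma_continuous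
        isomorphisms homeomorphic_snd S_R_eq theta_hat_hom theta_hat_continuous theta_hom theta_continuous
        deformation_retract)
      (simp_all add: j_incl_def theta_hat_def sigma_map_eq S_LR_D(1) S_LR_D(2)[symmetric] theta_Dfol sig_theta)
qed

end
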